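(* Let $A=(a_{ij})_{i,j\in I}$, $I=\{1,\dots,N\}$, be a symmetrizable generalized Cartan matrix with symmetrizer $D=\mathrm{diag}(d_1,\dots,d_N)$, where the $d_i$ are relatively prime positive integers and $d_ia_{ij}=d_ja_{ji}$ for all $i,j$. Let $Y^+_\hbar(\mathfrak g_Q)$ be the $\mathbb C[\hbar]$-algebra with generators $x^+_{k,r}$ and relations (Y1), (Y2) given in the context, and let $\widetilde{\mathcal{SH}}$ be the sign-twisted shuffle algebra over $\mathbb C[\hbar]$ attached to the quiver with symmetrizer $(Q,L)$ of $(A,D)$, with parameters specialized to $t_1=t_2=\hbar/2$, $t_3=-\hbar$, and with $\widetilde{\mathcal{SH}}^{sph}\subseteq\widetilde{\mathcal{SH}}$ its spherical subalgebra (see context). Then the assignment $$x^+_{k,r}\longmapsto(\lambda^{(k)})^r\in\mathcal{SH}_{e_k}=\mathbb C[\hbar][\lambda^{(k)}],\qquad k\in I,\ r\in\mathbb N,$$ extends to a well-defined surjective algebra homomorphism $Y^+_\hbar(\mathfrak g_Q)\to\widetilde{\mathcal{SH}}^{sph}|_{t_1=t_2=\hbar/2,\ t_3=-\hbar}$.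
   Context: $\mathbb N=\{0,1,2,\dots\}$ for the index $r$ and for dimension vectors. **Cartan matrix.** $a_{ii}=2$; $a_{ij}\le0$ (integers) for $i\ne j$; $a_{ij}\neq0\iff a_{ji}\ne0$; $DA$ symmetric. $\mathfrak g_Q$ denotes the associated symmetrizable Kac–Moody algebra. **The algebra $Y^+_\hbar(\mathfrak g_Q)$.** It is the quotient of the free algebra on $x^+_{k,r}$ ($k\in I$, $r\in\mathbb N$) by the following relations (coefficientwise), where $x_k^+(u)=\hbar\sum_{r\ge0}x^+_{k,r}u^{-r-1}$: (Y1) for all $k,l\in I$: $$\Big(u-v-\tfrac{d_ka_{kl}\hbar}{2}\Big)x_k^+(u)x_l^+(v)=\Big(u-v+\tfrac{d_ka_{kl}\hbar}{2}\Big)x_l^+(v)x_k^+(u)+\hbar\Big([x^+_{k,0},x^+_l(v)]-[x^+_k(u),x^+_{l,0}]\Big);$$ (Y2) for all $k\ne l\in I$: $$\sum_{\sigma\in\mathfrak S_{1-a_{kl}}}[x_k^+(u_{\sigma(1)}),[x_k^+(u_{\sigma(2)}),[\cdots,[x_k^+(u_{\sigma(1-a_{kl})}),x_l^+(v)]\cdots]]]=0 .$$ **Quiver, symmetrizer and weights.** $Q=(I,H)$ has vertex set $I$; for $i<j$ with $a_{ij}\neq 0$ there are $n_{ij}=|\gcd(a_{ij},a_{ji})|$ arrows from $i$ to $j$ (none if $a_{ij}=0$), and no other arrows. An arrow $h$ goes from $\mathrm{out}(h)$ to $\mathrm{in}(h)$; to each $h$ there is an associated reversed arrow $h^*$. The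 symmetrizer is $l_{ij}=|a_{ij}/\gcd(a_{ij},a_{ji})|$ (for $i\ne j$ with $a_{ij}\ne0$). Weights: $\mathbf m_i=d_i$; for $i<j$ with $a_{ij}\ne0$, put $\delta=\mathbf m_il_{ij}=\mathbf m_jl_{ji}$, $n=n_{ij}$, number the arrows $h_1,\dots,h_n$ from $i$ to $j$, and set $$\mathbf m_{h_p}=(n+2-2p)\delta,\qquad\mathbf m_{h_p^*}=(-n+2p)\delta,\qquad p=1,\dots,n.$$ **Sign-twisted shuffle algebra.** With $t_1=t_2=\hbar/2$, $t_3=-\hbar$, put $\widetilde{\mathcal{SH}}=\bigoplus_{v\in\mathbb N^I}\mathcal{SH}_v$ where $\mathcal{SH}_v=\mathbb C[\hbar][\lambda^i_s]_{i\in I,1\le s\le v^i}^{\mathfrak S_v}$, $\mathfrak S_v=\prod_i\mathfrak S_{v^i}$. For $f_1\in\mathcal{SH}_{v_1}$ in variables $\lambda'^i_s$ and $f_2\in\mathcal{SH}_{v_2}$ in variables $\lambda''^i_t$, set $\lambda'^i_s=\lambda^i_s$, $\lambda''^i_t=\lambda^i_{t+v_1^i}$, and $$f_1\star f_2=\sum_{\sigma\in\mathrm{Sh}(v_1,v_2)}\sigma\big(f_1\,f_2\,\widetilde{\mathrm{fac}}_1\,\widetilde{\mathrm{fac}}_2\big)\in\mathcal{SH}_{v_1+v_2},\qquad \widetilde{\mathrm{fac}}_1=\prod_{i\in I}\prod_{s=1}^{v_1^i}\prod_{t=1}^{v_2^i}\frac{\lambda'^i_s-\lambda''^i_t-\mathbf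 m_it_3}{\lambda'^i_s-\lambda''^i_t},$$ $$\widetilde{\mathrm{fac}}_2=\prod_{h\in H}\Big(\prod_{s=1}^{v_1^{\mathrm{out}(h)}}\prod_{t=1}^{v_2^{\mathrm{in}(h)}}(\lambda''^{\mathrm{in}(h)}_t-\lambda'^{\mathrm{out}(h)}_s+\mathbf m_ht_1)\prod_{s=1}^{v_1^{\mathrm{in}(h)}}\prod_{t=1}^{v_2^{\mathrm{out}(h)}}(\lambda'^{\mathrm{in}(h)}_s-\lambda''^{\mathrm{out}(h)}_t-\mathbf m_{h^*}t_2)\Big),$$ where $\mathrm{Sh}(v_1,v_2)=\prod_i\mathrm{Sh}(v_1^i,v_2^i)$ and $\mathrm{Sh}(p,q)\subset\mathfrak S_{p+q}$ is the set of $(p,q)$-shuffles (permutations preserving the relative order of $\{1,\dots,p\}$ and of $\{p+1,\dots,p+q\}$). This is an associative $\mathbb C[\hbar]$-algebra under $\star$. **Spherical subalgebra.** $e_k\in\mathbb N^I$ is the dimension vector equal to $1$ at $k$ and $0$ elsewhere, and $\mathcal{SH}_{e_k}=\mathbb C[\hbar][\lambda^{(k)}]$ with $\lambda^{(k)}=\lambda^k_1$. $\widetilde{\mathcal{SH}}^{sph}$ is the subalgebra of $\widetilde{\mathcal{SH}}$ generated by the $\mathcal{SH}_{e_k}$, $k\in I$. *)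

theory Defs
  imports
    "HOL-Algebra.Algebra"
    "HOL-Algebra.Algebraic_Closure_Type"
    "HOL-Combinatorics.Permutations"
    "HOL-Computational_Algebra.Computational_Algebra"
    "HOL-Library.Poly_Mapping"
    "HOL-Library.Product_Lexorder"
begin

section \<open>Associative algebras over a commutative ring\<close>

text \<open>The locale \<^locale>\<open>algebra\<close> of HOL-Algebra is restricted to commutative algebras.\<close>

locale assoc_algebra = module R M + ring M for R and M (structure) +
  assumes smult_mult_left:
      "\<lbrakk>c \<in> carrier R; x \<in> carrier M; y \<in> carrier M\<rbrakk> \<Longrightarrow>
        (c \<odot>\<^bsub>M\<^esub> x) \<otimes>\<^bsub>M\<^esub> y = c \<odot>\<^bsub>M\<^esub> (x \<otimes>\<^bsub>M\<^esub> y)"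
    and smult_mult_right:
      "\<lbrakk>c \<in> carrier R; x \<in> carrier M; y \<in> carrier M\<rbrakk> \<Longrightarrow>
        x \<otimes>\<^bsub>M\<^esub> (c \<odot>\<^bsub>M\<^esub> y) = c \<odot>\<^bsub>M\<^esub> (x \<otimes>\<^bsub>M\<^esub> y)"

locale assoc_algebra_hom = A: assoc_algebra R A + B: assoc_algebra R B
  for R and A and B and h +
  assumes hom_ring: "h \<in> ring_hom A B"
    and hom_smult: "\<lbrakk>c \<in> carrier R; x \<in> carrier A\<rbrakk> \<Longrightarrow> h (c \<odot>\<^bsub>A\<^esub> x) = c \<odot>\<^bsub>B\<^esub> h x"

text \<open>Closure under zero and additive inverses follows from the scalars \<open>0\<close> and \<open>-1\<close>.\<close>

inductive_set generated_subalgebra ::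
    "('r, 'm) ring_scheme \<Rightarrow> ('r, 'a, 'n) module_scheme \<Rightarrow> 'a set \<Rightarrow> 'a set"
  for R and A and S where
  one: "\<one>\<^bsub>A\<^esub> \<in> generated_subalgebra R A S"
| incl: "x \<in> S \<Longrightarrow> x \<in> generated_subalgebra R A S"
| add: "\<lbrakk>x \<in> generated_subalgebra R A S; y \<in> generated_subalgebra R A S\<rbrakk>
    \<Longrightarrow> x \<oplus>\<^bsub>A\<^esub> y \<in> generated_subalgebra R A S"
| mult: "\<lbrakk>x \<in> generated_subalgebra R A S; y \<in> generated_subalgebra R A S\<rbrakk>
    \<Longrightarrow> x \<otimes>\<^bsub>A\<^esub> y \<in> generated_subalgebra R A S"
| smult: "\<lbrakk>c \<in> carrier R; x \<in> generated_subalgebra R A S\<rbrakk>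
    \<Longrightarrow> c \<odot>\<^bsub>A\<^esub> x \<in> generated_subalgebra R A S"

definition quotient_algebra ::
    "('r, 'a, 'n) module_scheme \<Rightarrow> 'a set \<Rightarrow> ('r, 'a set) module" where
  "quotient_algebra A J = ring.extend (A Quot J)
     (module.fields (\<lambda>c C. \<Union>x\<in>C. J +>\<^bsub>A\<^esub> (c \<odot>\<^bsub>A\<^esub> x)))"

abbreviation Chbar :: "complex poly ring" where
  "Chbar \<equiv> ring_of_type_algebra"

definition hbar :: "complex poly" where
  "hbar = [:0, 1:]"


section \<open>Symmetrizable generalized Cartan matrices\<close>

text \<open>The ordered index set \<open>{1,\<dots>,N}\<close> is modelled by an arbitrary finite linearly ordered type.\<close>

definition symmetrizable_gcm ::
    "('i::finite \<Rightarrow> 'i \<Rightarrow> int) \<Rightarrow> ('i \<Rightarrow> int) \<Rightarrow> bool" where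
  "symmetrizable_gcm a d \<longleftrightarrow>
     (\<forall>i. a i i = 2) \<and>
     (\<forall>i j. i \<noteq> j \<longrightarrow> a i j \<le> 0) \<and>
     (\<forall>i j. a i j \<noteq> 0 \<longleftrightarrow> a j i \<noteq> 0) \<and>
     (\<forall>i. d i > 0) \<and>
     Gcd (range d) = 1 \<and>
     (\<forall>i j. d i * a i j = d j * a j i)"


section \<open>The algebra \<open>Y\<^sup>+\<close> by generators and relations\<close>

text \<open>Words are wrapped in a type of their own so that they form a monoid under concatenation;
  the finitely supported functions on words are then the free algebra, with convolution product.\<close>

datatype 'g word = Word "'g list"

fun letters :: "'g word \<Rightarrow> 'g list" where
  "letters (Word xs) = xs"

instantiation word :: (type) monoid_add
begin

definition "0 = Word []"
definition "v + w = Word (letters v @ letters w)"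

instance
proof
  fix u v w :: "'a word"
  show "u + v + w = u + (v + w)"
    by (simp add: plus_word_def)
  show "0 + u = u" "u + 0 = u"
    by (cases u; simp add: plus_word_def zero_word_def)+
qed

end

type_synonym 'i free_alg = "('i \<times> nat) word \<Rightarrow>\<^sub>0 complex poly"

definition free_algebra :: "(complex poly, 'i free_alg) module" where
  "free_algebra = ring.extend ring_of_type_algebra
     (module.fields (\<lambda>c x. Poly_Mapping.single 0 c * x))"

definition free_gen :: "'i \<Rightarrow> nat \<Rightarrow> 'i free_alg" where
  "free_gen k r = Poly_Mapping.single (Word [(k, r)]) 1"

abbreviation free_const :: "complex poly \<Rightarrow> 'i free_alg" where
  "free_const c \<equiv> Poly_Mapping.single 0 c"

definition commutator :: "'a::ring \<Rightarrow> 'a \<Rightarrow> 'a" where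
  "commutator x y = x * y - y * x"

text \<open>\<open>gen_series k p\<close> is the coefficient of \<open>u\<^sup>p\<close> (\<open>p\<close> an integer) in
  \<open>x\<^sub>k(u) = \<hbar> \<Sum>\<^sub>r x\<^sub>k\<^sub>,\<^sub>r u\<^bsup>-r-1\<^esup>\<close>.  The factor \<open>\<hbar>\<close> is part of the series,
  so the relations below carry the corresponding powers of \<open>\<hbar>\<close>.\<close>

definition gen_series :: "'i \<Rightarrow> int \<Rightarrow> 'i free_alg" where
  "gen_series k p = (if p < 0 then free_const hbar * free_gen k (nat (- p - 1)) else 0)"

text \<open>Coefficient of \<open>u\<^sup>p v\<^sup>q\<close> in the difference of the two sides of
  \<open>(u - v - c) x\<^sub>k(u) x\<^sub>l(v) =
    (u - v + c) x\<^sub>l(v) x\<^sub>k(u) + \<hbar> ([x\<^sub>k\<^sub>,\<^sub>0, x\<^sub>l(v)] - [x\<^sub>k(u), x\<^sub>l\<^sub>,\<^sub>0])\<close>,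
  where \<open>c = d\<^sub>k a\<^sub>k\<^sub>l \<hbar> / 2\<close>.\<close>

definition Y1_coeff ::
    "('i \<Rightarrow> 'i \<Rightarrow> int) \<Rightarrow> ('i \<Rightarrow> int) \<Rightarrow> 'i \<Rightarrow> 'i \<Rightarrow> int \<Rightarrow> int \<Rightarrow> 'i free_alg" where
  "Y1_coeff a d k l p q =
     (let c = free_const (Polynomial.smult (of_int (d k * a k l) / 2) hbar);
          F = (\<lambda>p q. gen_series k p * gen_series l q);
          G = (\<lambda>p q. gen_series l q * gen_series k p)
      in (F (p - 1) q - F p (q - 1) - c * F p q)
         - (G (p - 1) q - G p (q - 1) + c * G p q)
         - free_const hbar *
             ((if p = 0 then commutator (free_gen k 0) (gen_series l q) else 0)
              - (if q = 0 then commutator (gen_series k p) (free_gen l 0) else 0)))"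

text \<open>Coefficient of \<open>u\<^sub>1\<^bsup>p 1\<^esup> \<cdots> u\<^sub>n\<^bsup>p n\<^esup> v\<^sup>q\<close>, \<open>n = 1 - a\<^sub>k\<^sub>l\<close>, in
  \<open>\<Sum>\<^sub>\<sigma> [x\<^sub>k(u\<^bsub>\<sigma>(1)\<^esub>), [\<cdots>, [x\<^sub>k(u\<^bsub>\<sigma>(n)\<^esub>), x\<^sub>l(v)]\<cdots>]]\<close>.\<close>

definition Y2_coeff ::
    "('i \<Rightarrow> 'i \<Rightarrow> int) \<Rightarrow> 'i \<Rightarrow> 'i \<Rightarrow> (nat \<Rightarrow> int) \<Rightarrow> int \<Rightarrow> 'i free_alg" where
  "Y2_coeff a k l p q =
     (let n = nat (1 - a k l)
      in \<Sum>\<sigma> | \<sigma> permutes {1..n}.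
           foldr (\<lambda>m y. commutator (gen_series k (p (\<sigma> m))) y) [1..<Suc n] (gen_series l q))"

definition Y_relations ::
    "('i \<Rightarrow> 'i \<Rightarrow> int) \<Rightarrow> ('i \<Rightarrow> int) \<Rightarrow> 'i free_alg set" where
  "Y_relations a d =
     {Y1_coeff a d k l p q | k l p q. True} \<union> {Y2_coeff a k l p q | k l p q. k \<noteq> l}"

definition Y_ideal :: "('i \<Rightarrow> 'i \<Rightarrow> int) \<Rightarrow> ('i \<Rightarrow> int) \<Rightarrow> 'i free_alg set" where
  "Y_ideal a d = Idl\<^bsub>free_algebra\<^esub> (Y_relations a d)"

definition Y_plus ::
    "('i \<Rightarrow> 'i \<Rightarrow> int) \<Rightarrow> ('i \<Rightarrow> int) \<Rightarrow> (complex poly, 'i free_alg set) module" where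
  "Y_plus a d = quotient_algebra free_algebra (Y_ideal a d)"

definition Y_gen ::
    "('i \<Rightarrow> 'i \<Rightarrow> int) \<Rightarrow> ('i \<Rightarrow> int) \<Rightarrow> 'i \<Rightarrow> nat \<Rightarrow> 'i free_alg set" where
  "Y_gen a d k r = Y_ideal a d +>\<^bsub>free_algebra\<^esub> free_gen k r"


section \<open>The quiver with symmetrizer and its weights\<close>

definition num_arrows :: "('i \<Rightarrow> 'i \<Rightarrow> int) \<Rightarrow> 'i \<Rightarrow> 'i \<Rightarrow> nat" where
  "num_arrows a i j = nat \<bar>gcd (a i j) (a j i)\<bar>"

definition quiver_symmetrizer :: "('i \<Rightarrow> 'i \<Rightarrow> int) \<Rightarrow> 'i \<Rightarrow> 'i \<Rightarrow> int" where
  "quiver_symmetrizer a i j = \<bar>a i j div gcd (a i j) (a j i)\<bar>"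

text \<open>The triple \<open>(i, j, p)\<close> is the \<open>p\<close>-th arrow from \<open>i\<close> to \<open>j\<close>.\<close>

type_synonym 'i arrow = "'i \<times> 'i \<times> nat"

definition arrows :: "('i::linorder \<Rightarrow> 'i \<Rightarrow> int) \<Rightarrow> 'i arrow set" where
  "arrows a = {(i, j, p). i < j \<and> a i j \<noteq> 0 \<and> 1 \<le> p \<and> p \<le> num_arrows a i j}"

definition out_vertex :: "'i arrow \<Rightarrow> 'i" where
  "out_vertex = (\<lambda>(i, j, p). i)"

definition in_vertex :: "'i arrow \<Rightarrow> 'i" where
  "in_vertex = (\<lambda>(i, j, p). j)"

definition arrow_weight :: "('i \<Rightarrow> 'i \<Rightarrow> int) \<Rightarrow> ('i \<Rightarrow> int) \<Rightarrow> 'i arrow \<Rightarrow> int" where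
  "arrow_weight a d = (\<lambda>(i, j, p).
     (int (num_arrows a i j) + 2 - 2 * int p) * (d i * quiver_symmetrizer a i j))"

definition reversed_arrow_weight ::
    "('i \<Rightarrow> 'i \<Rightarrow> int) \<Rightarrow> ('i \<Rightarrow> int) \<Rightarrow> 'i arrow \<Rightarrow> int" where
  "reversed_arrow_weight a d = (\<lambda>(i, j, p).
     (- int (num_arrows a i j) + 2 * int p) * (d i * quiver_symmetrizer a i j))"


section \<open>The sign-twisted shuffle algebra\<close>

text \<open>Polynomials over \<open>\<complex>[\<hbar>]\<close> in the variables \<open>\<lambda>\<^sup>i\<^sub>s\<close>, indexed by the pairs \<open>(i, s)\<close>.\<close>

type_synonym 'i mpoly = "(('i \<times> nat) \<Rightarrow>\<^sub>0 nat) \<Rightarrow>\<^sub>0 complex poly"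

definition mpoly_const :: "complex poly \<Rightarrow> 'i mpoly" where
  "mpoly_const c = Poly_Mapping.single 0 c"

definition mpoly_var :: "'i \<times> nat \<Rightarrow> 'i mpoly" where
  "mpoly_var x = Poly_Mapping.single (Poly_Mapping.single x 1) 1"

definition mpoly_vars :: "'i mpoly \<Rightarrow> ('i \<times> nat) set" where
  "mpoly_vars f = (\<Union>m\<in>Poly_Mapping.keys f. Poly_Mapping.keys m)"

definition mpoly_rename :: "('i \<times> nat \<Rightarrow> 'i \<times> nat) \<Rightarrow> 'i mpoly \<Rightarrow> 'i mpoly" where
  "mpoly_rename \<rho> f = (\<Sum>m\<in>Poly_Mapping.keys f. mpoly_const (Poly_Mapping.lookup f m) *
     (\<Prod>x\<in>Poly_Mapping.keys m. mpoly_var (\<rho> x) ^ Poly_Mapping.lookup m x))"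

definition SH_component :: "('i \<Rightarrow> nat) \<Rightarrow> 'i mpoly set" where
  "SH_component v = {f. mpoly_vars f \<subseteq> {(i, s). 1 \<le> s \<and> s \<le> v i} \<and>
     (\<forall>\<pi>. (\<forall>i. \<pi> i permutes {1..v i}) \<longrightarrow> mpoly_rename (\<lambda>(i, s). (i, \<pi> i s)) f = f)}"

definition shuffles2 :: "nat \<Rightarrow> nat \<Rightarrow> (nat \<Rightarrow> nat) set" where
  "shuffles2 p q = {\<sigma>. \<sigma> permutes {1..p + q} \<and>
     strict_mono_on {1..p} \<sigma> \<and> strict_mono_on {p + 1..p + q} \<sigma>}"

definition shuffles_fam :: "('i \<Rightarrow> nat) \<Rightarrow> ('i \<Rightarrow> nat) \<Rightarrow> ('i \<Rightarrow> nat \<Rightarrow> nat) set" where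
  "shuffles_fam v1 v2 = {\<sigma>. \<forall>i. \<sigma> i \<in> shuffles2 (v1 i) (v2 i)}"

definition fract_of :: "'a::idom \<Rightarrow> 'a fract" where
  "fract_of f = Fraction_Field.Fract f 1"

definition fract_const ::
    "complex poly \<Rightarrow> 'i::{finite,linorder} mpoly fract" where
  "fract_const c = fract_of (mpoly_const c)"

text \<open>In the next two definitions \<open>x i s\<close> and \<open>y i t\<close> are the values of
  \<open>\<lambda>'\<^sup>i\<^sub>s\<close> and \<open>\<lambda>''\<^sup>i\<^sub>t\<close>.\<close>

definition fac1 ::
    "('i \<Rightarrow> int) \<Rightarrow> complex poly \<Rightarrow> ('i \<Rightarrow> nat) \<Rightarrow> ('i \<Rightarrow> nat) \<Rightarrow>
     ('i \<Rightarrow> nat \<Rightarrow> 'i mpoly fract) \<Rightarrow> ('i \<Rightarrow> nat \<Rightarrow> 'i mpoly fract) \<Rightarrow>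
     'i::{finite,linorder} mpoly fract" where
  "fac1 d t3 v1 v2 x y =
     (\<Prod>i\<in>UNIV. \<Prod>s=1..v1 i. \<Prod>t=1..v2 i.
        (x i s - y i t - of_int (d i) * fract_const t3) / (x i s - y i t))"

definition fac2 ::
    "('i \<Rightarrow> 'i \<Rightarrow> int) \<Rightarrow> ('i \<Rightarrow> int) \<Rightarrow> complex poly \<Rightarrow> complex poly \<Rightarrow>
     ('i \<Rightarrow> nat) \<Rightarrow> ('i \<Rightarrow> nat) \<Rightarrow>
     ('i \<Rightarrow> nat \<Rightarrow> 'i mpoly fract) \<Rightarrow> ('i \<Rightarrow> nat \<Rightarrow> 'i mpoly fract) \<Rightarrow>
     'i::{finite,linorder} mpoly fract" where
  "fac2 a d t1 t2 v1 v2 x y =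
     (\<Prod>h\<in>arrows a.
        (\<Prod>s=1..v1 (out_vertex h). \<Prod>t=1..v2 (in_vertex h).
           y (in_vertex h) t - x (out_vertex h) s
             + of_int (arrow_weight a d h) * fract_const t1) *
        (\<Prod>s=1..v1 (in_vertex h). \<Prod>t=1..v2 (out_vertex h).
           x (in_vertex h) s - y (out_vertex h) t
             - of_int (reversed_arrow_weight a d h) * fract_const t2))"

text \<open>The summand of the shuffle product indexed by \<open>\<sigma>\<close>: the permutation \<open>\<sigma>\<close> acts by
  \<open>\<lambda>\<^sup>i\<^sub>s \<mapsto> \<lambda>\<^sup>i\<^bsub>\<sigma>(s)\<^esub>\<close>, so \<open>\<lambda>'\<^sup>i\<^sub>s = \<lambda>\<^sup>i\<^sub>s\<close> becomes \<open>\<lambda>\<^sup>i\<^bsub>\<sigma>(s)\<^esub>\<close> and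
  \<open>\<lambda>''\<^sup>i\<^sub>t = \<lambda>\<^sup>i\<^bsub>t+v1 i\<^esub>\<close> becomes \<open>\<lambda>\<^sup>i\<^bsub>\<sigma>(t+v1 i)\<^esub>\<close>.\<close>

definition shuffle_summand ::
    "('i \<Rightarrow> 'i \<Rightarrow> int) \<Rightarrow> ('i \<Rightarrow> int) \<Rightarrow> complex poly \<Rightarrow> complex poly \<Rightarrow> complex poly \<Rightarrow>
     ('i \<Rightarrow> nat) \<Rightarrow> ('i \<Rightarrow> nat) \<Rightarrow> 'i mpoly \<Rightarrow> 'i mpoly \<Rightarrow> ('i \<Rightarrow> nat \<Rightarrow> nat) \<Rightarrow>
     'i::{finite,linorder} mpoly fract" where
  "shuffle_summand a d t1 t2 t3 v1 v2 f1 f2 \<sigma> =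
     (let x = (\<lambda>i s. fract_of (mpoly_var (i, \<sigma> i s)));
          y = (\<lambda>i t. fract_of (mpoly_var (i, \<sigma> i (t + v1 i))))
      in fract_of (mpoly_rename (\<lambda>(i, s). (i, \<sigma> i s)) f1) *
         fract_of (mpoly_rename (\<lambda>(i, t). (i, \<sigma> i (t + v1 i))) f2) *
         fac1 d t3 v1 v2 x y * fac2 a d t1 t2 v1 v2 x y)"

text \<open>The sum over all shuffles lies in the polynomial ring, although its summands have
  denominators; \<open>shuffle_product\<close> is that polynomial.\<close>

definition shuffle_product ::
    "('i \<Rightarrow> 'i \<Rightarrow> int) \<Rightarrow> ('i \<Rightarrow> int) \<Rightarrow> complex poly \<Rightarrow> complex poly \<Rightarrow> complex poly \<Rightarrow>
     ('i \<Rightarrow> nat) \<Rightarrow> ('i \<Rightarrow> nat) \<Rightarrow> 'i mpoly \<Rightarrow> 'i mpoly \<Rightarrow> 'i::{finite,linorder} mpoly" where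
  "shuffle_product a d t1 t2 t3 v1 v2 f1 f2 =
     (THE f. fract_of f =
        (\<Sum>\<sigma>\<in>shuffles_fam v1 v2. shuffle_summand a d t1 t2 t3 v1 v2 f1 f2 \<sigma>))"

text \<open>Elements of the direct sum over all dimension vectors are finitely supported families.\<close>

type_synonym 'i shuffle_elem = "('i \<Rightarrow> nat) \<Rightarrow>\<^sub>0 'i mpoly"

definition shuffle_algebra ::
    "('i::{finite,linorder} \<Rightarrow> 'i \<Rightarrow> int) \<Rightarrow> ('i \<Rightarrow> int) \<Rightarrow>
     complex poly \<Rightarrow> complex poly \<Rightarrow> complex poly \<Rightarrow>
     (complex poly, 'i shuffle_elem) module" where
  "shuffle_algebra a d t1 t2 t3 = \<lparr>
     carrier = {F. \<forall>v. Poly_Mapping.lookup F v \<in> SH_component v},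
     monoid.mult = (\<lambda>F G. \<Sum>v1\<in>Poly_Mapping.keys F. \<Sum>v2\<in>Poly_Mapping.keys G.
        Poly_Mapping.single (\<lambda>i. v1 i + v2 i)
          (shuffle_product a d t1 t2 t3 v1 v2
             (Poly_Mapping.lookup F v1) (Poly_Mapping.lookup G v2))),
     monoid.one = Poly_Mapping.single (\<lambda>_. 0) 1,
     ring.zero = 0,
     ring.add = (+),
     module.smult = (\<lambda>c F. Poly_Mapping.map (\<lambda>f. mpoly_const c * f) F)\<rparr>"

definition unit_vector :: "'i \<Rightarrow> 'i \<Rightarrow> nat" where
  "unit_vector k = (\<lambda>i. if i = k then 1 else 0)"

definition spherical_algebra ::
    "('i::{finite,linorder} \<Rightarrow> 'i \<Rightarrow> int) \<Rightarrow> ('i \<Rightarrow> int) \<Rightarrow>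
     complex poly \<Rightarrow> complex poly \<Rightarrow> complex poly \<Rightarrow>
     (complex poly, 'i shuffle_elem) module" where
  "spherical_algebra a d t1 t2 t3 =
     (shuffle_algebra a d t1 t2 t3)\<lparr>carrier :=
        generated_subalgebra Chbar (shuffle_algebra a d t1 t2 t3)
          (\<Union>k. Poly_Mapping.single (unit_vector k) ` SH_component (unit_vector k))\<rparr>"

definition lambda_power :: "'i \<Rightarrow> nat \<Rightarrow> 'i shuffle_elem" where
  "lambda_power k r = Poly_Mapping.single (unit_vector k) (mpoly_var (k, 1) ^ r)"

end

theory Submission
  imports Defs "HOL-Combinatorics.Multiset_Permutations" "HOL-Library.Function_Algebras"
begin

text \<open>The shuffle algebra embeds into the functions that assign to a finite set \<open>A\<close> of variables a
  rational function: a family of symmetric polynomials is evaluated at the variables in \<open>A\<close>.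
  There the shuffle product becomes the convolution
  \<open>(\<phi> * \<psi>) A = (\<Sum>B \<subseteq> A. \<phi> B \<psi> (A - B) \<Prod>x\<in>B. \<Prod>y\<in>A - B. \<omega> x y)\<close>, which is visibly associative,
  and the generators are supported on singletons.  The image consists of the functions that are
  equivariant under colour-preserving permutations of the variables, take polynomial values and
  live in finitely many degrees; polynomiality is preserved because multiplying by the Vandermonde
  product turns a symmetric function with simple poles into an antisymmetric polynomial.

  Relation (Y1) is the exchange identity \<open>(x - y - c) \<omega> x y = (x - y + c) \<omega> y x\<close>.  For (Y2) the
  iterated commutator is peeled off one generator at a time: after symmetrization each step
  contributes the sum of the residues of a rational function, which is the constant
  \<open>n (2 c - (n - 1) D)\<close> with \<open>D = d\<^sub>k \<hbar>\<close> and \<open>2 c = - a\<^sub>k\<^sub>l D\<close>, and this vanishes at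
  \<open>n = 1 - a\<^sub>k\<^sub>l\<close>.\<close>


section \<open>Additive maps on finitely supported functions\<close>

text \<open>The product of \<open>shuffle_algebra\<close> is only given as the polynomial that a sum
  of fractions happens to be, so nothing can be proved about it before that sum is known to be
  polynomial. Set functions separate the two issues: the convolution is bilinear and associative on
  all of them, whatever values the kernel takes in the fraction field, and polynomiality enters only
  when returning to shuffle elements.

  The arrow weights are made for the exchange identity. With \<delta> = d_k l_kl, the n arrows from
  k to l give \<open>kernel x y\<close> the factors y - x + m \<delta> \<hbar>/2 for m = n, n - 2,
  ..., 2 - n, and \<open>kernel y x\<close> the same factors for m = n - 2, ..., -n. All but one
  agree, and n \<delta> = - d_k a_kl; hence the two values are M (y - x + c) and M (y - x - c) with
  one common M. In the Serre relation the factors M come out of the sum, and only the linear terms y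
  - x + c and y - x - c meet the residues; this is why two moments of the residues suffice.\<close>

definition pm_ext ::
    "('m \<Rightarrow> 'c \<Rightarrow> 'b) \<Rightarrow> ('m \<Rightarrow>\<^sub>0 'c::zero) \<Rightarrow> 'b::comm_monoid_add" where
  "pm_ext T f = (\<Sum>m\<in>Poly_Mapping.keys f. T m (Poly_Mapping.lookup f m))"

lemma sum_single_keys:
  fixes f :: "'m \<Rightarrow>\<^sub>0 'c::comm_monoid_add"
  shows "(\<Sum>m\<in>Poly_Mapping.keys f. Poly_Mapping.single m (Poly_Mapping.lookup f m)) = f"
proof (rule poly_mapping_eqI)
  fix k
  have "Poly_Mapping.lookup
      (\<Sum>m\<in>Poly_Mapping.keys f. Poly_Mapping.single m (Poly_Mapping.lookup f m)) k =
      (\<Sum>m\<in>Poly_Mapping.keys f. if m = k then Poly_Mapping.lookup f k else 0)"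
    by (auto simp: lookup_sum lookup_single when_def intro!: sum.cong)
  then show "Poly_Mapping.lookup
      (\<Sum>m\<in>Poly_Mapping.keys f. Poly_Mapping.single m (Poly_Mapping.lookup f m)) k =
      Poly_Mapping.lookup f k"
    by (simp add: in_keys_iff)
qed

lemma poly_mapping_induct_add [case_names zero single add]:
  fixes f :: "'m \<Rightarrow>\<^sub>0 'c::comm_monoid_add"
  assumes "P 0" and "\<And>m c. P (Poly_Mapping.single m c)"
    and "\<And>f g. P f \<Longrightarrow> P g \<Longrightarrow> P (f + g)"
  shows "P f"
proof -
  have "P (\<Sum>m\<in>A. Poly_Mapping.single m (Poly_Mapping.lookup f m))" if "finite A" for A
    using that by (induction A) (auto intro: assms)
  from this[of "Poly_Mapping.keys f"] show ?thesis by (simp add: sum_single_keys)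
qed

context
  fixes T :: "'m \<Rightarrow> 'c::comm_monoid_add \<Rightarrow> 'b::comm_monoid_add"
  assumes T_zero: "\<And>m. T m 0 = 0"
    and T_add: "\<And>m c c'. T m (c + c') = T m c + T m c'"
begin

lemma pm_ext_0: "pm_ext T 0 = 0"
  by (simp add: pm_ext_def)

lemma pm_ext_add: "pm_ext T (f + g) = pm_ext T f + pm_ext T g"
  unfolding pm_ext_def using T_zero T_add by (intro setsum_keys_plus_distrib)

lemma pm_ext_single: "pm_ext T (Poly_Mapping.single m c) = T m c"
  by (cases "c = 0") (simp_all add: pm_ext_def T_zero)

end

text \<open>The target product is a parameter because it is the ring product for renaming of
  variables but \<open>conv\<close> for the map from the free algebra, where \<open>*\<close> on
  functions would mean the pointwise product.\<close>

lemma pm_ext_mult: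
  fixes T :: "'m::monoid_add \<Rightarrow> 'c::semiring_0 \<Rightarrow> 'b::comm_monoid_add"
  assumes T_zero: "\<And>m. T m 0 = 0"
    and T_add: "\<And>m c c'. T m (c + c') = T m c + T m c'"
    and mul_zero: "\<And>x. mul 0 x = 0" "\<And>x. mul x 0 = 0"
    and mul_add: "\<And>x y z. mul (x + y) z = mul x z + mul y z"
      "\<And>x y z. mul x (y + z) = mul x y + mul x z"
    and T_mult: "\<And>m m' c c'. T (m + m') (c * c') = mul (T m c) (T m' c')"
  shows "pm_ext T (f * g) = mul (pm_ext T f) (pm_ext T g)"
proof (induction f rule: poly_mapping_induct_add)
  case zero
  show ?case by (simp add: pm_ext_0[where T = T, OF T_zero T_add] mul_zero)
next
  case (single m c)
  show ?case
  proof (induction g rule: poly_mapping_induct_add)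
    case zero
    show ?case by (simp add: pm_ext_0[where T = T, OF T_zero T_add] mul_zero)
  next
    case (single m' c')
    show ?case by (simp add: mult_single pm_ext_single[where T = T, OF T_zero T_add] T_mult)
  next
    case (add f g)
    then show ?case by (simp add: distrib_left pm_ext_add[where T = T, OF T_zero T_add] mul_add)
  qed
next
  case (add f g)
  then show ?case by (simp add: distrib_right pm_ext_add[where T = T, OF T_zero T_add] mul_add)
qed


section \<open>Renaming the variables of a polynomial\<close>

definition rename_monom :: "('i \<times> nat \<Rightarrow> 'i \<times> nat) \<Rightarrow> ('i \<times> nat \<Rightarrow>\<^sub>0 nat) \<Rightarrow> 'i mpoly" where
  "rename_monom \<rho> m =
     (\<Prod>x\<in>Poly_Mapping.keys m. mpoly_var (\<rho> x) ^ Poly_Mapping.lookup m x)"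

lemma mpoly_rename_pm_ext: "mpoly_rename \<rho> = pm_ext (\<lambda>m c. mpoly_const c * rename_monom \<rho> m)"
  by (simp add: fun_eq_iff mpoly_rename_def pm_ext_def rename_monom_def)

lemma mpoly_const_0 [simp]: "mpoly_const 0 = 0"
  and mpoly_const_1 [simp]: "mpoly_const 1 = 1"
  and mpoly_const_add: "mpoly_const (c + c') = mpoly_const c + mpoly_const c'"
  and mpoly_const_mult: "mpoly_const (c * c') = mpoly_const c * mpoly_const c'"
  by (simp_all add: mpoly_const_def single_add mult_single)

lemma rename_monom_superset:
  assumes "finite A" "Poly_Mapping.keys m \<subseteq> A"
  shows "rename_monom \<rho> m = (\<Prod>x\<in>A. mpoly_var (\<rho> x) ^ Poly_Mapping.lookup m x)"
  unfolding rename_monom_def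
  by (rule prod.mono_neutral_left) (use assms in \<open>auto simp: in_keys_iff\<close>)

lemma rename_monom_0 [simp]: "rename_monom \<rho> 0 = 1"
  by (simp add: rename_monom_def)

lemma rename_monom_add: "rename_monom \<rho> (m + m') = rename_monom \<rho> m * rename_monom \<rho> m'"
proof -
  let ?A = "Poly_Mapping.keys m \<union> Poly_Mapping.keys m'"
  have "Poly_Mapping.keys (m + m') \<subseteq> ?A" by (rule keys_add)
  then show ?thesis
    by (simp add: rename_monom_superset[of ?A] lookup_add power_add prod.distrib)
qed

lemma mpoly_rename_0 [simp]: "mpoly_rename \<rho> 0 = 0"
  and mpoly_rename_add: "mpoly_rename \<rho> (f + g) = mpoly_rename \<rho> f + mpoly_rename \<rho> g"
  and mpoly_rename_single:
    "mpoly_rename \<rho> (Poly_Mapping.single m c) = mpoly_const c * rename_monom \<rho> m"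
  unfolding mpoly_rename_pm_ext
  by (intro pm_ext_0 pm_ext_add pm_ext_single; simp add: mpoly_const_add distrib_right)+

lemma mpoly_rename_mult: "mpoly_rename \<rho> (f * g) = mpoly_rename \<rho> f * mpoly_rename \<rho> g"
  unfolding mpoly_rename_pm_ext
  by (rule pm_ext_mult)
    (simp_all add: mpoly_const_add mpoly_const_mult rename_monom_add algebra_simps)

lemma mpoly_rename_const [simp]: "mpoly_rename \<rho> (mpoly_const c) = mpoly_const c"
  unfolding mpoly_const_def by (simp add: mpoly_rename_single mpoly_const_def)

lemma mpoly_rename_1 [simp]: "mpoly_rename \<rho> 1 = 1"
  using mpoly_rename_const[of \<rho> 1] by simp

lemma mpoly_rename_var [simp]: "mpoly_rename \<rho> (mpoly_var x) = mpoly_var (\<rho> x)"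
  by (simp add: mpoly_var_def[of x] mpoly_rename_single rename_monom_def)

lemma mpoly_rename_uminus: "mpoly_rename \<rho> (- f) = - mpoly_rename \<rho> f"
  by (metis add.right_inverse add_eq_0_iff mpoly_rename_0 mpoly_rename_add)

lemma mpoly_rename_diff: "mpoly_rename \<rho> (f - g) = mpoly_rename \<rho> f - mpoly_rename \<rho> g"
  using mpoly_rename_add[of \<rho> f "- g"] by (simp add: mpoly_rename_uminus)

lemma mpoly_rename_power: "mpoly_rename \<rho> (f ^ n) = mpoly_rename \<rho> f ^ n"
  by (induction n) (simp_all add: mpoly_rename_mult)

lemma mpoly_rename_prod: "mpoly_rename \<rho> (prod f A) = (\<Prod>x\<in>A. mpoly_rename \<rho> (f x))"
  by (induction A rule: infinite_finite_induct) (simp_all add: mpoly_rename_mult)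

lemma mpoly_rename_of_nat [simp]: "mpoly_rename \<rho> (of_nat n) = of_nat n"
  by (induction n) (simp_all add: mpoly_rename_add)

lemma mpoly_rename_of_int [simp]: "mpoly_rename \<rho> (of_int n) = of_int n"
  by (cases n) (simp_all add: mpoly_rename_diff mpoly_rename_uminus)

lemma mpoly_var_power: "mpoly_var x ^ n = Poly_Mapping.single (Poly_Mapping.single x n) 1"
  by (induction n) (simp_all add: mpoly_var_def mult_single single_add[symmetric])

lemma prod_single_1:
  "(\<Prod>x\<in>A. Poly_Mapping.single (m x) (1::'c::comm_semiring_1)) =
     Poly_Mapping.single (\<Sum>x\<in>A. m x :: 'm::comm_monoid_add) 1"
  by (induction A rule: infinite_finite_induct) (simp_all add: mult_single)

lemma rename_monom_id: "rename_monom (\<lambda>x. x) m = Poly_Mapping.single m 1"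
  by (simp add: rename_monom_def mpoly_var_power prod_single_1 sum_single_keys)

lemma mpoly_const_times_single:
  "mpoly_const c * Poly_Mapping.single m 1 = Poly_Mapping.single m c"
  by (simp add: mpoly_const_def mult_single)

lemma mpoly_rename_id [simp]: "mpoly_rename (\<lambda>x. x) f = f"
  by (induction f rule: poly_mapping_induct_add)
    (simp_all add: mpoly_rename_add mpoly_rename_single rename_monom_id mpoly_const_times_single)

lemma mpoly_rename_comp: "mpoly_rename \<rho> (mpoly_rename \<tau> f) = mpoly_rename (\<lambda>x. \<rho> (\<tau> x)) f"
  by (induction f rule: poly_mapping_induct_add)
    (simp_all add: mpoly_rename_add mpoly_rename_single mpoly_rename_mult rename_monom_def
      mpoly_rename_prod mpoly_rename_power)

lemma mpoly_rename_cong: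
  assumes "\<And>x. x \<in> mpoly_vars f \<Longrightarrow> \<rho> x = \<tau> x"
  shows "mpoly_rename \<rho> f = mpoly_rename \<tau> f"
  unfolding mpoly_rename_def
  by (intro sum.cong prod.cong arg_cong2[where f = "(*)"] refl arg_cong2[where f = "(^)"]
      arg_cong[where f = mpoly_var] assms) (auto simp: mpoly_vars_def)

lemma mpoly_rename_eq_0_iff:
  assumes "bij \<pi>"
  shows "mpoly_rename \<pi> f = 0 \<longleftrightarrow> f = 0"
proof
  assume "mpoly_rename \<pi> f = 0"
  then have "mpoly_rename (inv_into UNIV \<pi>) (mpoly_rename \<pi> f) = 0" by simp
  then show "f = 0"
    using assms by (simp add: mpoly_rename_comp bij_is_inj)
qed simp

lemma finite_mpoly_vars: "finite (mpoly_vars f)"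
  by (simp add: mpoly_vars_def)

lemma mpoly_vars_add: "mpoly_vars (f + g) \<subseteq> mpoly_vars f \<union> mpoly_vars g"
  using keys_add[of f g] by (fastforce simp: mpoly_vars_def)

lemma mpoly_vars_mult: "mpoly_vars (f * g) \<subseteq> mpoly_vars f \<union> mpoly_vars g"
proof
  fix x assume "x \<in> mpoly_vars (f * g)"
  then obtain m where m: "m \<in> Poly_Mapping.keys (f * g)" "x \<in> Poly_Mapping.keys m"
    by (auto simp: mpoly_vars_def)
  then obtain m1 m2 where "m = m1 + m2" "m1 \<in> Poly_Mapping.keys f" "m2 \<in> Poly_Mapping.keys g"
    using keys_mult by blast
  with m(2) keys_add[of m1 m2] show "x \<in> mpoly_vars f \<union> mpoly_vars g"
    by (auto simp: mpoly_vars_def)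
qed

lemma mpoly_vars_0 [simp]: "mpoly_vars 0 = {}"
  and mpoly_vars_1 [simp]: "mpoly_vars 1 = {}"
  and mpoly_vars_const [simp]: "mpoly_vars (mpoly_const c) = {}"
  and mpoly_vars_var [simp]: "mpoly_vars (mpoly_var x) = {x}"
  by (auto simp: mpoly_vars_def mpoly_const_def mpoly_var_def)

lemma mpoly_vars_power: "mpoly_vars (f ^ n) \<subseteq> mpoly_vars f"
proof (induction n)
  case (Suc n)
  then show ?case using mpoly_vars_mult[of f "f ^ n"] by auto
qed simp

lemma mpoly_vars_prod: "mpoly_vars (prod f A) \<subseteq> (\<Union>x\<in>A. mpoly_vars (f x))"
proof (induction A rule: infinite_finite_induct)
  case (insert x A)
  then show ?case using mpoly_vars_mult[of "f x" "prod f A"] by auto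
qed simp_all

lemma mpoly_vars_sum: "mpoly_vars (sum f A) \<subseteq> (\<Union>x\<in>A. mpoly_vars (f x))"
proof (induction A rule: infinite_finite_induct)
  case (insert x A)
  then show ?case using mpoly_vars_add[of "f x" "sum f A"] by auto
qed simp_all

lemma mpoly_vars_rename: "mpoly_vars (mpoly_rename \<rho> f) \<subseteq> \<rho> ` mpoly_vars f"
proof -
  have monom: "mpoly_vars (rename_monom \<rho> m) \<subseteq> \<rho> ` Poly_Mapping.keys m" for m
  proof -
    have "mpoly_vars (mpoly_var (\<rho> x) ^ n) \<subseteq> {\<rho> x}" for x n
      using mpoly_vars_power[of "mpoly_var (\<rho> x)" n] by simp
    then show ?thesis
      unfolding rename_monom_def by (intro order.trans[OF mpoly_vars_prod]) blast
  qed
  have "mpoly_vars (mpoly_const (Poly_Mapping.lookup f m) * rename_monom \<rho> m) \<subseteq>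
      \<rho> ` Poly_Mapping.keys m" for m
    using mpoly_vars_mult[of "mpoly_const (Poly_Mapping.lookup f m)" "rename_monom \<rho> m"] monom[of m]
    by simp
  moreover have "Poly_Mapping.keys m \<subseteq> mpoly_vars f" if "m \<in> Poly_Mapping.keys f" for m
    using that by (auto simp: mpoly_vars_def)
  ultimately show ?thesis
    unfolding mpoly_rename_pm_ext pm_ext_def
    by (intro order.trans[OF mpoly_vars_sum]) blast
qed


section \<open>Renaming the variables of a rational function\<close>

lemma fract_of_0 [simp]: "fract_of 0 = 0"
  and fract_of_1 [simp]: "fract_of 1 = 1"
  and fract_of_add: "fract_of (f + g) = fract_of f + fract_of g"
  and fract_of_mult: "fract_of (f * g) = fract_of f * fract_of g"
  and fract_of_uminus: "fract_of (- f) = - fract_of f"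
  and fract_of_diff: "fract_of (f - g) = fract_of f - fract_of g"
  and fract_of_eq_iff [simp]: "fract_of f = fract_of g \<longleftrightarrow> f = g"
  by (simp_all add: fract_of_def fract_collapse eq_fract)

lemma fract_of_eq_0_iff [simp]: "fract_of f = 0 \<longleftrightarrow> f = 0"
  using fract_of_eq_iff[of f 0] by simp

lemma fract_of_of_nat [simp]: "fract_of (of_nat n) = of_nat n"
  by (induction n) (simp_all add: fract_of_add)

lemma fract_of_of_int [simp]: "fract_of (of_int n) = of_int n"
  by (cases n) (simp_all add: fract_of_diff fract_of_uminus)

lemma fract_of_prod: "fract_of (prod f A) = (\<Prod>x\<in>A. fract_of (f x))"
  by (induction A rule: infinite_finite_induct) (simp_all add: fract_of_mult)

lemma fract_of_power: "fract_of (f ^ n) = fract_of f ^ n"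
  by (induction n) (simp_all add: fract_of_mult)

text \<open>Independent of the representative for injective renamings: identifying two variables
  could turn a nonzero denominator into 0. The rules below assume bijectivity, and the substitution
  of one variable for another is performed on polynomials only.\<close>

definition fract_rename ::
    "('i \<times> nat \<Rightarrow> 'i \<times> nat) \<Rightarrow> 'i mpoly fract \<Rightarrow> 'i::{finite,linorder} mpoly fract" where
  "fract_rename \<rho> q = (THE z. \<exists>f g. g \<noteq> 0 \<and> q = Fraction_Field.Fract f g \<and>
     z = Fraction_Field.Fract (mpoly_rename \<rho> f) (mpoly_rename \<rho> g))"

context
  fixes \<pi> :: "'i::{finite,linorder} \<times> nat \<Rightarrow> 'i \<times> nat"
  assumes bij: "bij \<pi>"
begin

lemma fract_rename_Fract:
  assumes "g \<noteq> 0"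
  shows "fract_rename \<pi> (Fraction_Field.Fract f g) =
    Fraction_Field.Fract (mpoly_rename \<pi> f) (mpoly_rename \<pi> g)"
  unfolding fract_rename_def
proof (rule the_equality)
  fix z
  assume "\<exists>f' g'. g' \<noteq> 0 \<and> Fraction_Field.Fract f g = Fraction_Field.Fract f' g' \<and>
    z = Fraction_Field.Fract (mpoly_rename \<pi> f') (mpoly_rename \<pi> g')"
  then obtain f' g' where g': "g' \<noteq> 0"
    and eq: "Fraction_Field.Fract f g = Fraction_Field.Fract f' g'"
    and z: "z = Fraction_Field.Fract (mpoly_rename \<pi> f') (mpoly_rename \<pi> g')" by blast
  have "f * g' = f' * g" using eq assms g' by (simp add: eq_fract)
  then have "mpoly_rename \<pi> f * mpoly_rename \<pi> g' = mpoly_rename \<pi> f' * mpoly_rename \<pi> g"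
    by (metis mpoly_rename_mult)
  then show "z = Fraction_Field.Fract (mpoly_rename \<pi> f) (mpoly_rename \<pi> g)"
    using z assms g' bij by (simp add: eq_fract mpoly_rename_eq_0_iff)
qed (use assms in blast)

lemma fract_rename_fract_of [simp]: "fract_rename \<pi> (fract_of f) = fract_of (mpoly_rename \<pi> f)"
  by (simp add: fract_of_def fract_rename_Fract)

lemma fract_rename_0 [simp]: "fract_rename \<pi> 0 = 0"
  and fract_rename_1 [simp]: "fract_rename \<pi> 1 = 1"
  using fract_rename_fract_of[of 0] fract_rename_fract_of[of 1] by simp_all

lemma fract_rename_add: "fract_rename \<pi> (p + q) = fract_rename \<pi> p + fract_rename \<pi> q"
  by (cases p; cases q) (simp add: fract_rename_Fract mpoly_rename_eq_0_iff[OF bij]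
    mpoly_rename_add mpoly_rename_mult)

lemma fract_rename_mult: "fract_rename \<pi> (p * q) = fract_rename \<pi> p * fract_rename \<pi> q"
  by (cases p; cases q) (simp add: fract_rename_Fract mpoly_rename_eq_0_iff[OF bij]
    mpoly_rename_mult)

lemma fract_rename_divide: "fract_rename \<pi> (p / q) = fract_rename \<pi> p / fract_rename \<pi> q"
proof (cases "q = 0")
  case False
  then have "fract_rename \<pi> (p / q) * fract_rename \<pi> q = fract_rename \<pi> p"
    by (simp flip: fract_rename_mult)
  moreover have "fract_rename \<pi> q \<noteq> 0"
    using False fract_rename_mult[of q "inverse q"] by auto
  ultimately show ?thesis by (simp add: eq_divide_eq)
qed simp

lemma fract_rename_uminus: "fract_rename \<pi> (- q) = - fract_rename \<pi> q"
  by (metis add.right_inverse add_eq_0_iff fract_rename_0 fract_rename_add)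

lemma fract_rename_diff: "fract_rename \<pi> (p - q) = fract_rename \<pi> p - fract_rename \<pi> q"
  using fract_rename_add[of p "- q"] by (simp add: fract_rename_uminus)

lemma fract_rename_prod: "fract_rename \<pi> (prod f A) = (\<Prod>x\<in>A. fract_rename \<pi> (f x))"
  by (induction A rule: infinite_finite_induct) (simp_all add: fract_rename_mult)

lemma fract_rename_sum: "fract_rename \<pi> (sum f A) = (\<Sum>x\<in>A. fract_rename \<pi> (f x))"
  by (induction A rule: infinite_finite_induct) (simp_all add: fract_rename_add)

lemma fract_rename_const [simp]: "fract_rename \<pi> (fract_const c) = fract_const c"
  by (simp add: fract_const_def)

lemma fract_rename_of_int [simp]: "fract_rename \<pi> (of_int n) = of_int n"
  using fract_rename_fract_of[of "of_int n"] by simp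

end


section \<open>Colour-preserving permutations of the variables\<close>

text \<open>Bijections of the whole infinite set of variables, not of a finite block: they carry the
  standard variables onto any finite set with the same colour counts and can exchange a variable
  with a fresh one.\<close>

definition colour_perm :: "('i \<times> nat \<Rightarrow> 'i \<times> nat) \<Rightarrow> bool" where
  "colour_perm \<pi> \<longleftrightarrow> bij \<pi> \<and> (\<forall>x. fst (\<pi> x) = fst x)"

definition std_vars :: "('i \<Rightarrow> nat) \<Rightarrow> ('i \<times> nat) set" where
  "std_vars v = {(i, s). 1 \<le> s \<and> s \<le> v i}"

definition colour_count :: "('i \<times> nat) set \<Rightarrow> 'i \<Rightarrow> nat" where
  "colour_count A i = card {s. (i, s) \<in> A}"

lemma colour_perm_bij: "colour_perm \<pi> \<Longrightarrow> bij \<pi>"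
  and colour_perm_fst: "colour_perm \<pi> \<Longrightarrow> fst (\<pi> x) = fst x"
  by (simp_all add: colour_perm_def del: split_paired_All)

lemma colour_perm_inj: "colour_perm \<pi> \<Longrightarrow> inj \<pi>"
  by (simp add: colour_perm_def bij_is_inj)

lemma colour_perm_id: "colour_perm (\<lambda>x. x)"
  using bij_id by (simp add: colour_perm_def id_def)

lemma colour_perm_comp: "colour_perm \<pi> \<Longrightarrow> colour_perm \<pi>' \<Longrightarrow> colour_perm (\<lambda>x. \<pi> (\<pi>' x))"
  using bij_comp[of \<pi>' \<pi>] by (simp add: colour_perm_def comp_def del: split_paired_All)

lemma colour_perm_inv: "colour_perm \<pi> \<Longrightarrow> colour_perm (inv_into UNIV \<pi>)"
proof -
  assume \<pi>: "colour_perm \<pi>"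
  have "fst (inv_into UNIV \<pi> x) = fst x" for x
    using colour_perm_fst[OF \<pi>, of "inv_into UNIV \<pi> x"]
    by (simp add: surj_f_inv_f bij_is_surj[OF colour_perm_bij[OF \<pi>]])
  then show ?thesis
    using bij_imp_bij_inv[OF colour_perm_bij[OF \<pi>]] unfolding colour_perm_def by blast
qed

lemma colour_perm_transpose:
  assumes "fst x = fst y"
  shows "colour_perm (Transposition.transpose x y)"
proof -
  have "fst (Transposition.transpose x y z) = fst z" for z
    using assms by (simp add: Transposition.transpose_def)
  then show ?thesis unfolding colour_perm_def by (intro conjI allI) simp_all
qed

lemma finite_std_vars [simp]: "finite (std_vars (v :: 'i::finite \<Rightarrow> nat))"
proof -
  have "std_vars v = Sigma UNIV (\<lambda>i. {1..v i})" by (auto simp: std_vars_def)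
  then show ?thesis by simp
qed

lemma colour_count_std_vars [simp]: "colour_count (std_vars v) = v"
proof
  fix i
  have "{s. (i, s) \<in> std_vars v} = {1..v i}" by (auto simp: std_vars_def)
  then show "colour_count (std_vars v) i = v i" by (simp add: colour_count_def)
qed

lemma finite_colour_slice: "finite A \<Longrightarrow> finite {s. (i, s) \<in> A}"
proof -
  assume "finite A"
  moreover have "{s. (i, s) \<in> A} \<subseteq> snd ` A" by (auto intro: rev_image_eqI)
  ultimately show ?thesis by (meson finite_imageI finite_subset)
qed

lemma colour_count_image:
  assumes "inj_on f A" "\<And>x. x \<in> A \<Longrightarrow> fst (f x) = fst x"
  shows "colour_count (f ` A) = colour_count A"
proof
  fix i
  have "bij_betw (\<lambda>s. snd (f (i, s))) {s. (i, s) \<in> A} {s. (i, s) \<in> f ` A}"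
  proof (rule bij_betw_imageI)
    show "inj_on (\<lambda>s. snd (f (i, s))) {s. (i, s) \<in> A}"
    proof (rule inj_onI)
      fix s t assume "s \<in> {s. (i, s) \<in> A}" "t \<in> {s. (i, s) \<in> A}" "snd (f (i, s)) = snd (f (i, t))"
      then have "f (i, s) = f (i, t)" "(i, s) \<in> A" "(i, t) \<in> A"
        using assms(2) by (auto simp: prod_eq_iff)
      then have "(i, s) = (i, t)" using assms(1) by (auto dest: inj_onD)
      then show "s = t" by simp
    qed
    show "(\<lambda>s. snd (f (i, s))) ` {s. (i, s) \<in> A} = {s. (i, s) \<in> f ` A}"
    proof (intro equalityI subsetI)
      fix t assume "t \<in> (\<lambda>s. snd (f (i, s))) ` {s. (i, s) \<in> A}"
      then obtain s where s: "(i, s) \<in> A" "t = snd (f (i, s))" by auto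
      then have "f (i, s) = (i, t)" using assms(2)[of "(i, s)"] by (simp add: prod_eq_iff)
      then show "t \<in> {s. (i, s) \<in> f ` A}" using imageI[OF s(1), of f] by simp
    next
      fix t assume "t \<in> {s. (i, s) \<in> f ` A}"
      then obtain x where x: "x \<in> A" "f x = (i, t)" by auto
      then have "x = (i, snd x)" using assms(2)[of x] by (simp add: prod_eq_iff)
      with x have "(i, snd x) \<in> A" "t = snd (f (i, snd x))" by simp_all
      then show "t \<in> (\<lambda>s. snd (f (i, s))) ` {s. (i, s) \<in> A}" by blast
    qed
  qed
  then show "colour_count (f ` A) i = colour_count A i"
    unfolding colour_count_def by (rule bij_betw_same_card[symmetric])
qed

lemma colour_count_perm: "colour_perm \<pi> \<Longrightarrow> colour_count (\<pi> ` A) = colour_count A"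
  using colour_count_image[OF inj_on_subset[OF colour_perm_inj subset_UNIV]] colour_perm_fst
  by blast

lemma colour_count_Un:
  assumes "finite A" "finite B" "A \<inter> B = {}"
  shows "colour_count (A \<union> B) = (\<lambda>i. colour_count A i + colour_count B i)"
proof
  fix i
  have "{s. (i, s) \<in> A \<union> B} = {s. (i, s) \<in> A} \<union> {s. (i, s) \<in> B}" by auto
  then show "colour_count (A \<union> B) i = colour_count A i + colour_count B i"
    unfolding colour_count_def using assms(3)
    by (simp, intro card_Un_disjoint finite_colour_slice assms(1,2)) auto
qed

text \<open>Induction on \<open>A\<close>: composing with the transposition of
  \<open>\<pi> x\<close> and \<open>f x\<close> repairs the value at the new point, and by
  injectivity the earlier values differ from both, so they survive. It is applied to partial maps
  such as \<open>t \<mapsto> \<sigma> i (t + v1 i)\<close>, which are injective on the relevant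
  variables but need not be bijections.\<close>

lemma extend_colour_perm:
  assumes "finite A" "inj_on f A" "\<And>x. x \<in> A \<Longrightarrow> fst (f x) = fst x"
  shows "\<exists>\<pi>. colour_perm \<pi> \<and> (\<forall>x\<in>A. \<pi> x = f x)"
  using assms
proof (induction A)
  case empty
  show ?case using colour_perm_id by blast
next
  case (insert x A)
  then obtain \<pi> where \<pi>: "colour_perm \<pi>" "\<forall>y\<in>A. \<pi> y = f y" by auto
  let ?\<pi> = "\<lambda>y. Transposition.transpose (\<pi> x) (f x) (\<pi> y)"
  have "colour_perm ?\<pi>"
    by (rule colour_perm_comp[OF colour_perm_transpose \<pi>(1)])
      (use insert.prems(2) in \<open>simp add: colour_perm_fst[OF \<pi>(1)]\<close>)
  moreover have "?\<pi> y = f y" if "y \<in> insert x A" for y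
  proof (cases "y = x")
    case False
    with that have y: "y \<in> A" by simp
    then have "\<pi> y \<noteq> \<pi> x" using False colour_perm_inj[OF \<pi>(1)] by (auto dest: injD)
    moreover have "f y \<noteq> f x" using inj_onD[OF insert.prems(1), of y x] y False by auto
    ultimately show ?thesis using \<pi>(2) y by (simp add: Transposition.transpose_def)
  qed simp
  ultimately show ?case by blast
qed

lemma ex_colour_perm_std_vars:
  assumes "finite (A :: ('i::finite \<times> nat) set)"
  shows "\<exists>\<pi>. colour_perm \<pi> \<and> \<pi> ` std_vars (colour_count A) = A"
proof -
  have "\<exists>g. bij_betw g {1..colour_count A i} {s. (i, s) \<in> A}" for i
    by (rule finite_same_card_bij)
      (use assms in \<open>simp_all add: finite_colour_slice colour_count_def\<close>)
  then obtain g where g: "\<And>i. bij_betw (g i) {1..colour_count A i} {s. (i, s) \<in> A}"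
    by metis
  define f where "f = (\<lambda>(i, s). (i, g i s))"
  have "inj_on f (std_vars (colour_count A))"
    using g by (auto simp: inj_on_def f_def std_vars_def bij_betw_def)
  then obtain \<pi> where \<pi>: "colour_perm \<pi>" "\<forall>x\<in>std_vars (colour_count A). \<pi> x = f x"
    using extend_colour_perm[of "std_vars (colour_count A)" f] by (auto simp: f_def)
  have "f ` std_vars (colour_count A) = A"
  proof (intro equalityI subsetI)
    fix x assume "x \<in> f ` std_vars (colour_count A)"
    then obtain i s where "x = (i, g i s)" "s \<in> {1..colour_count A i}"
      by (auto simp: f_def std_vars_def)
    then show "x \<in> A" using bij_betwE[OF g[of i]] by auto
  next
    fix x assume "x \<in> A"
    then have "snd x \<in> g (fst x) ` {1..colour_count A (fst x)}"
      using bij_betw_imp_surj_on[OF g[of "fst x"]] by auto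
    then obtain s where "s \<in> {1..colour_count A (fst x)}" "x = f (fst x, s)"
      by (auto simp: f_def prod_eq_iff)
    then show "x \<in> f ` std_vars (colour_count A)"
      by (auto simp: std_vars_def)
  qed
  then have "\<pi> ` std_vars (colour_count A) = A" using \<pi>(2) by (simp cong: image_cong)
  with \<pi>(1) show ?thesis by blast
qed


section \<open>Shuffle elements as set functions\<close>

type_synonym 'i set_fun = "('i \<times> nat) set \<Rightarrow> 'i mpoly fract"

definition sh_carrier :: "'i shuffle_elem set" where
  "sh_carrier = {F. \<forall>v. Poly_Mapping.lookup F v \<in> SH_component v}"

text \<open>The value at a finite set \<open>A\<close> is the component of degree \<open>colour_count A\<close>, evaluated
  at the variables in \<open>A\<close>; by symmetry their order does not matter.\<close>

definition embed :: "'i shuffle_elem \<Rightarrow> 'i::{finite,linorder} set_fun" where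
  "embed F A = (if finite A then
     fract_of (mpoly_rename (SOME \<pi>. colour_perm \<pi> \<and> \<pi> ` std_vars (colour_count A) = A)
       (Poly_Mapping.lookup F (colour_count A))) else 0)"

definition equivariant :: "'i::{finite,linorder} set_fun \<Rightarrow> bool" where
  "equivariant \<phi> \<longleftrightarrow>
     (\<forall>\<pi> A. colour_perm \<pi> \<longrightarrow> finite A \<longrightarrow> fract_rename \<pi> (\<phi> A) = \<phi> (\<pi> ` A))"

definition regular :: "'i::{finite,linorder} set_fun \<Rightarrow> bool" where
  "regular \<phi> \<longleftrightarrow> equivariant \<phi> \<and> (\<forall>A. infinite A \<longrightarrow> \<phi> A = 0) \<and>
     (\<forall>A. finite A \<longrightarrow> \<phi> A \<in> range fract_of) \<and> finite {v. \<phi> (std_vars v) \<noteq> 0}"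

lemma equivariantD:
  "equivariant \<phi> \<Longrightarrow> colour_perm \<pi> \<Longrightarrow> finite A \<Longrightarrow> fract_rename \<pi> (\<phi> A) = \<phi> (\<pi> ` A)"
  by (simp add: equivariant_def)

lemma SH_component_vars: "f \<in> SH_component v \<Longrightarrow> mpoly_vars f \<subseteq> std_vars v"
  by (simp add: SH_component_def std_vars_def)

text \<open>The composite of \<open>\<pi>\<close> with the inverse of \<open>\<pi>'\<close> permutes
  the standard variables colour by colour, so it lies in the symmetry group of \<open>f\<close> and
  is absorbed.\<close>

lemma SH_component_rename_eq:
  assumes f: "f \<in> SH_component v" and \<pi>: "colour_perm \<pi>" and \<pi>': "colour_perm \<pi>'"
    and eq: "\<pi> ` std_vars v = \<pi>' ` std_vars v"
  shows "mpoly_rename \<pi> f = mpoly_rename \<pi>' f"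
proof -
  \<comment> \<open>The composite may move variables outside the standard block; replacing it there
    by the identity makes each \<open>\<tau> i\<close> permute \<open>{1..v i}\<close>, and
    \<open>f\<close> does not see the change.\<close>
  define \<tau> where "\<tau> = (\<lambda>i s. if s \<in> {1..v i} then snd (inv_into UNIV \<pi>' (\<pi> (i, s))) else s)"
  have inv: "inv_into UNIV \<pi>' (\<pi>' x) = x" "\<pi>' (inv_into UNIV \<pi>' x) = x" for x
    using colour_perm_bij[OF \<pi>']
    by (simp_all add: bij_is_inj bij_is_surj surj_f_inv_f)
  have \<tau>: "(i, \<tau> i s) = inv_into UNIV \<pi>' (\<pi> (i, s))" "(i, \<tau> i s) \<in> std_vars v"
    if "s \<in> {1..v i}" for i s
  proof -
    show 1: "(i, \<tau> i s) = inv_into UNIV \<pi>' (\<pi> (i, s))"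
      using that colour_perm_fst[OF colour_perm_inv[OF \<pi>'], of "\<pi> (i, s)"]
        colour_perm_fst[OF \<pi>, of "(i, s)"]
      by (simp add: \<tau>_def prod_eq_iff)
    have "(i, s) \<in> std_vars v" using that by (simp add: std_vars_def)
    then have "\<pi> (i, s) \<in> \<pi>' ` std_vars v" using eq by blast
    then show "(i, \<tau> i s) \<in> std_vars v" using 1 inv by auto
  qed
  have "\<tau> i permutes {1..v i}" for i
  proof (rule bij_imp_permutes)
    have "\<tau> i ` {1..v i} \<subseteq> {1..v i}" using \<tau>(2)[of _ i] by (fastforce simp: std_vars_def)
    moreover have "inj_on (\<tau> i) {1..v i}"
    proof (rule inj_onI)
      fix s t assume st: "s \<in> {1..v i}" "t \<in> {1..v i}" "\<tau> i s = \<tau> i t"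
      then have "inv_into UNIV \<pi>' (\<pi> (i, s)) = inv_into UNIV \<pi>' (\<pi> (i, t))"
        using \<tau>(1) by metis
      then have "\<pi> (i, s) = \<pi> (i, t)" by (metis inv(2))
      then show "s = t" using colour_perm_inj[OF \<pi>] by (auto dest: injD)
    qed
    ultimately show "bij_betw (\<tau> i) {1..v i} {1..v i}"
      by (simp add: bij_betw_def endo_inj_surj)
    show "\<tau> i s = s" if "s \<notin> {1..v i}" for s
      using that by (simp only: \<tau>_def if_False)
  qed
  then have "mpoly_rename (\<lambda>(i, s). (i, \<tau> i s)) f = f"
    using f by (simp add: SH_component_def)
  then have "mpoly_rename \<pi>' f = mpoly_rename \<pi>' (mpoly_rename (\<lambda>(i, s). (i, \<tau> i s)) f)" by simp
  also have "\<dots> = mpoly_rename \<pi> f"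
    unfolding mpoly_rename_comp
  proof (rule mpoly_rename_cong)
    fix x assume "x \<in> mpoly_vars f"
    then obtain i s where x: "x = (i, s)" "s \<in> {1..v i}"
      using SH_component_vars[OF f] by (fastforce simp: std_vars_def)
    show "\<pi>' (case x of (i, s) \<Rightarrow> (i, \<tau> i s)) = \<pi> x"
      using inv(2)[of "\<pi> (i, s)"] \<tau>(1)[OF x(2)] x(1) by simp
  qed
  finally show ?thesis by simp
qed

text \<open>Removes the arbitrary choice in \<open>embed\<close>: any colour permutation reaching
  the set may be used.\<close>

lemma embed_image:
  assumes F: "F \<in> sh_carrier" and \<pi>: "colour_perm \<pi>"
  shows "embed F (\<pi> ` std_vars v) = fract_of (mpoly_rename \<pi> (Poly_Mapping.lookup F v))"
proof -
  let ?A = "\<pi> ` std_vars v"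
  have v: "colour_count ?A = v" using \<pi> by (simp add: colour_count_perm)
  define \<pi>' where "\<pi>' = (SOME \<pi>'. colour_perm \<pi>' \<and> \<pi>' ` std_vars (colour_count ?A) = ?A)"
  have "\<exists>\<pi>'. colour_perm \<pi>' \<and> \<pi>' ` std_vars (colour_count ?A) = ?A"
    by (rule ex_colour_perm_std_vars) simp
  from someI_ex[OF this] have "colour_perm \<pi>' \<and> \<pi>' ` std_vars (colour_count ?A) = ?A"
    by (simp only: \<pi>'_def)
  then have "mpoly_rename \<pi>' (Poly_Mapping.lookup F v) = mpoly_rename \<pi> (Poly_Mapping.lookup F v)"
    using F \<pi> unfolding v by (intro SH_component_rename_eq) (auto simp: sh_carrier_def)
  then show ?thesis unfolding embed_def \<pi>'_def[symmetric] by (simp add: v)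
qed

lemma embed_std_vars:
  "F \<in> sh_carrier \<Longrightarrow> embed F (std_vars v) = fract_of (Poly_Mapping.lookup F v)"
  using embed_image[OF _ colour_perm_id, of F v] by simp

lemma set_fun_cases:
  fixes A :: "('i::finite \<times> nat) set"
  obtains "infinite A" | \<pi> v where "colour_perm \<pi>" "A = \<pi> ` std_vars v"
  using ex_colour_perm_std_vars by metis

lemma regular_embed:
  fixes F :: "'i::{finite,linorder} shuffle_elem"
  assumes F: "F \<in> sh_carrier"
  shows "regular (embed F)"
  unfolding regular_def
proof (intro conjI allI impI)
  show "equivariant (embed F)"
    unfolding equivariant_def
  proof (intro allI impI)
    fix \<pi> :: "'i \<times> nat \<Rightarrow> 'i \<times> nat" and A :: "('i \<times> nat) set" assume \<pi>: "colour_perm \<pi>" and "finite A"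
    then obtain \<rho> v where \<rho>: "colour_perm \<rho>" "A = \<rho> ` std_vars v" by (metis set_fun_cases)
    have "\<pi> ` A = (\<lambda>x. \<pi> (\<rho> x)) ` std_vars v" by (simp add: \<rho>(2) image_image)
    then show "fract_rename \<pi> (embed F A) = embed F (\<pi> ` A)"
      using embed_image[OF F colour_perm_comp[OF \<pi> \<rho>(1)], of v] embed_image[OF F \<rho>(1), of v]
      by (simp add: \<rho>(2) fract_rename_fract_of[OF colour_perm_bij[OF \<pi>]] mpoly_rename_comp)
  qed
  show "finite {v. embed F (std_vars v) \<noteq> 0}"
    by (simp add: embed_std_vars[OF F])
qed (simp_all add: embed_def)

lemma embed_inject:
  assumes "F \<in> sh_carrier" "G \<in> sh_carrier" "embed F = embed G"
  shows "F = G"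
proof (rule poly_mapping_eqI)
  fix v
  show "Poly_Mapping.lookup F v = Poly_Mapping.lookup G v"
    using embed_std_vars[of _ v] assms by (metis fract_of_eq_iff)
qed

lemma ex_fresh_colour:
  assumes "finite B"
  shows "\<exists>t. (i, t) \<notin> (B :: ('i \<times> nat) set)"
proof -
  obtain t where "t \<notin> snd ` B"
    using ex_new_if_finite[of "snd ` B"] assms by (auto simp: infinite_UNIV_nat)
  then show ?thesis by (metis image_eqI snd_conv)
qed

text \<open>A polynomial fixed by all transpositions with fresh variables outside \<open>A\<close> involves no
  variable outside \<open>A\<close>.\<close>

lemma regular_imp_SH_component:
  assumes "equivariant \<phi>" and h: "\<phi> (std_vars v) = fract_of h"
  shows "h \<in> SH_component v"
proof -
  have fixed: "mpoly_rename \<pi> h = h" if "colour_perm \<pi>" "\<pi> ` std_vars v = std_vars v" for \<pi>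
    using equivariantD[OF assms(1) that(1), of "std_vars v"] that(2)
    by (simp add: h fract_rename_fract_of[OF colour_perm_bij[OF that(1)]])
  have "mpoly_vars h \<subseteq> std_vars v"
  proof
    fix x assume x: "x \<in> mpoly_vars h"
    show "x \<in> std_vars v"
    proof (rule ccontr)
      assume nx: "x \<notin> std_vars v"
      obtain t where t: "(fst x, t) \<notin> mpoly_vars h \<union> std_vars v"
        using ex_fresh_colour[of "mpoly_vars h \<union> std_vars v"] finite_mpoly_vars by auto
      let ?\<pi> = "Transposition.transpose x (fst x, t)"
      have "?\<pi> y = y" if "y \<in> std_vars v" for y
        using that nx t by (auto simp: Transposition.transpose_def)
      then have "?\<pi> ` std_vars v = std_vars v" by (simp cong: image_cong)
      then have "mpoly_rename ?\<pi> h = h" by (intro fixed colour_perm_transpose) simp_all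
      then have "x \<in> ?\<pi> ` mpoly_vars h" using x mpoly_vars_rename[of ?\<pi> h] by auto
      then have "(fst x, t) \<in> mpoly_vars h" by (auto simp: Transposition.transpose_def split: if_splits)
      then show False using t by blast
    qed
  qed
  moreover have "mpoly_rename (\<lambda>(i, s). (i, \<pi> i s)) h = h" if perm: "\<forall>i. \<pi> i permutes {1..v i}" for \<pi>
  proof (rule fixed)
    let ?\<rho> = "\<lambda>(i, s). (i, \<pi> i s)"
    have "inj ?\<rho>" using permutes_inj[OF spec[OF perm]] by (auto simp: inj_def)
    moreover have "surj ?\<rho>"
    proof
      show "UNIV \<subseteq> range ?\<rho>"
      proof
        fix x
        obtain s where "snd x = \<pi> (fst x) s"
          using permutes_surj[OF spec[OF perm], of "fst x"] by (metis surjD)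
        then have "x = ?\<rho> (fst x, s)" by (simp add: prod_eq_iff)
        then show "x \<in> range ?\<rho>" by blast
      qed
    qed simp
    ultimately show "colour_perm ?\<rho>" by (simp add: colour_perm_def bij_betw_def)
    have "?\<rho> ` std_vars v \<subseteq> std_vars v"
      using permutes_in_image[OF spec[OF perm]] by (auto simp: std_vars_def)
    then show "?\<rho> ` std_vars v = std_vars v"
      using inj_on_subset[OF \<open>inj ?\<rho>\<close> subset_UNIV] by (intro endo_inj_surj) simp_all
  qed
  ultimately show ?thesis by (simp add: SH_component_def std_vars_def)
qed

lemma regular_imp_embed:
  assumes "regular \<phi>"
  shows "\<exists>F\<in>sh_carrier. embed F = \<phi>"
proof -
  have eqv: "equivariant \<phi>" using assms by (simp add: regular_def)
  have "\<phi> (std_vars v) \<in> range fract_of" for v using assms by (simp add: regular_def)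
  then have "\<forall>v. \<exists>h. \<phi> (std_vars v) = fract_of h" by blast
  then obtain h where h: "\<And>v. \<phi> (std_vars v) = fract_of (h v)" by metis
  have "finite {v. h v \<noteq> 0}" using assms by (simp add: regular_def h)
  then have lookup: "Poly_Mapping.lookup (Abs_poly_mapping h) = h" by simp
  have carrier: "Abs_poly_mapping h \<in> sh_carrier"
    by (simp add: sh_carrier_def lookup regular_imp_SH_component[OF eqv h])
  moreover have "embed (Abs_poly_mapping h) A = \<phi> A" for A
  proof (cases A rule: set_fun_cases)
    case 1
    then show ?thesis using assms by (simp add: embed_def regular_def)
  next
    case (2 \<pi> v)
    have "\<phi> A = fract_rename \<pi> (\<phi> (std_vars v))"
      using equivariantD[OF eqv 2(1), of "std_vars v"] 2(2) by simp
    then show ?thesis using embed_image[OF carrier 2(1), of v] 2(2)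
      by (simp add: h lookup fract_rename_fract_of[OF colour_perm_bij[OF 2(1)]])
  qed
  ultimately show ?thesis by blast
qed


section \<open>Divisibility by differences of variables\<close>

definition var_diff :: "('i \<times> nat) \<times> ('i \<times> nat) \<Rightarrow> 'i mpoly" where
  "var_diff = (\<lambda>(x, y). mpoly_var x - mpoly_var y)"

text \<open>The substitution x = y, encoded as a non-injective renaming. As a ring homomorphism into
  an integral domain it tests divisibility by x - y without unique factorization.\<close>

definition merge :: "'x \<Rightarrow> 'x \<Rightarrow> 'x \<Rightarrow> 'x" where
  "merge x y = (\<lambda>z. if z = x then y else z)"

lemma mpoly_var_eq_iff [simp]: "mpoly_var x = mpoly_var y \<longleftrightarrow> x = y"
  by (metis mpoly_vars_var singleton_inject)

lemma var_diff_eq_0_iff: "var_diff p = 0 \<longleftrightarrow> fst p = snd p"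
  by (simp add: var_diff_def split: prod.split)

lemma mpoly_rename_var_diff:
  "mpoly_rename \<rho> (var_diff p) = var_diff (\<rho> (fst p), \<rho> (snd p))"
  by (simp add: var_diff_def mpoly_rename_diff split: prod.split)

lemma prod_diff_dvd:
  fixes f g :: "'x \<Rightarrow> 'a::comm_ring_1"
  assumes "\<And>x. x \<in> A \<Longrightarrow> r dvd f x - g x"
  shows "r dvd prod f A - prod g A"
  using assms
proof (induction A rule: infinite_finite_induct)
  case (insert x A)
  have "f x * prod f A - g x * prod g A =
      f x * (prod f A - prod g A) + (f x - g x) * prod g A"
    by (simp add: algebra_simps)
  moreover have "r dvd prod f A - prod g A" "r dvd f x - g x" using insert by auto
  ultimately show ?case using insert.hyps by simp
qed simp_all

text \<open>Congruence modulo x - y is clear for a single variable and passes to powers and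
  monomials by \<open>prod_diff_dvd\<close>, then to sums.\<close>

lemma var_diff_dvd_diff_merge: "var_diff (x, y) dvd f - mpoly_rename (merge x y) f"
proof (induction f rule: poly_mapping_induct_add)
  case (single m c)
  have "var_diff (x, y) dvd mpoly_var z - mpoly_var (merge x y z)" for z
    by (simp add: var_diff_def merge_def)
  then have "var_diff (x, y) dvd mpoly_var z ^ n - mpoly_var (merge x y z) ^ n" for z n
    using prod_diff_dvd[of "{..<n}" _ "\<lambda>_. mpoly_var z" "\<lambda>_. mpoly_var (merge x y z)"] by simp
  then have "var_diff (x, y) dvd rename_monom (\<lambda>z. z) m - rename_monom (merge x y) m"
    unfolding rename_monom_def by (intro prod_diff_dvd) simp
  then have "var_diff (x, y) dvd
      mpoly_const c * (rename_monom (\<lambda>z. z) m - rename_monom (merge x y) m)" by simp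
  then show ?case
    by (simp add: mpoly_rename_single rename_monom_id mpoly_const_times_single right_diff_distrib)
next
  case (add f g)
  have eq: "f + g - mpoly_rename (merge x y) (f + g) =
      (f - mpoly_rename (merge x y) f) + (g - mpoly_rename (merge x y) g)"
    by (simp add: mpoly_rename_add)
  show ?case unfolding eq by (rule dvd_add[OF add])
qed simp

text \<open>The factor theorem: \<open>merge\<close> kills x - y, and conversely \<open>f\<close>
  differs from its merged form by a multiple of x - y.\<close>

lemma var_diff_dvd_iff: "var_diff (x, y) dvd f \<longleftrightarrow> mpoly_rename (merge x y) f = 0"
proof
  assume "var_diff (x, y) dvd f"
  then obtain g where "f = var_diff (x, y) * g" ..
  moreover have "merge x y x = y" "merge x y y = y" by (simp_all add: merge_def)
  then have "mpoly_rename (merge x y) (var_diff (x, y)) = 0"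
    by (simp add: mpoly_rename_var_diff var_diff_eq_0_iff)
  ultimately show "mpoly_rename (merge x y) f = 0" by (simp add: mpoly_rename_mult)
qed (use var_diff_dvd_diff_merge[of x y f] in simp)

text \<open>After x and y are merged their transposition is invisible, so the merged polynomial
  equals its own negative and vanishes because 2 is not a zero divisor.\<close>

lemma antisymmetric_dvd:
  fixes f :: "'i::{finite,linorder} mpoly"
  assumes "mpoly_rename (Transposition.transpose x y) f = - f"
  shows "var_diff (x, y) dvd f"
proof -
  have "(\<lambda>z. merge x y (Transposition.transpose x y z)) = merge x y"
    by (rule ext) (simp add: merge_def Transposition.transpose_def)
  then have "mpoly_rename (merge x y) f =
      mpoly_rename (merge x y) (mpoly_rename (Transposition.transpose x y) f)"
    by (simp only: mpoly_rename_comp)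
  also have "\<dots> = - mpoly_rename (merge x y) f" by (simp add: assms mpoly_rename_uminus)
  finally have "mpoly_rename (merge x y) f + mpoly_rename (merge x y) f = 0"
    by (simp only: eq_neg_iff_add_eq_0)
  then have "2 * mpoly_rename (merge x y) f = 0" by (simp only: mult_2)
  then show ?thesis by (simp add: var_diff_dvd_iff)
qed

text \<open>Merging x and y can only collapse the pairs (x, y) and (y, x). The first is excluded by
  hypothesis, the second by the orientation of the pairs; all other factors stay nonzero in a
  domain.\<close>

lemma merge_prod_var_diff_nonzero:
  fixes P :: "(('i::{finite,linorder} \<times> nat) \<times> ('i \<times> nat)) set"
  assumes "\<And>p. p \<in> P \<Longrightarrow> fst p < snd p" "x < y" "(x, y) \<notin> P"
  shows "mpoly_rename (merge x y) (prod var_diff P) \<noteq> 0"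
proof (cases "finite P")
  case True
  have "merge x y (fst p) \<noteq> merge x y (snd p)" if "p \<in> P" for p
    using assms(1)[OF that] assms(2,3) that
    by (cases p) (auto simp: merge_def)
  then show ?thesis using True
    by (simp add: mpoly_rename_prod mpoly_rename_var_diff var_diff_eq_0_iff prod_zero_iff)
qed simp

text \<open>Distinct oriented differences behave like coprime primes. If the product over
  \<open>P\<close> is already split off from \<open>f\<close>, merging the next pair kills
  \<open>f\<close> but not that product, hence it kills the cofactor.\<close>

lemma prod_var_diff_dvd:
  fixes f :: "'i::{finite,linorder} mpoly"
  assumes "finite P" "\<And>p. p \<in> P \<Longrightarrow> fst p < snd p" "\<And>p. p \<in> P \<Longrightarrow> var_diff p dvd f"
  shows "prod var_diff P dvd f"
  using assms
proof (induction P)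
  case (insert p P)
  obtain x y where p: "p = (x, y)" by (cases p)
  have "prod var_diff P dvd f" by (intro insert.IH insert.prems insertI2)
  then obtain h where h: "f = prod var_diff P * h" ..
  have "mpoly_rename (merge x y) f = 0"
    using insert.prems(2)[of p] by (simp add: p var_diff_dvd_iff)
  moreover have "mpoly_rename (merge x y) (prod var_diff P) \<noteq> 0"
    using insert.prems(1)[of p] insert.prems(1) insert.hyps(2)
    by (intro merge_prod_var_diff_nonzero) (auto simp: p)
  ultimately have "var_diff p dvd h" by (simp add: p var_diff_dvd_iff h mpoly_rename_mult)
  then show ?case using insert.hyps
    by (simp add: h)
qed simp

section \<open>The Vandermonde product of equally coloured variables\<close>

definition colour_pairs :: "('i::linorder \<times> nat) set \<Rightarrow> (('i \<times> nat) \<times> ('i \<times> nat)) set" where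
  "colour_pairs A = {(x, y). x \<in> A \<and> y \<in> A \<and> x < y \<and> fst x = fst y}"

text \<open>One factor for each possible pole of the shuffle product: denominators occur only
  between variables of the same colour.\<close>

definition vandermonde :: "('i::linorder \<times> nat) set \<Rightarrow> 'i mpoly" where
  "vandermonde A = prod var_diff (colour_pairs A)"

lemma finite_colour_pairs: "finite A \<Longrightarrow> finite (colour_pairs A)"
  by (rule finite_subset[of _ "A \<times> A"]) (auto simp: colour_pairs_def)

lemma vandermonde_nonzero:
  assumes "finite A"
  shows "vandermonde (A :: ('i::{finite,linorder} \<times> nat) set) \<noteq> 0"
proof -
  have "var_diff p \<noteq> 0" if "p \<in> colour_pairs A" for p
    using that by (auto simp: var_diff_eq_0_iff colour_pairs_def)
  then show ?thesis
    using finite_colour_pairs[OF assms] by (simp add: vandermonde_def prod_zero_iff)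
qed

text \<open>The renaming permutes the unordered pairs; squaring forgets their orientation. The map
  \<open>r\<close> is this permutation, with each image pair put in increasing order.\<close>

lemma vandermonde_rename_square:
  fixes A :: "('i::{finite,linorder} \<times> nat) set"
  assumes "finite A" "colour_perm \<pi>" "\<pi> ` A = A"
  shows "mpoly_rename \<pi> (vandermonde A) ^ 2 = vandermonde A ^ 2"
proof -
  define r where "r = (\<lambda>p. let x = \<pi> (fst p); y = \<pi> (snd p) in if x < y then (x, y) else (y, x))"
  have inj: "inj \<pi>" by (rule colour_perm_inj[OF assms(2)])
  have r_in: "r p \<in> colour_pairs A" if "p \<in> colour_pairs A" for p
  proof -
    obtain x y where p1: "p = (x, y)" by (cases p)
    with that have p: "p = (x, y)" "x \<in> A" "y \<in> A" "x < y" "fst x = fst y"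
      by (simp_all add: colour_pairs_def)
    have "\<pi> x \<in> A" "\<pi> y \<in> A" "fst (\<pi> x) = fst (\<pi> y)" "\<pi> x \<noteq> \<pi> y"
      using p assms inj by (auto simp: colour_perm_fst dest: injD)
    then show ?thesis by (auto simp: r_def Let_def p(1) colour_pairs_def)
  qed
  have "inj_on r (colour_pairs A)"
  proof (rule inj_onI)
    fix p q assume pq: "p \<in> colour_pairs A" "q \<in> colour_pairs A" "r p = r q"
    then have "{\<pi> (fst p), \<pi> (snd p)} = {\<pi> (fst q), \<pi> (snd q)}"
      by (auto simp: r_def Let_def split: if_splits)
    then have "\<pi> ` {fst p, snd p} = \<pi> ` {fst q, snd q}" by simp
    then have "{fst p, snd p} = {fst q, snd q}" using inj by (simp only: inj_image_eq_iff)
    then show "p = q" using pq(1,2) by (auto simp: colour_pairs_def doubleton_eq_iff)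
  qed
  moreover have "r ` colour_pairs A \<subseteq> colour_pairs A" using r_in by blast
  ultimately have bij: "bij_betw r (colour_pairs A) (colour_pairs A)"
    using finite_colour_pairs[OF assms(1)] by (simp add: bij_betw_def endo_inj_surj)
  have "mpoly_rename \<pi> (vandermonde A) ^ 2 = (\<Prod>p\<in>colour_pairs A. var_diff (r p) ^ 2)"
    unfolding vandermonde_def mpoly_rename_prod prod_power_distrib
    unfolding mpoly_rename_var_diff
    by (intro prod.cong refl) (simp add: r_def Let_def var_diff_def power2_commute)
  also have "\<dots> = vandermonde A ^ 2"
    unfolding vandermonde_def prod_power_distrib by (rule prod.reindex_bij_betw[OF bij])
  finally show ?thesis .
qed

text \<open>The sign is found without counting inversions: were the Vandermonde product symmetric,
  its cofactor of \<open>x - y\<close> would be antisymmetric and hence vanish at \<open>x = y\<close>.\<close>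

lemma vandermonde_transpose:
  fixes A :: "('i::{finite,linorder} \<times> nat) set"
  assumes "finite A" and xy: "(x, y) \<in> colour_pairs A"
  shows "mpoly_rename (Transposition.transpose x y) (vandermonde A) = - vandermonde A"
proof -
  let ?\<tau> = "Transposition.transpose x y"
  have "x \<in> A" "y \<in> A" "x < y" "fst x = fst y" using xy by (auto simp: colour_pairs_def)
  then have "?\<tau> ` A = A" by simp
  then have "mpoly_rename ?\<tau> (vandermonde A) ^ 2 = vandermonde A ^ 2"
    using \<open>fst x = fst y\<close> by (intro vandermonde_rename_square colour_perm_transpose assms(1))
  moreover have "mpoly_rename ?\<tau> (vandermonde A) \<noteq> vandermonde A"
  proof
    assume eq: "mpoly_rename ?\<tau> (vandermonde A) = vandermonde A"
    define W where "W = prod var_diff (colour_pairs A - {(x, y)})"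
    have V: "vandermonde A = var_diff (x, y) * W"
      unfolding vandermonde_def W_def
      by (rule prod.remove) (use xy finite_colour_pairs[OF assms(1)] in auto)
    have "mpoly_rename ?\<tau> (var_diff (x, y)) = - var_diff (x, y)"
      unfolding mpoly_rename_var_diff by (simp add: var_diff_def)
    then have "var_diff (x, y) * (mpoly_rename ?\<tau> W + W) = 0"
      using eq unfolding V mpoly_rename_mult by (simp add: distrib_left neg_eq_iff_add_eq_0)
    then have "mpoly_rename ?\<tau> W = - W"
      using less_imp_neq[OF \<open>x < y\<close>] by (simp add: var_diff_eq_0_iff eq_neg_iff_add_eq_0)
    then have "mpoly_rename (merge x y) W = 0"
      using antisymmetric_dvd var_diff_dvd_iff by blast
    moreover have "mpoly_rename (merge x y) W \<noteq> 0"
      unfolding W_def using \<open>x < y\<close>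
      by (intro merge_prod_var_diff_nonzero) (auto simp: colour_pairs_def)
    ultimately show False by blast
  qed
  ultimately show ?thesis by (simp add: power2_eq_iff)
qed

text \<open>Up to sign each pair crossing from \<open>B\<close> to its complement is one of the
  pairs of the Vandermonde product, and no unordered pair crosses twice. The product on the left is
  the denominator of the kernel between \<open>B\<close> and \<open>A - B\<close>.\<close>

lemma prod_var_diff_dvd_vandermonde:
  fixes A :: "('i::{finite,linorder} \<times> nat) set"
  assumes "finite A" "B \<subseteq> A"
  shows "prod var_diff {(x, y). x \<in> B \<and> y \<in> A - B \<and> fst x = fst y} dvd vandermonde A"
    (is "prod _ ?R dvd _")
proof -
  define r where "r = (\<lambda>p :: ('i \<times> nat) \<times> ('i \<times> nat). if fst p < snd p then p else prod.swap p)"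
  have fin: "finite ?R" by (rule finite_subset[of _ "A \<times> A"]) (use assms in auto)
  have "inj_on r ?R"
    by (rule inj_onI) (auto simp: r_def prod.swap_def split: if_splits)
  then have "(\<Prod>p\<in>?R. var_diff (r p)) = prod var_diff (r ` ?R)"
    by (simp add: prod.reindex comp_def)
  moreover have "r p \<in> colour_pairs A" if "p \<in> ?R" for p
  proof -
    obtain x y where p: "p = (x, y)" by (cases p)
    with that assms(2) have "x \<in> A" "y \<in> A" "x \<noteq> y" "fst x = fst y" by auto
    then show ?thesis
      using linorder_less_linear[of x y] by (auto simp: r_def p colour_pairs_def)
  qed
  then have "r ` ?R \<subseteq> colour_pairs A" by blast
  moreover have "prod var_diff ?R dvd (\<Prod>p\<in>?R. var_diff (r p))"
  proof (rule prod_dvd_prod)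
    fix p assume "p \<in> ?R"
    have swap: "var_diff (prod.swap p) = - var_diff p"
      by (simp add: var_diff_def split: prod.split)
    show "var_diff p dvd var_diff (r p)"
    proof (cases "fst p < snd p")
      case False
      then have "var_diff (r p) = - var_diff p" by (simp only: r_def if_False swap)
      then show ?thesis by (simp only: dvd_minus_iff dvd_refl)
    qed (simp only: r_def if_True dvd_refl)
  qed
  ultimately show ?thesis
    unfolding vandermonde_def using finite_colour_pairs[OF assms(1)]
    by (simp add: dvd_trans[OF _ prod_dvd_prod_subset])
qed


section \<open>The convolution product of set functions\<close>

definition gvar :: "'i \<times> nat \<Rightarrow> 'i::{finite,linorder} mpoly fract" where
  "gvar x = fract_of (mpoly_var x)"

lemma gvar_eq_iff [simp]: "gvar x = gvar y \<longleftrightarrow> x = y"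
  by (simp add: gvar_def)

lemma fract_rename_gvar: "colour_perm \<pi> \<Longrightarrow> fract_rename \<pi> (gvar x) = gvar (\<pi> x)"
  by (simp add: gvar_def fract_rename_fract_of colour_perm_bij)

lemma gvar_in_range: "gvar x \<in> range fract_of"
  and fract_const_in_range: "fract_const c \<in> range fract_of"
  and of_int_in_range: "of_int n \<in> range fract_of"
  by (auto simp: gvar_def fract_const_def simp flip: fract_of_of_int)

lemma fract_of_range_1: "1 \<in> range fract_of"
  and fract_of_range_0: "0 \<in> range fract_of"
  by (metis fract_of_1 rangeI, metis fract_of_0 rangeI)

lemma fract_of_range_add: "p \<in> range fract_of \<Longrightarrow> q \<in> range fract_of \<Longrightarrow> p + q \<in> range fract_of"
  and fract_of_range_diff: "p \<in> range fract_of \<Longrightarrow> q \<in> range fract_of \<Longrightarrow> p - q \<in> range fract_of"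
  and fract_of_range_mult: "p \<in> range fract_of \<Longrightarrow> q \<in> range fract_of \<Longrightarrow> p * q \<in> range fract_of"
  by (auto simp flip: fract_of_add fract_of_diff fract_of_mult)

lemma fract_of_range_prod:
  "(\<And>x. x \<in> A \<Longrightarrow> f x \<in> range fract_of) \<Longrightarrow> prod f A \<in> range fract_of"
proof (induction A rule: infinite_finite_induct)
  case (insert x A)
  then show ?case by (simp add: fract_of_range_mult)
qed (simp_all add: fract_of_range_1)

lemma fract_of_range_sum:
  "(\<And>x. x \<in> A \<Longrightarrow> f x \<in> range fract_of) \<Longrightarrow> sum f A \<in> range fract_of"
proof (induction A rule: infinite_finite_induct)
  case (insert x A)
  then show ?case by (simp add: fract_of_range_add)
qed (simp_all add: fract_of_range_0)

lemmas fract_of_range_intros = gvar_in_range fract_const_in_range of_int_in_range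
  fract_of_range_0 fract_of_range_1 fract_of_range_add fract_of_range_diff fract_of_range_mult
  fract_of_range_prod fract_of_range_sum

definition one_set_fun :: "'i::{finite,linorder} set_fun" where
  "one_set_fun A = (if A = {} then 1 else 0)"

locale shuffle_data =
  fixes a :: "'i::{finite,linorder} \<Rightarrow> 'i \<Rightarrow> int" and d :: "'i \<Rightarrow> int"
    and t1 t2 t3 :: "complex poly"
begin

text \<open>The case distinctions turn the products of \<open>fac2\<close>, which run over variables
  at the two ends of an arrow, into one product over all pairs of variables. This makes the kernel
  multiplicative in each of its two sets, as associativity requires.\<close>

definition arrow_factor :: "'i arrow \<Rightarrow> 'i \<times> nat \<Rightarrow> 'i \<times> nat \<Rightarrow> 'i mpoly fract" where
  "arrow_factor h x y =
     (if out_vertex h = fst x \<and> in_vertex h = fst y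
      then gvar y - gvar x + of_int (arrow_weight a d h) * fract_const t1 else 1) *
     (if in_vertex h = fst x \<and> out_vertex h = fst y
      then gvar x - gvar y - of_int (reversed_arrow_weight a d h) * fract_const t2 else 1)"

text \<open>At x = y the quotient is 0 by the convention for division by zero. The convolution meets
  distinct variables only, since \<open>B\<close> and \<open>A - B\<close> are disjoint.\<close>

definition vertex_factor :: "'i \<times> nat \<Rightarrow> 'i \<times> nat \<Rightarrow> 'i mpoly fract" where
  "vertex_factor x y =
     (if fst x = fst y
      then (gvar x - gvar y - of_int (d (fst x)) * fract_const t3) / (gvar x - gvar y) else 1)"

definition kernel :: "'i \<times> nat \<Rightarrow> 'i \<times> nat \<Rightarrow> 'i mpoly fract" where
  "kernel x y = vertex_factor x y * (\<Prod>h\<in>arrows a. arrow_factor h x y)"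

definition kernel2 :: "('i \<times> nat) set \<Rightarrow> ('i \<times> nat) set \<Rightarrow> 'i mpoly fract" where
  "kernel2 A B = (\<Prod>x\<in>A. \<Prod>y\<in>B. kernel x y)"

definition conv :: "'i set_fun \<Rightarrow> 'i set_fun \<Rightarrow> 'i set_fun" where
  "conv \<phi> \<psi> A = (\<Sum>B\<in>Pow A. \<phi> B * \<psi> (A - B) * kernel2 B (A - B))"

lemma kernel2_Un_left:
  "finite A \<Longrightarrow> finite B \<Longrightarrow> A \<inter> B = {} \<Longrightarrow> kernel2 (A \<union> B) C = kernel2 A C * kernel2 B C"
  unfolding kernel2_def by (rule prod.union_disjoint)

lemma kernel2_Un_right:
  "finite B \<Longrightarrow> finite C \<Longrightarrow> B \<inter> C = {} \<Longrightarrow> kernel2 A (B \<union> C) = kernel2 A B * kernel2 A C"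
  unfolding kernel2_def by (simp add: prod.union_disjoint prod.distrib)

lemma kernel2_empty [simp]: "kernel2 {} B = 1" "kernel2 A {} = 1"
  by (simp_all add: kernel2_def)

lemma conv_infinite: "infinite A \<Longrightarrow> conv \<phi> \<psi> A = 0"
  by (simp add: conv_def finite_Pow_iff)

lemma conv_zero_left [simp]: "conv 0 \<psi> = 0"
  and conv_zero_right [simp]: "conv \<phi> 0 = 0"
  by (simp_all add: conv_def fun_eq_iff)

lemma conv_add_left: "conv (\<phi> + \<phi>') \<psi> = conv \<phi> \<psi> + conv \<phi>' \<psi>"
  and conv_add_right: "conv \<phi> (\<psi> + \<psi>') = conv \<phi> \<psi> + conv \<phi> \<psi>'"
  by (simp_all add: conv_def fun_eq_iff algebra_simps sum.distrib)

lemma conv_scale_left: "conv (\<lambda>A. c * \<phi> A) \<psi> = (\<lambda>A. c * conv \<phi> \<psi> A)"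
  and conv_scale_right: "conv \<phi> (\<lambda>A. c * \<psi> A) = (\<lambda>A. c * conv \<phi> \<psi> A)"
  by (simp_all add: conv_def fun_eq_iff sum_distrib_left mult_ac)

lemma conv_one_left:
  assumes "\<And>A. infinite A \<Longrightarrow> \<phi> A = 0"
  shows "conv one_set_fun \<phi> = \<phi>"
proof
  fix A :: "('i \<times> nat) set"
  show "conv one_set_fun \<phi> A = \<phi> A"
  proof (cases "finite A")
    case True
    have "conv one_set_fun \<phi> A = (\<Sum>B\<in>Pow A. if B = {} then \<phi> A else 0)"
      unfolding conv_def by (rule sum.cong) (auto simp: one_set_fun_def)
    then show ?thesis using True by simp
  qed (simp add: conv_infinite assms)
qed

lemma conv_one_right:
  assumes "\<And>A. infinite A \<Longrightarrow> \<phi> A = 0"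
  shows "conv \<phi> one_set_fun = \<phi>"
proof
  fix A :: "('i \<times> nat) set"
  show "conv \<phi> one_set_fun A = \<phi> A"
  proof (cases "finite A")
    case True
    have "conv \<phi> one_set_fun A = (\<Sum>B\<in>Pow A. if B = A then \<phi> A else 0)"
      unfolding conv_def by (rule sum.cong) (auto simp: one_set_fun_def)
    then show ?thesis using True by simp
  qed (simp add: conv_infinite assms)
qed

text \<open>Both sides are sums over ordered partitions of \<open>A\<close> into three blocks C, D,
  E, and by multiplicativity of \<open>kernel2\<close> both weights are the product of the kernels
  of (C, D), (C, E) and (D, E).\<close>

lemma conv_assoc: "conv (conv \<phi> \<psi>) \<chi> = conv \<phi> (conv \<psi> \<chi>)"
proof
  fix A :: "('i \<times> nat) set"
  show "conv (conv \<phi> \<psi>) \<chi> A = conv \<phi> (conv \<psi> \<chi>) A"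
  proof (cases "finite A")
    case True
    have fin: "finite B" if "B \<subseteq> A" for B using True that by (rule rev_finite_subset)
    have "conv (conv \<phi> \<psi>) \<chi> A = (\<Sum>B\<in>Pow A. \<Sum>C\<in>Pow B.
        \<phi> C * \<psi> (B - C) * kernel2 C (B - C) * \<chi> (A - B) * kernel2 B (A - B))"
      by (simp add: conv_def sum_distrib_right)
    also have "\<dots> = (\<Sum>(B, C)\<in>Sigma (Pow A) Pow.
        \<phi> C * \<psi> (B - C) * kernel2 C (B - C) * \<chi> (A - B) * kernel2 B (A - B))"
      by (rule sum.Sigma) (use True in \<open>auto intro: fin\<close>)
    also have "\<dots> = (\<Sum>(C, D)\<in>Sigma (Pow A) (\<lambda>C. Pow (A - C)).
        \<phi> C * (\<psi> D * \<chi> (A - C - D) * kernel2 D (A - C - D)) * kernel2 C (A - C))"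
    \<comment> \<open>On the left the outer set \<open>B\<close> is the union of the first two
      blocks and \<open>C\<close> is the first; on the right the first block is chosen before the
      second, \<open>D = B - C\<close>.\<close>
    proof (rule sum.reindex_bij_witness[where
          i = "\<lambda>(C, D). (C \<union> D, C)" and j = "\<lambda>(B, C). (C, B - C)"])
      fix p assume "p \<in> Sigma (Pow A) Pow"
      then obtain B C where p: "p = (B, C)" "B \<subseteq> A" "C \<subseteq> B" by auto
      let ?D = "B - C" and ?E = "A - B"
      have B: "kernel2 B ?E = kernel2 C ?E * kernel2 ?D ?E"
        using kernel2_Un_left[of C ?D ?E] p fin[of B] by (auto simp: Un_absorb1 finite_subset)
      have "A - C = ?D \<union> ?E" "?D \<inter> ?E = {}" using p by auto
      then have C: "kernel2 C (A - C) = kernel2 C ?D * kernel2 C ?E"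
        using kernel2_Un_right[of ?D ?E C] p True fin[of B] by auto
      have E: "A - C - ?D = ?E" using p by auto
      show "(case (case p of (B, C) \<Rightarrow> (C, B - C)) of (C, D) \<Rightarrow>
          \<phi> C * (\<psi> D * \<chi> (A - C - D) * kernel2 D (A - C - D)) * kernel2 C (A - C)) =
        (case p of (B, C) \<Rightarrow>
          \<phi> C * \<psi> (B - C) * kernel2 C (B - C) * \<chi> (A - B) * kernel2 B (A - B))"
        by (simp add: p(1) E B C mult_ac)
    qed auto
    also have "\<dots> = (\<Sum>C\<in>Pow A. \<Sum>D\<in>Pow (A - C).
        \<phi> C * (\<psi> D * \<chi> (A - C - D) * kernel2 D (A - C - D)) * kernel2 C (A - C))"
      by (rule sum.Sigma[symmetric]) (use True in auto)
    also have "\<dots> = conv \<phi> (conv \<psi> \<chi>) A"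
      by (simp add: conv_def sum_distrib_left sum_distrib_right mult_ac)
    finally show ?thesis .
  qed (simp add: conv_infinite)
qed

lemma fract_rename_kernel:
  assumes "colour_perm \<pi>"
  shows "fract_rename \<pi> (kernel x y) = kernel (\<pi> x) (\<pi> y)"
proof -
  note bij = colour_perm_bij[OF assms]
  have "fract_rename \<pi> (arrow_factor h x y) = arrow_factor h (\<pi> x) (\<pi> y)" for h
    by (simp only: arrow_factor_def if_distrib[of "fract_rename \<pi>"] fract_rename_mult[OF bij] fract_rename_add[OF bij]
        fract_rename_diff[OF bij] fract_rename_1[OF bij] fract_rename_gvar[OF assms]
        fract_rename_const[OF bij] fract_rename_of_int[OF bij] colour_perm_fst[OF assms])
  moreover have "fract_rename \<pi> (vertex_factor x y) = vertex_factor (\<pi> x) (\<pi> y)"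
    by (simp only: vertex_factor_def if_distrib[of "fract_rename \<pi>"] fract_rename_mult[OF bij] fract_rename_divide[OF bij]
        fract_rename_diff[OF bij] fract_rename_1[OF bij] fract_rename_gvar[OF assms]
        fract_rename_const[OF bij] fract_rename_of_int[OF bij] colour_perm_fst[OF assms])
  ultimately show ?thesis
    by (simp add: kernel_def fract_rename_mult[OF bij] fract_rename_prod[OF bij])
qed

lemma fract_rename_kernel2:
  assumes "colour_perm \<pi>"
  shows "fract_rename \<pi> (kernel2 A B) = kernel2 (\<pi> ` A) (\<pi> ` B)"
proof -
  have inj: "inj_on \<pi> C" for C by (rule inj_on_subset[OF colour_perm_inj[OF assms] subset_UNIV])
  show ?thesis
    unfolding kernel2_def fract_rename_prod[OF colour_perm_bij[OF assms]] prod.reindex[OF inj]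
    by (simp add: fract_rename_kernel[OF assms] comp_def)
qed

lemma equivariant_conv:
  assumes "equivariant \<phi>" "equivariant \<psi>"
  shows "equivariant (conv \<phi> \<psi>)"
  unfolding equivariant_def
proof (intro allI impI)
  fix \<pi> :: "'i \<times> nat \<Rightarrow> 'i \<times> nat" and A :: "('i \<times> nat) set"
  assume \<pi>: "colour_perm \<pi>" and A: "finite A"
  note bij = colour_perm_bij[OF \<pi>]
  have inj: "inj_on (image \<pi>) (Pow A)"
    by (rule inj_onI) (use colour_perm_inj[OF \<pi>] in \<open>simp add: inj_image_eq_iff\<close>)
  have "fract_rename \<pi> (conv \<phi> \<psi> A) = (\<Sum>B\<in>Pow A. fract_rename \<pi> (\<phi> B) *
      fract_rename \<pi> (\<psi> (A - B)) * fract_rename \<pi> (kernel2 B (A - B)))"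
    by (simp add: conv_def fract_rename_sum[OF bij] fract_rename_mult[OF bij])
  also have "\<dots> = (\<Sum>B\<in>Pow A. \<phi> (\<pi> ` B) * \<psi> (\<pi> ` A - \<pi> ` B) * kernel2 (\<pi> ` B) (\<pi> ` A - \<pi> ` B))"
  proof (rule sum.cong[OF refl])
    fix B assume "B \<in> Pow A"
    then have "finite B" using A by (auto intro: finite_subset)
    then show "fract_rename \<pi> (\<phi> B) * fract_rename \<pi> (\<psi> (A - B)) *
        fract_rename \<pi> (kernel2 B (A - B)) =
      \<phi> (\<pi> ` B) * \<psi> (\<pi> ` A - \<pi> ` B) * kernel2 (\<pi> ` B) (\<pi> ` A - \<pi> ` B)"
      using A by (simp add: equivariantD[OF _ \<pi>] assms fract_rename_kernel2[OF \<pi>]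
        image_set_diff[OF colour_perm_inj[OF \<pi>]])
  qed
  also have "\<dots> = (\<Sum>B\<in>image \<pi> ` Pow A. \<phi> B * \<psi> (\<pi> ` A - B) * kernel2 B (\<pi> ` A - B))"
    by (simp add: sum.reindex[OF inj])
  also have "\<dots> = conv \<phi> \<psi> (\<pi> ` A)" by (simp add: conv_def image_Pow_surj)
  finally show "fract_rename \<pi> (conv \<phi> \<psi> A) = conv \<phi> \<psi> (\<pi> ` A)" .
qed

text \<open>Among the pairs crossing from \<open>B\<close> to \<open>A - B\<close> only the equally
  coloured ones, collected in \<open>?R\<close>, carry a denominator; their differences multiply to
  a divisor of the Vandermonde product.\<close>

lemma vandermonde_kernel2:
  assumes "finite A" "B \<subseteq> A"
  shows "fract_of (vandermonde A) * kernel2 B (A - B) \<in> range fract_of"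
proof -
  let ?R = "{(x, y). x \<in> B \<and> y \<in> A - B \<and> fst x = fst y}"
  have fin: "finite B" "finite (A - B)" using assms finite_subset by auto
  have arrows: "(\<Prod>h\<in>arrows a. arrow_factor h x y) \<in> range fract_of" for x y
    unfolding arrow_factor_def by (intro fract_of_range_intros) (auto intro: fract_of_range_intros)
  have "kernel2 B (A - B) = (\<Prod>p\<in>B \<times> (A - B). vertex_factor (fst p) (snd p)) *
      (\<Prod>x\<in>B. \<Prod>y\<in>A - B. \<Prod>h\<in>arrows a. arrow_factor h x y)"
    by (simp add: kernel2_def kernel_def prod.distrib prod.cartesian_product case_prod_unfold)
  moreover have "(\<Prod>p\<in>B \<times> (A - B). vertex_factor (fst p) (snd p)) =
      (\<Prod>p\<in>?R. vertex_factor (fst p) (snd p))"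
    by (rule prod.mono_neutral_right) (use fin in \<open>auto simp: vertex_factor_def\<close>)
  moreover have "(\<Prod>p\<in>?R. vertex_factor (fst p) (snd p)) =
      (\<Prod>p\<in>?R. gvar (fst p) - gvar (snd p) - of_int (d (fst (fst p))) * fract_const t3) /
      fract_of (prod var_diff ?R)"
    unfolding fract_of_prod prod_dividef[symmetric]
    by (rule prod.cong) (auto simp: vertex_factor_def var_diff_def fract_of_diff gvar_def)
  moreover obtain w where w: "vandermonde A = prod var_diff ?R * w"
    using prod_var_diff_dvd_vandermonde[OF assms] by (auto elim: dvdE)
  moreover have "prod var_diff ?R \<noteq> 0"
    using w vandermonde_nonzero[OF assms(1)] by auto
  ultimately have "fract_of (vandermonde A) * kernel2 B (A - B) = fract_of w *
      (\<Prod>p\<in>?R. gvar (fst p) - gvar (snd p) - of_int (d (fst (fst p))) * fract_const t3) *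
      (\<Prod>x\<in>B. \<Prod>y\<in>A - B. \<Prod>h\<in>arrows a. arrow_factor h x y)"
    by (simp add: fract_of_mult)
  moreover have "fract_of w *
      (\<Prod>p\<in>?R. gvar (fst p) - gvar (snd p) - of_int (d (fst (fst p))) * fract_const t3) *
      (\<Prod>x\<in>B. \<Prod>y\<in>A - B. \<Prod>h\<in>arrows a. arrow_factor h x y) \<in> range fract_of"
    by (intro fract_of_range_intros arrows rangeI)
  ultimately show ?thesis by simp
qed

text \<open>Clearing denominators turns the symmetric convolution into an antisymmetric polynomial,
  which is divisible by the Vandermonde product.\<close>

lemma conv_in_range:
  assumes \<phi>: "regular \<phi>" and \<psi>: "regular \<psi>" and A: "finite A"
  shows "conv \<phi> \<psi> A \<in> range fract_of"
proof -
  have "fract_of (vandermonde A) * conv \<phi> \<psi> A = (\<Sum>B\<in>Pow A. \<phi> B * \<psi> (A - B) *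
      (fract_of (vandermonde A) * kernel2 B (A - B)))"
    by (simp add: conv_def sum_distrib_left mult_ac)
  also have "\<dots> \<in> range fract_of"
  proof (rule fract_of_range_sum)
    fix B assume "B \<in> Pow A"
    then have "B \<subseteq> A" "finite B" "finite (A - B)" using A finite_subset by auto
    then show "\<phi> B * \<psi> (A - B) * (fract_of (vandermonde A) * kernel2 B (A - B)) \<in> range fract_of"
      using \<phi> \<psi> unfolding regular_def
      by (intro fract_of_range_mult vandermonde_kernel2 A) simp_all
  qed
  finally obtain g where g: "fract_of (vandermonde A) * conv \<phi> \<psi> A = fract_of g" by auto
  have "prod var_diff (colour_pairs A) dvd g"
  proof (rule prod_var_diff_dvd)
    fix p assume p: "p \<in> colour_pairs A"
    then show "fst p < snd p" by (auto simp: colour_pairs_def)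
    obtain x y where xy: "p = (x, y)" by (cases p)
    let ?\<tau> = "Transposition.transpose x y"
    have "x \<in> A" "y \<in> A" "fst x = fst y" using p by (simp_all add: xy colour_pairs_def)
    then have \<tau>: "colour_perm ?\<tau>" "?\<tau> ` A = A" by (simp_all add: colour_perm_transpose)
    note bij = colour_perm_bij[OF \<tau>(1)]
    have "fract_rename ?\<tau> (conv \<phi> \<psi> A) = conv \<phi> \<psi> A"
      using equivariantD[OF equivariant_conv \<tau>(1) A, of \<phi> \<psi>] \<phi> \<psi> \<tau>(2)
      by (simp add: regular_def)
    then have "fract_rename ?\<tau> (fract_of (vandermonde A) * conv \<phi> \<psi> A) =
        - (fract_of (vandermonde A) * conv \<phi> \<psi> A)"
      using vandermonde_transpose[OF A p[unfolded xy]]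
      by (simp add: fract_rename_mult[OF bij] fract_rename_fract_of[OF bij] fract_of_uminus)
    then have "fract_of (mpoly_rename ?\<tau> g) = fract_of (- g)"
      by (simp only: g fract_rename_fract_of[OF bij] fract_of_uminus)
    then show "var_diff p dvd g" by (simp add: xy antisymmetric_dvd)
  qed (rule finite_colour_pairs[OF A])
  then obtain h where "g = vandermonde A * h" by (auto simp: vandermonde_def elim: dvdE)
  then have "conv \<phi> \<psi> A = fract_of h"
    using g vandermonde_nonzero[OF A] by (simp add: fract_of_mult)
  then show ?thesis by simp
qed

lemma regular_conv:
  assumes \<phi>: "regular \<phi>" and \<psi>: "regular \<psi>"
  shows "regular (conv \<phi> \<psi>)"
proof -
  define supp where "supp = (\<lambda>\<chi> :: 'i set_fun. {v. \<chi> (std_vars v) \<noteq> 0})"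
  have count: "colour_count B \<in> supp \<chi>" if "equivariant \<chi>" "finite B" "\<chi> B \<noteq> 0" for \<chi> B
  proof -
    obtain \<pi> where \<pi>: "colour_perm \<pi>" "\<pi> ` std_vars (colour_count B) = B"
      using ex_colour_perm_std_vars[OF \<open>finite B\<close>] by blast
    then show ?thesis
      using equivariantD[OF that(1) \<pi>(1), of "std_vars (colour_count B)"] that(3)
      by (auto simp: supp_def fract_rename_0[OF colour_perm_bij])
  qed
  \<comment> \<open>A nonzero convolution has a nonzero summand, whose two sets have degrees in the
    two supports by \<open>count\<close>; degrees of disjoint sets add.\<close>
  have "supp (conv \<phi> \<psi>) \<subseteq> (\<lambda>(v1, v2) i. v1 i + v2 i) ` (supp \<phi> \<times> supp \<psi>)"
  proof
    fix v assume "v \<in> supp (conv \<phi> \<psi>)"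
    then have "conv \<phi> \<psi> (std_vars v) \<noteq> 0" by (simp add: supp_def)
    then obtain B where B: "B \<subseteq> std_vars v" "\<phi> B \<noteq> 0" "\<psi> (std_vars v - B) \<noteq> 0"
      unfolding conv_def by (metis (no_types, lifting) Pow_iff mult_zero_left mult_zero_right sum.neutral)
    have fin: "finite B" "finite (std_vars v - B)" using finite_subset[OF B(1)] by simp_all
    have "v = colour_count (B \<union> (std_vars v - B))" using B(1) by (simp add: Un_absorb1)
    also have "\<dots> = (\<lambda>i. colour_count B i + colour_count (std_vars v - B) i)"
      by (rule colour_count_Un) (use fin in auto)
    finally have "v = (\<lambda>(v1, v2) i. v1 i + v2 i) (colour_count B, colour_count (std_vars v - B))"
      by simp
    moreover have "(colour_count B, colour_count (std_vars v - B)) \<in> supp \<phi> \<times> supp \<psi>"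
      using count fin B \<phi> \<psi> by (simp add: regular_def)
    ultimately show "v \<in> (\<lambda>(v1, v2) i. v1 i + v2 i) ` (supp \<phi> \<times> supp \<psi>)" by (rule image_eqI)
  qed
  moreover have "finite (supp \<phi> \<times> supp \<psi>)" using \<phi> \<psi> by (simp add: regular_def supp_def)
  ultimately have "finite (supp (conv \<phi> \<psi>))" using finite_surj by blast
  then show ?thesis
    using \<phi> \<psi> unfolding regular_def[of "conv \<phi> \<psi>"]
    by (auto simp: supp_def conv_infinite conv_in_range regular_def equivariant_conv)
qed

end


section \<open>The shuffle product is the convolution product\<close>

text \<open>The list of values of a strictly increasing function is the sorted list of its image, so
  the image determines the function.\<close>

lemma strict_mono_on_image_eqD:
  fixes f g :: "nat \<Rightarrow> nat"
  assumes f: "strict_mono_on {m..n} f" and g: "strict_mono_on {m..n} g"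
    and eq: "f ` {m..n} = g ` {m..n}" and k: "k \<in> {m..n}"
  shows "f k = g k"
proof -
  have "map h [m..<Suc n] = sorted_list_of_set (h ` {m..n})"
    if h: "strict_mono_on {m..n} h" for h :: "nat \<Rightarrow> nat"
  proof -
    have "sorted_wrt (<) (map h [m..<Suc n])"
      unfolding sorted_wrt_map
      by (rule sorted_wrt_mono_rel[of _ "(<)"])
        (auto simp del: upt_Suc intro: strict_mono_onD[OF h])
    then have "sorted (map h [m..<Suc n])" "distinct (map h [m..<Suc n])"
      by (simp_all add: strict_sorted_iff del: upt_Suc)
    moreover have "set (map h [m..<Suc n]) = h ` {m..n}" by (auto simp del: upt_Suc)
    ultimately show ?thesis using sorted_list_of_set.idem_if_sorted_distinct by metis
  qed
  then have "map f [m..<Suc n] = map g [m..<Suc n]" using f g eq by metis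
  then show ?thesis using k by (auto simp del: upt_Suc)
qed

text \<open>The image of the second block is the complement of the image of the first, and on each
  block the shuffle is the increasing enumeration of its image.\<close>

lemma shuffles2_eqI:
  assumes \<sigma>: "\<sigma> \<in> shuffles2 p q" and \<tau>: "\<tau> \<in> shuffles2 p q" and eq: "\<sigma> ` {1..p} = \<tau> ` {1..p}"
  shows "\<sigma> = \<tau>"
proof
  fix k
  have image: "\<rho> ` {p + 1..p + q} = {1..p + q} - \<rho> ` {1..p}" if "\<rho> \<in> shuffles2 p q" for \<rho>
  proof -
    have "\<rho> permutes {1..p + q}" using that by (simp add: shuffles2_def)
    then have "inj \<rho>" "\<rho> ` {1..p + q} = {1..p + q}" by (simp_all add: permutes_inj permutes_image)
    moreover have "{p + 1..p + q} = {1..p + q} - {1..p}" by auto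
    ultimately show ?thesis by (metis image_set_diff)
  qed
  consider "k \<in> {1..p}" | "k \<in> {p + 1..p + q}" | "k \<notin> {1..p + q}" by force
  then show "\<sigma> k = \<tau> k"
  proof cases
    case 1
    then show ?thesis
      using strict_mono_on_image_eqD[of 1 p \<sigma> \<tau> k] assms by (simp add: shuffles2_def)
  next
    case 2
    then show ?thesis
      using strict_mono_on_image_eqD[of "p + 1" "p + q" \<sigma> \<tau> k] \<sigma> \<tau> eq image[OF \<sigma>] image[OF \<tau>]
      by (simp add: shuffles2_def)
  next
    case 3
    then show ?thesis using \<sigma> \<tau> by (simp add: shuffles2_def permutes_def)
  qed
qed

lemma ex_shuffles2:
  assumes B: "B \<subseteq> {1..p + q}" and card: "card B = p"
  shows "\<exists>\<sigma>\<in>shuffles2 p q. \<sigma> ` {1..p} = B"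
proof -
  let ?C = "{1..p + q} - B"
  have fin: "finite B" "finite ?C" using B finite_subset by auto
  have "card ?C = q" using B card by (simp add: card_Diff_subset[OF fin(1)])
  then obtain g where g: "bij_betw g {..<q} ?C" "strict_mono_on {..<q} g"
    using ex_bij_betw_strict_mono_card[OF fin(2)] by metis
  obtain f where f: "bij_betw f {..<p} B" "strict_mono_on {..<p} f"
    using ex_bij_betw_strict_mono_card[OF fin(1)] card by metis
  \<comment> \<open>The enumerations \<open>f\<close> and \<open>g\<close> start at 0, the two
    blocks at 1 and at \<open>p + 1\<close>; hence the shifts.\<close>
  define \<sigma> where "\<sigma> = (\<lambda>k. if k \<in> {1..p} then f (k - 1)
    else if k \<in> {p + 1..p + q} then g (k - (p + 1)) else k)"
  have "bij_betw (\<lambda>k. k - 1) {1..p} {..<p}"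
    by (rule bij_betw_byWitness[where f' = "\<lambda>k. k + 1"]) auto
  then have "bij_betw (f \<circ> (\<lambda>k. k - 1)) {1..p} B" using f(1) by (rule bij_betw_trans)
  then have "bij_betw \<sigma> {1..p} B"
    by (rule bij_betw_cong[THEN iffD1, rotated]) (simp add: \<sigma>_def)
  moreover have "bij_betw (\<lambda>k. k - (p + 1)) {p + 1..p + q} {..<q}"
    by (rule bij_betw_byWitness[where f' = "\<lambda>k. k + (p + 1)"]) auto
  then have "bij_betw (g \<circ> (\<lambda>k. k - (p + 1))) {p + 1..p + q} ?C"
    using g(1) by (rule bij_betw_trans)
  then have "bij_betw \<sigma> {p + 1..p + q} ?C"
    by (rule bij_betw_cong[THEN iffD1, rotated]) (simp add: \<sigma>_def)
  ultimately have "bij_betw \<sigma> ({1..p} \<union> {p + 1..p + q}) (B \<union> ?C)"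
    by (rule bij_betw_combine) auto
  moreover have "{1..p} \<union> {p + 1..p + q} = {1..p + q}" "B \<union> ?C = {1..p + q}" using B by auto
  ultimately have "bij_betw \<sigma> {1..p + q} {1..p + q}" by simp
  then have "\<sigma> permutes {1..p + q}"
    by (rule bij_imp_permutes) (auto simp: \<sigma>_def)
  moreover have "strict_mono_on {1..p} \<sigma>"
    unfolding strict_mono_on_def by (auto simp: \<sigma>_def intro!: strict_mono_onD[OF f(2)])
  moreover have "strict_mono_on {p + 1..p + q} \<sigma>"
    unfolding strict_mono_on_def by (auto simp: \<sigma>_def intro!: strict_mono_onD[OF g(2)])
  moreover have "\<sigma> ` {1..p} = B" using \<open>bij_betw \<sigma> {1..p} B\<close> by (simp add: bij_betw_def)
  ultimately show ?thesis by (auto simp: shuffles2_def)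
qed

definition shuffle_image :: "('i \<Rightarrow> nat) \<Rightarrow> ('i \<Rightarrow> nat \<Rightarrow> nat) \<Rightarrow> ('i \<times> nat) set" where
  "shuffle_image v \<sigma> = (\<lambda>(i, s). (i, \<sigma> i s)) ` std_vars v"

lemma shuffle_image_slice: "{s. (i, s) \<in> shuffle_image v \<sigma>} = \<sigma> i ` {1..v i}"
  by (auto simp: shuffle_image_def std_vars_def)

lemma shuffle_image_eq: "shuffle_image v \<sigma> = {(i, s). s \<in> \<sigma> i ` {1..v i}}"
  using shuffle_image_slice[of _ v \<sigma>] by (auto simp: set_eq_iff)

lemma shuffles_famD:
  assumes "\<sigma> \<in> shuffles_fam v1 v2"
  shows "\<sigma> i \<in> shuffles2 (v1 i) (v2 i)" "\<sigma> i permutes {1..v1 i + v2 i}" "inj (\<sigma> i)"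
proof -
  show 1: "\<sigma> i \<in> shuffles2 (v1 i) (v2 i)" using assms by (simp add: shuffles_fam_def)
  then show 2: "\<sigma> i permutes {1..v1 i + v2 i}" by (simp add: shuffles2_def)
  show "inj (\<sigma> i)" by (rule permutes_inj[OF 2])
qed

lemma colour_perm_family:
  assumes "\<And>i. bij (\<sigma> i)"
  shows "colour_perm (\<lambda>(i, s). (i, \<sigma> i s))"
proof -
  have "bij (\<lambda>(i, s). (i, \<sigma> i s))"
  proof (rule o_bij[where g = "\<lambda>(i, s). (i, inv_into UNIV (\<sigma> i) s)"])
    show "(\<lambda>(i, s). (i, inv_into UNIV (\<sigma> i) s)) \<circ> (\<lambda>(i, s). (i, \<sigma> i s)) = id"
      using assms by (auto simp: fun_eq_iff bij_is_inj)
    show "(\<lambda>(i, s). (i, \<sigma> i s)) \<circ> (\<lambda>(i, s). (i, inv_into UNIV (\<sigma> i) s)) = id"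
      using assms by (auto simp: fun_eq_iff surj_f_inv_f bij_is_surj)
  qed
  then show ?thesis by (auto simp: colour_perm_def)
qed

text \<open>This replaces sums over shuffles by sums over subsets: in each colour a shuffle amounts
  to the choice of the variables that receive those of the first factor.\<close>

lemma bij_betw_shuffle_image:
  fixes v1 v2 :: "'i::finite \<Rightarrow> nat"
  shows "bij_betw (shuffle_image v1) (shuffles_fam v1 v2)
    {B. B \<subseteq> std_vars (\<lambda>i. v1 i + v2 i) \<and> colour_count B = v1}"
proof (rule bij_betw_imageI)
  show "inj_on (shuffle_image v1) (shuffles_fam v1 v2)"
  proof (rule inj_onI)
    fix \<sigma> \<tau> assume \<sigma>: "\<sigma> \<in> shuffles_fam v1 v2" and \<tau>: "\<tau> \<in> shuffles_fam v1 v2"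
      and eq: "shuffle_image v1 \<sigma> = shuffle_image v1 \<tau>"
    show "\<sigma> = \<tau>"
    proof
      fix i
      have "\<sigma> i ` {1..v1 i} = \<tau> i ` {1..v1 i}"
        using shuffle_image_slice[of i v1 \<sigma>] shuffle_image_slice[of i v1 \<tau>] eq by simp
      then show "\<sigma> i = \<tau> i" using shuffles_famD(1)[OF \<sigma>] shuffles_famD(1)[OF \<tau>]
        by (intro shuffles2_eqI)
    qed
  qed
  show "shuffle_image v1 ` shuffles_fam v1 v2 =
    {B. B \<subseteq> std_vars (\<lambda>i. v1 i + v2 i) \<and> colour_count B = v1}"
  proof (intro equalityI subsetI)
    fix B assume "B \<in> shuffle_image v1 ` shuffles_fam v1 v2"
    then obtain \<sigma> where \<sigma>: "\<sigma> \<in> shuffles_fam v1 v2" and B: "B = shuffle_image v1 \<sigma>" by blast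
    have "\<sigma> i ` {1..v1 i} \<subseteq> {1..v1 i + v2 i}" for i
      using permutes_image[OF shuffles_famD(2)[OF \<sigma>, of i]] by (metis atLeastatMost_subset_iff
          image_mono le_add1 le_refl)
    then have "B \<subseteq> std_vars (\<lambda>i. v1 i + v2 i)"
      by (fastforce simp: B shuffle_image_eq std_vars_def)
    moreover have "colour_count B i = v1 i" for i
      using card_image[OF inj_on_subset[OF shuffles_famD(3)[OF \<sigma>] subset_UNIV], of i "{1..v1 i}"]
      by (simp only: B colour_count_def shuffle_image_slice card_atLeastAtMost diff_Suc_1)
    ultimately show "B \<in> {B. B \<subseteq> std_vars (\<lambda>i. v1 i + v2 i) \<and> colour_count B = v1}" by auto
  next
    fix B assume "B \<in> {B. B \<subseteq> std_vars (\<lambda>i. v1 i + v2 i) \<and> colour_count B = v1}"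
    then have B: "B \<subseteq> std_vars (\<lambda>i. v1 i + v2 i)" "\<And>i. card {s. (i, s) \<in> B} = v1 i"
      by (auto simp: colour_count_def)
    have "\<exists>\<tau>\<in>shuffles2 (v1 i) (v2 i). \<tau> ` {1..v1 i} = {s. (i, s) \<in> B}" for i
      by (rule ex_shuffles2) (use B in \<open>auto simp: std_vars_def\<close>)
    then obtain \<sigma> where \<sigma>: "\<And>i. \<sigma> i \<in> shuffles2 (v1 i) (v2 i)"
      "\<And>i. \<sigma> i ` {1..v1 i} = {s. (i, s) \<in> B}" by metis
    then have "B = shuffle_image v1 \<sigma>" by (auto simp: shuffle_image_eq)
    moreover have "\<sigma> \<in> shuffles_fam v1 v2" using \<sigma>(1) by (simp add: shuffles_fam_def)
    ultimately show "B \<in> shuffle_image v1 ` shuffles_fam v1 v2" by blast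
  qed
qed

lemma std_vars_minus_shuffle_image:
  assumes "\<sigma> \<in> shuffles_fam v1 v2"
  shows "std_vars (\<lambda>i. v1 i + v2 i) - shuffle_image v1 \<sigma> =
    (\<lambda>(i, t). (i, \<sigma> i (t + v1 i))) ` std_vars v2"
proof -
  have "{1..v1 i + v2 i} - \<sigma> i ` {1..v1 i} = (\<lambda>t. \<sigma> i (t + v1 i)) ` {1..v2 i}" for i
  proof -
    have "(\<lambda>t. t + v1 i) ` {1..v2 i} = {1..v1 i + v2 i} - {1..v1 i}"
      by (simp add: image_add_atLeastAtMost') auto
    then have "(\<lambda>t. \<sigma> i (t + v1 i)) ` {1..v2 i} = \<sigma> i ` ({1..v1 i + v2 i} - {1..v1 i})"
      by (metis image_image)
    also have "\<dots> = {1..v1 i + v2 i} - \<sigma> i ` {1..v1 i}"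
      using shuffles_famD[OF assms, of i] by (simp add: image_set_diff permutes_image)
    finally show ?thesis by simp
  qed
  then have "(s \<in> {1..v1 i + v2 i} \<and> s \<notin> \<sigma> i ` {1..v1 i}) \<longleftrightarrow>
      s \<in> (\<lambda>t. \<sigma> i (t + v1 i)) ` {1..v2 i}" for i s
    by blast
  then have eq: "(i, s) \<in> std_vars (\<lambda>i. v1 i + v2 i) - shuffle_image v1 \<sigma> \<longleftrightarrow>
      (i, s) \<in> (\<lambda>(i, t). (i, \<sigma> i (t + v1 i))) ` std_vars v2" for i s
    unfolding shuffle_image_eq by (auto simp: std_vars_def image_iff Bex_def)
  show ?thesis
  proof (rule Set.set_eqI)
    fix x
    show "x \<in> std_vars (\<lambda>i. v1 i + v2 i) - shuffle_image v1 \<sigma> \<longleftrightarrow>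
        x \<in> (\<lambda>(i, t). (i, \<sigma> i (t + v1 i))) ` std_vars v2"
      by (cases x) (simp only: eq)
  qed
qed

lemma prod_std_vars:
  "prod f (std_vars v) = (\<Prod>i\<in>(UNIV :: 'i::finite set). \<Prod>s=1..v i. f (i, s))"
proof -
  have "std_vars v = Sigma UNIV (\<lambda>i. {1..v i})" by (auto simp: std_vars_def)
  then show ?thesis by (simp add: prod.Sigma)
qed

lemma prod_std_vars_delta:
  "(\<Prod>x\<in>std_vars v. if k = fst x then f x else 1) = (\<Prod>s=1..v (k :: 'i::finite). f (k, s))"
proof -
  have "(\<Prod>x\<in>std_vars v. if k = fst x then f x else 1) =
      (\<Prod>i\<in>UNIV. if k = i then \<Prod>s=1..v i. f (i, s) else 1)"
    unfolding prod_std_vars by (rule prod.cong) auto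
  then show ?thesis by simp
qed

lemma prod_std_vars_delta2:
  "(\<Prod>x\<in>std_vars v. \<Prod>y\<in>std_vars w. if k = fst x \<and> l = fst y then f x y else 1) =
    (\<Prod>s=1..v (k :: 'i::finite). \<Prod>t=1..w (l :: 'i). f (k, s) (l, t))"
proof -
  have "(\<Prod>x\<in>std_vars v. \<Prod>y\<in>std_vars w. if k = fst x \<and> l = fst y then f x y else 1) =
      (\<Prod>x\<in>std_vars v. if k = fst x then \<Prod>y\<in>std_vars w. if l = fst y then f x y else 1 else 1)"
    by (rule prod.cong) auto
  then show ?thesis by (simp only: prod_std_vars_delta)
qed

lemma SH_component_0: "0 \<in> SH_component v"
  by (simp add: SH_component_def)

lemma SH_component_add: "f \<in> SH_component v \<Longrightarrow> g \<in> SH_component v \<Longrightarrow> f + g \<in> SH_component v"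
  using mpoly_vars_add[of f g] unfolding SH_component_def by (auto simp: mpoly_rename_add)

lemma SH_component_scale: "f \<in> SH_component v \<Longrightarrow> mpoly_const c * f \<in> SH_component v"
  using mpoly_vars_mult[of "mpoly_const c" f] unfolding SH_component_def
  by (auto simp: mpoly_rename_mult)

lemma single_in_sh_carrier: "f \<in> SH_component v \<Longrightarrow> Poly_Mapping.single v f \<in> sh_carrier"
  by (simp add: sh_carrier_def lookup_single when_def SH_component_0)

lemma zero_in_sh_carrier: "0 \<in> sh_carrier"
  and add_in_sh_carrier: "F \<in> sh_carrier \<Longrightarrow> G \<in> sh_carrier \<Longrightarrow> F + G \<in> sh_carrier"
  by (simp_all add: sh_carrier_def SH_component_0 SH_component_add lookup_add)

lemma sum_in_sh_carrier: "(\<And>x. x \<in> A \<Longrightarrow> F x \<in> sh_carrier) \<Longrightarrow> sum F A \<in> sh_carrier"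
  by (induction A rule: infinite_finite_induct)
    (auto simp: zero_in_sh_carrier add_in_sh_carrier)

lemma embed_0 [simp]: "embed 0 = 0"
  by (simp add: embed_def fun_eq_iff)

lemma embed_add: "embed (F + G) = embed F + embed G"
  by (simp add: embed_def fun_eq_iff lookup_add mpoly_rename_add fract_of_add)

lemma embed_sum: "embed (sum F A) = (\<Sum>x\<in>A. embed (F x))"
  by (induction A rule: infinite_finite_induct) (simp_all add: embed_add)

lemma embed_single_eq_0: "colour_count A \<noteq> v \<Longrightarrow> embed (Poly_Mapping.single v f) A = 0"
  by (simp add: embed_def lookup_single when_def)

section \<open>Comparison of the two products\<close>

context shuffle_data
begin

text \<open>The product over pairs of variables is regrouped by colour for the vertex factors and by
  arrow for the arrow factors; pairs of the wrong colours contribute 1.\<close>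

lemma kernel2_shuffle:
  assumes \<sigma>: "\<sigma> \<in> shuffles_fam v1 v2"
  defines "x \<equiv> \<lambda>i s. gvar (i, \<sigma> i s)" and "y \<equiv> \<lambda>i t. gvar (i, \<sigma> i (t + v1 i))"
  shows "kernel2 (shuffle_image v1 \<sigma>)
      (std_vars (\<lambda>i. v1 i + v2 i) - shuffle_image v1 \<sigma>) =
    fac1 d t3 v1 v2 x y * fac2 a d t1 t2 v1 v2 x y"
proof -
  let ?\<rho> = "\<lambda>(i, s). (i, \<sigma> i s)" and ?\<rho>' = "\<lambda>(i, t). (i, \<sigma> i (t + v1 i))"
  have inj: "inj_on ?\<rho> (std_vars v1)" "inj_on ?\<rho>' (std_vars v2)"
    by (auto simp: inj_on_def inj_eq[OF shuffles_famD(3)[OF \<sigma>]])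
  have "kernel2 (shuffle_image v1 \<sigma>) (std_vars (\<lambda>i. v1 i + v2 i) - shuffle_image v1 \<sigma>) =
      (\<Prod>p\<in>std_vars v1. \<Prod>q\<in>std_vars v2. kernel (?\<rho> p) (?\<rho>' q))"
    unfolding std_vars_minus_shuffle_image[OF \<sigma>] unfolding shuffle_image_def
    by (simp add: kernel2_def prod.reindex[OF inj(1)] prod.reindex[OF inj(2)])
  also have "\<dots> = (\<Prod>p\<in>std_vars v1. \<Prod>q\<in>std_vars v2. vertex_factor (?\<rho> p) (?\<rho>' q)) *
      (\<Prod>p\<in>std_vars v1. \<Prod>q\<in>std_vars v2. \<Prod>h\<in>arrows a. arrow_factor h (?\<rho> p) (?\<rho>' q))"
    by (simp add: kernel_def prod.distrib)
  also have "(\<Prod>p\<in>std_vars v1. \<Prod>q\<in>std_vars v2. vertex_factor (?\<rho> p) (?\<rho>' q)) =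
      fac1 d t3 v1 v2 x y"
  proof -
    have "(\<Prod>q\<in>std_vars v2. vertex_factor (?\<rho> p) (?\<rho>' q)) =
        (\<Prod>q\<in>std_vars v2. if fst p = fst q then
          (x (fst p) (snd p) - y (fst q) (snd q) - of_int (d (fst p)) * fract_const t3) /
          (x (fst p) (snd p) - y (fst q) (snd q)) else 1)" for p
      by (rule prod.cong) (simp_all add: vertex_factor_def x_def y_def case_prod_unfold)
    then have "(\<Prod>q\<in>std_vars v2. vertex_factor (?\<rho> p) (?\<rho>' q)) =
        (\<Prod>t=1..v2 (fst p).
          (x (fst p) (snd p) - y (fst p) t - of_int (d (fst p)) * fract_const t3) /
          (x (fst p) (snd p) - y (fst p) t))" for p
      unfolding prod_std_vars_delta by simp
    then show ?thesis unfolding fac1_def by (simp add: prod_std_vars)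
  qed
  also have "(\<Prod>p\<in>std_vars v1. \<Prod>q\<in>std_vars v2. \<Prod>h\<in>arrows a. arrow_factor h (?\<rho> p) (?\<rho>' q)) =
      (\<Prod>h\<in>arrows a. \<Prod>p\<in>std_vars v1. \<Prod>q\<in>std_vars v2. arrow_factor h (?\<rho> p) (?\<rho>' q))"
    by (subst prod.swap) (intro prod.cong refl, subst prod.swap, rule refl)
  also have "\<dots> = fac2 a d t1 t2 v1 v2 x y"
    unfolding fac2_def
  proof (rule prod.cong[OF refl])
    fix h assume "h \<in> arrows a"
    have "arrow_factor h (?\<rho> p) (?\<rho>' q) =
      (if out_vertex h = fst p \<and> in_vertex h = fst q
       then y (fst q) (snd q) - x (fst p) (snd p) + of_int (arrow_weight a d h) * fract_const t1
       else 1) *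
      (if in_vertex h = fst p \<and> out_vertex h = fst q
       then x (fst p) (snd p) - y (fst q) (snd q)
         - of_int (reversed_arrow_weight a d h) * fract_const t2 else 1)" for p q
      by (simp only: arrow_factor_def x_def y_def case_prod_unfold fst_conv snd_conv)
    then show "(\<Prod>p\<in>std_vars v1. \<Prod>q\<in>std_vars v2. arrow_factor h (?\<rho> p) (?\<rho>' q)) =
      (\<Prod>s=1..v1 (out_vertex h). \<Prod>t=1..v2 (in_vertex h).
         y (in_vertex h) t - x (out_vertex h) s + of_int (arrow_weight a d h) * fract_const t1) *
      (\<Prod>s=1..v1 (in_vertex h). \<Prod>t=1..v2 (out_vertex h).
         x (in_vertex h) s - y (out_vertex h) t
           - of_int (reversed_arrow_weight a d h) * fract_const t2)"
      by (simp only: prod.distrib prod_std_vars_delta2 fst_conv snd_conv)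
  qed
  finally show ?thesis .
qed

lemma sum_shuffle_summand:
  assumes f: "f \<in> SH_component v1" and g: "g \<in> SH_component v2"
  shows "(\<Sum>\<sigma>\<in>shuffles_fam v1 v2. shuffle_summand a d t1 t2 t3 v1 v2 f g \<sigma>) =
    conv (embed (Poly_Mapping.single v1 f)) (embed (Poly_Mapping.single v2 g))
      (std_vars (\<lambda>i. v1 i + v2 i))"
proof -
  let ?\<phi> = "embed (Poly_Mapping.single v1 f)" and ?\<psi> = "embed (Poly_Mapping.single v2 g)"
  let ?S = "std_vars (\<lambda>i. v1 i + v2 i)"
  have summand: "shuffle_summand a d t1 t2 t3 v1 v2 f g \<sigma> =
      ?\<phi> (shuffle_image v1 \<sigma>) * ?\<psi> (?S - shuffle_image v1 \<sigma>) *
      kernel2 (shuffle_image v1 \<sigma>) (?S - shuffle_image v1 \<sigma>)"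
    if \<sigma>: "\<sigma> \<in> shuffles_fam v1 v2" for \<sigma>
  proof -
    let ?\<rho> = "\<lambda>(i, s). (i, \<sigma> i s)" and ?\<rho>' = "\<lambda>(i, t). (i, \<sigma> i (t + v1 i))"
    have "colour_perm ?\<rho>"
      using shuffles_famD(2)[OF \<sigma>] by (intro colour_perm_family permutes_bij)
    then have 1: "?\<phi> (shuffle_image v1 \<sigma>) = fract_of (mpoly_rename ?\<rho> f)"
      unfolding shuffle_image_def by (subst embed_image[OF single_in_sh_carrier[OF f]]) simp_all
    \<comment> \<open>Because of the shift by \<open>v1 i\<close> this renaming is in general not
      surjective. It is replaced by a colour permutation agreeing with it on the standard variables,
      the only ones that \<open>g\<close> may contain.\<close>
    have "inj_on ?\<rho>' (std_vars v2)"
      by (auto simp: inj_on_def inj_eq[OF shuffles_famD(3)[OF \<sigma>]])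
    then obtain \<pi> where \<pi>: "colour_perm \<pi>" "\<forall>x\<in>std_vars v2. \<pi> x = ?\<rho>' x"
      using extend_colour_perm[of "std_vars v2" ?\<rho>'] by auto
    then have "?S - shuffle_image v1 \<sigma> = \<pi> ` std_vars v2"
      unfolding std_vars_minus_shuffle_image[OF \<sigma>] by (auto intro!: image_cong)
    then have "?\<psi> (?S - shuffle_image v1 \<sigma>) = fract_of (mpoly_rename \<pi> g)"
      using embed_image[OF single_in_sh_carrier[OF g] \<pi>(1), of v2] by simp
    also have "mpoly_rename \<pi> g = mpoly_rename ?\<rho>' g"
      by (rule mpoly_rename_cong) (use SH_component_vars[OF g] \<pi>(2) in blast)
    finally show ?thesis
      unfolding kernel2_shuffle[OF \<sigma>] 1 shuffle_summand_def Let_def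
      by (simp add: gvar_def)
  qed
  \<comment> \<open>Subsets of any degree other than \<open>v1\<close> drop out because
    \<open>?\<phi>\<close> is concentrated in that degree.\<close>
  have "conv ?\<phi> ?\<psi> ?S = (\<Sum>B | B \<subseteq> ?S \<and> colour_count B = v1.
      ?\<phi> B * ?\<psi> (?S - B) * kernel2 B (?S - B))"
    unfolding conv_def by (rule sum.mono_neutral_right) (auto simp: embed_single_eq_0)
  also have "\<dots> = (\<Sum>\<sigma>\<in>shuffles_fam v1 v2. ?\<phi> (shuffle_image v1 \<sigma>) *
      ?\<psi> (?S - shuffle_image v1 \<sigma>) * kernel2 (shuffle_image v1 \<sigma>) (?S - shuffle_image v1 \<sigma>))"
    by (rule sum.reindex_bij_betw[OF bij_betw_shuffle_image, symmetric])
  also have "\<dots> = (\<Sum>\<sigma>\<in>shuffles_fam v1 v2. shuffle_summand a d t1 t2 t3 v1 v2 f g \<sigma>)"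
    by (rule sum.cong) (simp_all add: summand)
  finally show ?thesis by simp
qed

lemma conv_embed_single_eq_0:
  assumes "colour_count A \<noteq> (\<lambda>i. v1 i + v2 i)"
  shows "conv (embed (Poly_Mapping.single v1 f)) (embed (Poly_Mapping.single v2 g)) A = 0"
proof (cases "finite A")
  case True
  have "embed (Poly_Mapping.single v1 f) B * embed (Poly_Mapping.single v2 g) (A - B) = 0"
    if "B \<subseteq> A" for B
  proof (rule ccontr)
    assume "\<not> ?thesis"
    then have "colour_count B = v1" "colour_count (A - B) = v2"
      using embed_single_eq_0 by (metis mult_zero_left, metis mult_zero_right)
    moreover have "colour_count A = colour_count (B \<union> (A - B))" using that by (simp add: Un_absorb1)
    ultimately show False
      using assms colour_count_Un[of B "A - B"] True finite_subset[OF that] by simp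
  qed
  then show ?thesis unfolding conv_def by (intro sum.neutral) auto
qed (simp add: conv_infinite)

text \<open>Here the definite description in \<open>shuffle_product\<close> is resolved: the sum of
  summands is a value of a convolution of regular functions, hence a polynomial, and
  \<open>fract_of\<close> is injective.\<close>

lemma shuffle_product:
  assumes f: "f \<in> SH_component v1" and g: "g \<in> SH_component v2"
  shows shuffle_product_in_SH_component:
      "shuffle_product a d t1 t2 t3 v1 v2 f g \<in> SH_component (\<lambda>i. v1 i + v2 i)"
    and embed_shuffle_product:
      "embed (Poly_Mapping.single (\<lambda>i. v1 i + v2 i) (shuffle_product a d t1 t2 t3 v1 v2 f g)) =
       conv (embed (Poly_Mapping.single v1 f)) (embed (Poly_Mapping.single v2 g))"
proof -
  let ?\<chi> = "conv (embed (Poly_Mapping.single v1 f)) (embed (Poly_Mapping.single v2 g))"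
  let ?w = "\<lambda>i. v1 i + v2 i"
  have regular: "regular ?\<chi>"
    by (intro regular_conv regular_embed single_in_sh_carrier f g)
  then have "?\<chi> (std_vars ?w) \<in> range fract_of" by (simp add: regular_def)
  then obtain h where h: "?\<chi> (std_vars ?w) = fract_of h" by blast
  have eq: "shuffle_product a d t1 t2 t3 v1 v2 f g = h"
    unfolding shuffle_product_def sum_shuffle_summand[OF f g] h by (rule the_equality) simp_all
  show carrier: "shuffle_product a d t1 t2 t3 v1 v2 f g \<in> SH_component ?w"
    unfolding eq by (rule regular_imp_SH_component[where \<phi> = ?\<chi>, OF _ h]) (use regular in \<open>simp add: regular_def\<close>)
  obtain H where H: "H \<in> sh_carrier" "embed H = ?\<chi>" using regular_imp_embed[OF regular] by blast
  have "Poly_Mapping.lookup H v = Poly_Mapping.lookup (Poly_Mapping.single ?w h) v" for v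
  proof -
    have "fract_of (Poly_Mapping.lookup H v) = ?\<chi> (std_vars v)"
      using embed_std_vars[OF H(1), of v] H(2) by simp
    also have "\<dots> = (if v = ?w then fract_of h else 0)"
      using h conv_embed_single_eq_0[of "std_vars v" v1 v2 f g] by auto
    also have "\<dots> = fract_of (Poly_Mapping.lookup (Poly_Mapping.single ?w h) v)"
      by (auto simp: lookup_single when_def)
    finally show ?thesis by simp
  qed
  then have "H = Poly_Mapping.single ?w h" by (rule poly_mapping_eqI)
  then show "embed (Poly_Mapping.single ?w (shuffle_product a d t1 t2 t3 v1 v2 f g)) = ?\<chi>"
    using H(2) eq by simp
qed

lemma conv_sum_left: "conv (sum \<phi> A) \<psi> = (\<Sum>x\<in>A. conv (\<phi> x) \<psi>)"
  and conv_sum_right: "conv \<psi> (sum \<phi> A) = (\<Sum>x\<in>A. conv \<psi> (\<phi> x))"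
  by (induction A rule: infinite_finite_induct; simp only: sum.infinite sum.empty sum.insert
      conv_zero_left conv_zero_right conv_add_left conv_add_right simp_thms)+

abbreviation SH :: "(complex poly, 'i shuffle_elem) module" where
  "SH \<equiv> shuffle_algebra a d t1 t2 t3"

lemma sh_mult:
  assumes F: "F \<in> sh_carrier" and G: "G \<in> sh_carrier"
  shows mult_in_sh_carrier: "F \<otimes>\<^bsub>SH\<^esub> G \<in> sh_carrier"
    and embed_mult: "embed (F \<otimes>\<^bsub>SH\<^esub> G) = conv (embed F) (embed G)"
proof -
  let ?F = "Poly_Mapping.lookup F" and ?G = "Poly_Mapping.lookup G"
  have SH: "?F v \<in> SH_component v" "?G v \<in> SH_component v" for v
    using F G by (simp_all add: sh_carrier_def)
  have mult: "F \<otimes>\<^bsub>SH\<^esub> G = (\<Sum>v1\<in>Poly_Mapping.keys F. \<Sum>v2\<in>Poly_Mapping.keys G.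
      Poly_Mapping.single (\<lambda>i. v1 i + v2 i) (shuffle_product a d t1 t2 t3 v1 v2 (?F v1) (?G v2)))"
    by (simp add: shuffle_algebra_def)
  show "F \<otimes>\<^bsub>SH\<^esub> G \<in> sh_carrier"
    unfolding mult
    by (intro sum_in_sh_carrier single_in_sh_carrier shuffle_product_in_SH_component SH)
  have "embed (F \<otimes>\<^bsub>SH\<^esub> G) = (\<Sum>v1\<in>Poly_Mapping.keys F. \<Sum>v2\<in>Poly_Mapping.keys G.
      conv (embed (Poly_Mapping.single v1 (?F v1))) (embed (Poly_Mapping.single v2 (?G v2))))"
    unfolding mult embed_sum by (intro sum.cong refl embed_shuffle_product SH)
  also have "\<dots> = conv (embed F) (embed G)"
    by (simp flip: conv_sum_left conv_sum_right embed_sum add: sum_single_keys)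
  finally show "embed (F \<otimes>\<^bsub>SH\<^esub> G) = conv (embed F) (embed G)" .
qed

end


section \<open>Rational function identities for the Serre relations\<close>

text \<open>Up to the factor -D, the residue at u = z b of the rational function in u given by the
  product over \<open>B\<close> of (u - z b' - D) / (u - z b').\<close>

definition residue :: "('x \<Rightarrow> 'f) \<Rightarrow> 'f::field \<Rightarrow> 'x set \<Rightarrow> 'x \<Rightarrow> 'f" where
  "residue z D B b = (\<Prod>b'\<in>B - {b}. (z b - z b' - D) / (z b - z b'))"

lemma residue_insert:
  assumes "finite B" "w \<notin> B" "b \<in> B"
  shows "residue z D (insert w B) b = residue z D B b * ((z b - z w - D) / (z b - z w))"
proof -
  have "insert w B - {b} = insert w (B - {b})" using assms by auto
  then show ?thesis using assms by (simp add: residue_def)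
qed

lemma residue_insert_new:
  "w \<notin> B \<Longrightarrow> residue z D (insert w B) w = (\<Prod>b\<in>B. (z w - z b - D) / (z w - z b))"
  by (simp add: residue_def)

text \<open>Partial fraction expansion, by induction on the set of poles. Since D is arbitrary, it
  serves for both orders of multiplication, with D and with -D.\<close>

lemma partial_fraction:
  assumes "finite B" "inj_on z B" "u \<notin> z ` B"
  shows "(\<Prod>b\<in>B. (u - z b - D) / (u - z b)) = 1 - D * (\<Sum>b\<in>B. residue z D B b / (u - z b))"
  using assms
proof (induction B arbitrary: u rule: finite_induct)
  case (insert w B)
  have u: "u \<noteq> z w" "u \<notin> z ` B" and w: "z w \<notin> z ` B" and inj: "inj_on z B"
    using insert by auto
  let ?r = "residue z D B"
  have summand: "residue z D (insert w B) b / (u - z b) =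
      ?r b / (u - z b) - D * (?r b / ((z b - z w) * (u - z b)))" if "b \<in> B" for b
  proof -
    have "z b - z w \<noteq> 0" using w imageI[OF that, of z] by auto
    then have "(z b - z w - D) / (z b - z w) = 1 - D / (z b - z w)" by (simp add: diff_divide_distrib)
    then show ?thesis using insert.hyps that
      by (simp add: residue_insert right_diff_distrib diff_divide_distrib)
  qed
  \<comment> \<open>The elementary two-pole partial fraction: the new factor meets an old pole, and
    the result is distributed over the two.\<close>
  have split: "?r b / ((u - w') * (u - z b)) =
      ?r b / ((z b - w') * (u - z b)) + ?r b / ((w' - z b) * (u - w'))"
    if "b \<in> B" "w' = z w" for b w'
  proof -
    have "z b - w' \<noteq> 0" "u - z b \<noteq> 0" "u - w' \<noteq> 0" "w' - z b \<noteq> 0"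
      using u w that(2) imageI[OF that(1), of z] by auto
    then show ?thesis by (simp add: divide_simps) (simp add: algebra_simps)
  qed
  have sum_split: "(\<Sum>b\<in>B. ?r b / ((u - z w) * (u - z b))) =
      (\<Sum>b\<in>B. ?r b / ((z b - z w) * (u - z b))) + (\<Sum>b\<in>B. ?r b / ((z w - z b) * (u - z w)))"
    unfolding sum.distrib[symmetric] by (rule sum.cong) (simp_all add: split)
  let ?R = "\<Sum>b\<in>B. ?r b / (u - z b)"
  have frac: "(u - z w - D) / (u - z w) = 1 - D / (u - z w)"
    using u by (simp add: diff_divide_distrib)
  have "(\<Prod>b\<in>insert w B. (u - z b - D) / (u - z b)) = (1 - D / (u - z w)) * (1 - D * ?R)"
    using insert.IH[OF inj u(2)] insert.hyps by (simp add: frac)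
  also have "\<dots> = 1 - D * ?R - D / (u - z w) + D * D * (?R / (u - z w))"
    by (simp add: algebra_simps)
  also have "?R / (u - z w) = (\<Sum>b\<in>B. ?r b / ((u - z w) * (u - z b)))"
    by (simp add: sum_divide_distrib mult.commute)
  finally have lhs: "(\<Prod>b\<in>insert w B. (u - z b - D) / (u - z b)) = 1 - D * ?R - D / (u - z w) +
      D * D * (\<Sum>b\<in>B. ?r b / ((u - z w) * (u - z b)))" .
  \<comment> \<open>The induction hypothesis is used a second time, at u = z w, where the old
    product is exactly the residue at the new pole.\<close>
  have "residue z D (insert w B) w / (u - z w) =
      (1 - D * (\<Sum>b\<in>B. ?r b / (z w - z b))) / (u - z w)"
    using insert.IH[OF inj w] insert.hyps by (simp add: residue_insert_new)
  also have "\<dots> = 1 / (u - z w) - D * (\<Sum>b\<in>B. ?r b / ((z w - z b) * (u - z w)))"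
    by (simp add: diff_divide_distrib flip: times_divide_eq_right)
      (simp add: sum_divide_distrib)
  finally have "(\<Sum>b\<in>insert w B. residue z D (insert w B) b / (u - z b)) =
      1 / (u - z w) - D * (\<Sum>b\<in>B. ?r b / ((z w - z b) * (u - z w))) +
      (?R - D * (\<Sum>b\<in>B. ?r b / ((z b - z w) * (u - z b))))"
    using insert.hyps by (simp add: summand sum_subtractf sum_distrib_left)
  moreover have "1 - D * R - D / p + D * D * (S1 + S2) =
      1 - D * (1 / p - D * S2 + (R - D * S1))" for R S1 S2 p
    by (simp add: algebra_simps)
  ultimately show ?case unfolding lhs sum_split by (simp only:)
qed simp

text \<open>Recursions for the moments of order 0 and 1 of the residues. The changes at the old
  poles and the correction in the new residue, given by \<open>partial_fraction\<close> at z w,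
  cancel in the sum; weighting by z leaves only -D times the old sum, because z b / (z w - z b) = z
  w / (z w - z b) - 1.\<close>

lemma sum_residue_insert:
  assumes "finite B" "w \<notin> B" "inj_on z (insert w B)"
  shows "(\<Sum>b\<in>insert w B. residue z D (insert w B) b) = (\<Sum>b\<in>B. residue z D B b) + 1"
    and "(\<Sum>b\<in>insert w B. z b * residue z D (insert w B) b) =
      (\<Sum>b\<in>B. z b * residue z D B b) + z w - D * (\<Sum>b\<in>B. residue z D B b)"
proof -
  let ?r = "residue z D B" and ?s = "residue z D (insert w B)"
  have w: "z w \<notin> z ` B" and inj: "inj_on z B" using assms by auto
  have old: "?s b = ?r b + D * (?r b / (z w - z b))" if "b \<in> B" for b
  proof -
    have "z b - z w \<noteq> 0" "z w - z b \<noteq> 0" using w imageI[OF that, of z] by auto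
    then have "(z b - z w - D) / (z b - z w) = 1 + D / (z w - z b)"
      by (simp add: divide_simps) (simp add: algebra_simps)
    then show ?thesis using assms that by (simp add: residue_insert distrib_left)
  qed
  have new: "?s w = 1 - D * (\<Sum>b\<in>B. ?r b / (z w - z b))"
    using partial_fraction[OF assms(1) inj w, of D] assms(2) by (simp add: residue_insert_new)
  show "(\<Sum>b\<in>insert w B. ?s b) = (\<Sum>b\<in>B. ?r b) + 1"
    using assms by (simp add: old new sum.distrib sum_distrib_left)
  have "z b * (?r b / (z w - z b)) = z w * (?r b / (z w - z b)) - ?r b" if "b \<in> B" for b
  proof -
    have "z w - z b \<noteq> 0" using w imageI[OF that, of z] by auto
    then show ?thesis by (simp add: divide_simps) (simp add: algebra_simps)
  qed
  then have "(\<Sum>b\<in>B. z b * (?r b / (z w - z b))) =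
      z w * (\<Sum>b\<in>B. ?r b / (z w - z b)) - (\<Sum>b\<in>B. ?r b)"
    by (simp add: sum_subtractf sum_distrib_left)
  moreover have "(\<Sum>b\<in>B. z b * ?s b) =
      (\<Sum>b\<in>B. z b * ?r b) + D * (\<Sum>b\<in>B. z b * (?r b / (z w - z b)))"
    by (simp add: old distrib_left sum.distrib sum_distrib_left mult_ac)
  moreover have "(\<Sum>b\<in>insert w B. z b * ?s b) = z w * ?s w + (\<Sum>b\<in>B. z b * ?s b)"
    using assms by simp
  ultimately have "(\<Sum>b\<in>insert w B. z b * ?s b) =
      z w * (1 - D * (\<Sum>b\<in>B. ?r b / (z w - z b))) + ((\<Sum>b\<in>B. z b * ?r b) +
      D * (z w * (\<Sum>b\<in>B. ?r b / (z w - z b)) - (\<Sum>b\<in>B. ?r b)))"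
    by (simp only: new)
  then show "(\<Sum>b\<in>insert w B. z b * ?s b) =
      (\<Sum>b\<in>B. z b * ?r b) + z w - D * (\<Sum>b\<in>B. ?r b)"
    by (simp only: algebra_simps) simp
qed

lemma sum_residue:
  assumes "finite B" "inj_on z B"
  shows "(\<Sum>b\<in>B. residue z D B b) = of_nat (card B)"
  using assms
proof (induction B rule: finite_induct)
  case (insert w B)
  then have "inj_on z B" by simp
  then show ?case
    unfolding sum_residue_insert(1)[OF insert.hyps insert.prems] by (simp add: insert)
qed simp

text \<open>For n poles the expansion at u = infinity predicts the first moment to be the sum of all
  z b minus D n (n - 1) / 2. Comparing D with -D removes the part depending on z.\<close>

lemma sum_residue_diff:
  assumes "finite B" "inj_on z B"
  shows "(\<Sum>b\<in>B. z b * residue z D B b) - (\<Sum>b\<in>B. z b * residue z (- D) B b) =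
    - D * of_nat (card B) * (of_nat (card B) - 1)"
  using assms
proof (induction B rule: finite_induct)
  case (insert w B)
  then have "inj_on z B" by simp
  then show ?case
    using insert.IH sum_residue[OF insert.hyps(1), of z]
    unfolding sum_residue_insert(2)[OF insert.hyps insert.prems]
    by (simp add: insert.hyps algebra_simps)
qed simp

text \<open>The weights are linear in z, so only the two moments enter: the difference of first
  moments, and c times the two zeroth moments, each equal to the number of poles.\<close>

lemma sum_serre_bracket:
  assumes "finite B" "inj_on z B"
  shows "(\<Sum>b\<in>B. (z b + c) * residue z D B b - (z b - c) * residue z (- D) B b) =
    of_nat (card B) * (2 * c - (of_nat (card B) - 1) * D)"
proof -
  have "(\<Sum>b\<in>B. (z b + c) * residue z D B b - (z b - c) * residue z (- D) B b) =
      ((\<Sum>b\<in>B. z b * residue z D B b) - (\<Sum>b\<in>B. z b * residue z (- D) B b)) +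
      c * ((\<Sum>b\<in>B. residue z D B b) + (\<Sum>b\<in>B. residue z (- D) B b))"
    by (simp add: algebra_simps sum.distrib sum_subtractf sum_distrib_left)
  also have "\<dots> = of_nat (card B) * (2 * c - (of_nat (card B) - 1) * D)"
    unfolding sum_residue_diff[OF assms] sum_residue[OF assms] by (simp add: algebra_simps)
  finally show ?thesis .
qed


section \<open>Sums over permutations\<close>

text \<open>Permutations are kept as lists of distinct elements so that peeling off the outermost
  commutator means removing the head of the list.\<close>

definition permanent :: "('j \<Rightarrow> 'x \<Rightarrow> 'f::comm_ring_1) \<Rightarrow> 'j set \<Rightarrow> 'x list \<Rightarrow> 'f" where
  "permanent \<xi> J bs = (\<Sum>js\<in>permutations_of_set J. prod_list (map2 \<xi> js bs))"

lemma sum_permutations_of_set: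
  assumes "finite J" "J \<noteq> {}"
  shows "(\<Sum>js\<in>permutations_of_set J. F js) =
    (\<Sum>j\<in>J. \<Sum>js\<in>permutations_of_set (J - {j}). F (j # js))"
proof -
  have "(\<Sum>js\<in>permutations_of_set J. F js) =
      (\<Sum>j\<in>J. \<Sum>js\<in>(#) j ` permutations_of_set (J - {j}). F js)"
    unfolding permutations_of_set_nonempty[OF assms(2)]
    by (rule sum.UNION_disjoint) (use assms(1) in auto)
  then show ?thesis by (simp add: sum.reindex)
qed

lemma permanent_Cons:
  assumes "finite J" "J \<noteq> {}"
  shows "permanent \<xi> J (b # bs) = (\<Sum>j\<in>J. \<xi> j b * permanent \<xi> (J - {j}) bs)"
  unfolding permanent_def sum_permutations_of_set[OF assms] by (simp add: sum_distrib_left)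

text \<open>Reordering \<open>bs\<close> is compensated by the same reordering of the index lists.
  It is needed because expansion along a variable b first moves b to the front.\<close>

lemma permanent_cong_mset:
  assumes "mset bs = mset bs'" "card J = length bs"
  shows "permanent \<xi> J bs = permanent \<xi> J bs'"
proof -
  obtain \<pi> where \<pi>: "\<pi> permutes {..<length bs'}" "permute_list \<pi> bs' = bs"
    using mset_eq_permutation[OF assms(1)] by blast
  have len: "length js = length bs'" if "js \<in> permutations_of_set J" for js
    using length_finite_permutations_of_set[OF that] assms mset_eq_length[OF assms(1)] by simp
  have "inj_on (permute_list \<pi>) (permutations_of_set J)"
  proof (rule inj_onI)
    fix js ks assume js: "js \<in> permutations_of_set J" and ks: "ks \<in> permutations_of_set J"
      and eq: "permute_list \<pi> js = permute_list \<pi> ks"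
    show "js = ks"
    proof (rule nth_equalityI)
      fix i assume i: "i < length js"
      have "inv_into UNIV \<pi> i < length bs'"
        using permutes_in_image[OF permutes_inv[OF \<pi>(1)], of i] i len[OF js] by simp
      then show "js ! i = ks ! i"
        using arg_cong[OF eq, of "\<lambda>l. l ! inv_into UNIV \<pi> i"] \<pi>(1) len[OF js] len[OF ks]
        by (simp add: permute_list_nth permutes_inverses)
    qed (simp add: len[OF js] len[OF ks])
  qed
  moreover have "permute_list \<pi> ` permutations_of_set J \<subseteq> permutations_of_set J"
  proof (rule image_subsetI)
    fix js assume js: "js \<in> permutations_of_set J"
    then have "\<pi> permutes {..<length js}" using \<pi>(1) len by simp
    then show "permute_list \<pi> js \<in> permutations_of_set J"
      using js by (simp add: permutations_of_set_def)
  qed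
  ultimately have bij: "bij_betw (permute_list \<pi>) (permutations_of_set J) (permutations_of_set J)"
    by (simp add: bij_betw_def endo_inj_surj)
  have "permanent \<xi> J bs = (\<Sum>js\<in>permutations_of_set J. prod_list (map2 \<xi> (permute_list \<pi> js) bs))"
    unfolding permanent_def by (rule sum.reindex_bij_betw[OF bij, symmetric])
  also have "\<dots> = permanent \<xi> J bs'"
    unfolding permanent_def
  proof (rule sum.cong[OF refl])
    fix js assume js: "js \<in> permutations_of_set J"
    have "map2 \<xi> (permute_list \<pi> js) bs = permute_list \<pi> (map2 \<xi> js bs')"
      using permute_list_zip[of \<pi> _ js bs'] \<pi> len[OF js] by (simp add: permute_list_map)
    then have "mset (map2 \<xi> (permute_list \<pi> js) bs) = mset (map2 \<xi> js bs')"
      using \<pi>(1) len[OF js] by simp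
    then show "prod_list (map2 \<xi> (permute_list \<pi> js) bs) = prod_list (map2 \<xi> js bs')"
      by (metis prod_mset_prod_list)
  qed
  finally show ?thesis .
qed

lemma sum_permutes_eq_sum_permutations_of_set:
  "(\<Sum>\<sigma> | \<sigma> permutes {1..n}. F (map \<sigma> [1..<Suc n])) =
    (\<Sum>js\<in>permutations_of_set {1..n}. F js)"
proof -
  have "bij_betw (\<lambda>\<sigma>. map \<sigma> [1..<Suc n]) {\<sigma>. \<sigma> permutes {1..n}} (permutations_of_set {1..n})"
  proof (rule bij_betw_imageI)
    show "inj_on (\<lambda>\<sigma>. map \<sigma> [1..<Suc n]) {\<sigma>. \<sigma> permutes {1..n}}"
    proof (rule inj_onI)
      fix \<sigma> \<tau> :: "nat \<Rightarrow> nat"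
      assume "\<sigma> \<in> {\<sigma>. \<sigma> permutes {1..n}}" "\<tau> \<in> {\<sigma>. \<sigma> permutes {1..n}}"
        and eq: "map \<sigma> [1..<Suc n] = map \<tau> [1..<Suc n]"
      then have perm: "\<sigma> permutes {1..n}" "\<tau> permutes {1..n}" by simp_all
      show "\<sigma> = \<tau>"
      proof
        fix k
        show "\<sigma> k = \<tau> k"
        proof (cases "k \<in> {1..n}")
          case True
          then have "k \<in> set [1..<Suc n]" by auto
          then show ?thesis using eq by (simp only: map_eq_conv)
        next
          case False
          then show ?thesis
            using permutes_not_in[OF perm(1) False] permutes_not_in[OF perm(2) False]
            by (simp only:)
        qed
      qed
    qed
    show "(\<lambda>\<sigma>. map \<sigma> [1..<Suc n]) ` {\<sigma>. \<sigma> permutes {1..n}} = permutations_of_set {1..n}"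
    proof (intro equalityI subsetI)
      fix js assume "js \<in> (\<lambda>\<sigma>. map \<sigma> [1..<Suc n]) ` {\<sigma>. \<sigma> permutes {1..n}}"
      then obtain \<sigma> where \<sigma>: "\<sigma> permutes {1..n}" "js = map \<sigma> [1..<Suc n]" by auto
      have "set [1..<Suc n] = {1..n}" by auto
      then have "set js = {1..n}" "distinct js"
        using \<sigma>(1) permutes_inj_on[OF \<sigma>(1)]
        by (simp_all only: \<sigma>(2) set_map permutes_image distinct_map distinct_upt simp_thms)
      then show "js \<in> permutations_of_set {1..n}" by blast
    next
      fix js assume js: "js \<in> permutations_of_set {1..n}"
      then have len: "length js = n" and js': "set js = {1..n}" "distinct js"
        using length_finite_permutations_of_set[OF js] permutations_of_setD[OF js] by auto
      \<comment> \<open>List positions start at 0 and \<open>\<sigma>\<close> acts on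
        \<open>{1..n}\<close>, hence \<open>k - 1\<close>; the identity outside is demanded by
        \<open>permutes\<close>.\<close>
      define \<sigma> where "\<sigma> = (\<lambda>k. if k \<in> {1..n} then js ! (k - 1) else k)"
      have map: "map \<sigma> [1..<Suc n] = js"
        by (rule nth_equalityI) (auto simp: \<sigma>_def len simp del: upt_Suc)
      have set: "set [1..<Suc n] = {1..n}" by auto
      have "inj_on \<sigma> {1..n}"
        using js'(2) unfolding map[symmetric] distinct_map set by blast
      moreover have "\<sigma> ` {1..n} = {1..n}"
        using js'(1) unfolding map[symmetric] set_map set .
      ultimately have "\<sigma> permutes {1..n}"
        by (intro bij_imp_permutes) (simp_all add: bij_betw_def \<sigma>_def del: atLeastAtMost_iff)
      then show "js \<in> (\<lambda>\<sigma>. map \<sigma> [1..<Suc n]) ` {\<sigma>. \<sigma> permutes {1..n}}"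
        using map by (metis (mono_tags, lifting) image_eqI mem_Collect_eq)
    qed
  qed
  then show ?thesis by (rule sum.reindex_bij_betw)
qed


section \<open>The defining relations hold for the convolution product\<close>

text \<open>The weight \<open>\<xi>\<close> is arbitrary, so that the same functions represent the
  generators (powers of the variable) and the coefficients of their generating series.\<close>

definition gen_fun :: "'i \<Rightarrow> ('i \<times> nat \<Rightarrow> 'i mpoly fract) \<Rightarrow> 'i::{finite,linorder} set_fun" where
  "gen_fun k \<xi> A = (if \<exists>x. A = {x} \<and> fst x = k then \<xi> (the_elem A) else 0)"

lemma gen_fun_singleton: "gen_fun k \<xi> {x} = (if fst x = k then \<xi> x else 0)"
  by (auto simp: gen_fun_def)

lemma gen_fun_eq_0: "(\<And>x. A = {x} \<Longrightarrow> fst x \<noteq> k) \<Longrightarrow> gen_fun k \<xi> A = 0"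
  by (auto simp: gen_fun_def)

context shuffle_data
begin

lemma kernel2_singleton [simp]: "kernel2 {x} {y} = kernel x y"
  by (simp add: kernel2_def)

lemma conv_gen_left:
  assumes "finite A"
  shows "conv (gen_fun k \<xi>) \<psi> A =
    (\<Sum>x | x \<in> A \<and> fst x = k. \<xi> x * \<psi> (A - {x}) * kernel2 {x} (A - {x}))"
proof -
  let ?T = "{x. x \<in> A \<and> fst x = k}"
  have "conv (gen_fun k \<xi>) \<psi> A =
      (\<Sum>B\<in>(\<lambda>x. {x}) ` ?T. gen_fun k \<xi> B * \<psi> (A - B) * kernel2 B (A - B))"
    unfolding conv_def
  proof (rule sum.mono_neutral_right)
    show "\<forall>B\<in>Pow A - (\<lambda>x. {x}) ` ?T. gen_fun k \<xi> B * \<psi> (A - B) * kernel2 B (A - B) = 0"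
    proof
      fix B assume "B \<in> Pow A - (\<lambda>x. {x}) ` ?T"
      then have "gen_fun k \<xi> B = 0" by (intro gen_fun_eq_0) auto
      then show "gen_fun k \<xi> B * \<psi> (A - B) * kernel2 B (A - B) = 0" by simp
    qed
  qed (use assms in auto)
  then show ?thesis by (simp add: sum.reindex gen_fun_singleton)
qed

lemma conv_gen_right:
  assumes "finite A"
  shows "conv \<psi> (gen_fun k \<xi>) A =
    (\<Sum>x | x \<in> A \<and> fst x = k. \<psi> (A - {x}) * \<xi> x * kernel2 (A - {x}) {x})"
proof -
  let ?T = "{x. x \<in> A \<and> fst x = k}"
  have "conv \<psi> (gen_fun k \<xi>) A =
      (\<Sum>B\<in>(\<lambda>x. A - {x}) ` ?T. \<psi> B * gen_fun k \<xi> (A - B) * kernel2 B (A - B))"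
    unfolding conv_def
  proof (rule sum.mono_neutral_right)
    show "\<forall>B\<in>Pow A - (\<lambda>x. A - {x}) ` ?T. \<psi> B * gen_fun k \<xi> (A - B) * kernel2 B (A - B) = 0"
    proof
      fix B assume B: "B \<in> Pow A - (\<lambda>x. A - {x}) ` ?T"
      have "gen_fun k \<xi> (A - B) = 0"
      proof (rule gen_fun_eq_0)
        fix x assume x: "A - B = {x}"
        then have "B = A - {x}" "x \<in> A" using B by auto
        then show "fst x \<noteq> k" using B by auto
      qed
      then show "\<psi> B * gen_fun k \<xi> (A - B) * kernel2 B (A - B) = 0" by simp
    qed
  qed (use assms in auto)
  also have "inj_on (\<lambda>x. A - {x}) ?T" by (rule inj_onI) auto
  then have "(\<Sum>B\<in>(\<lambda>x. A - {x}) ` ?T. \<psi> B * gen_fun k \<xi> (A - B) * kernel2 B (A - B)) =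
      (\<Sum>x\<in>?T. \<psi> (A - {x}) * gen_fun k \<xi> (A - (A - {x})) * kernel2 (A - {x}) (A - (A - {x})))"
    by (simp add: sum.reindex)
  also have "\<dots> = (\<Sum>x\<in>?T. \<psi> (A - {x}) * \<xi> x * kernel2 (A - {x}) {x})"
  proof (rule sum.cong[OF refl])
    fix x assume "x \<in> ?T"
    then have "A - (A - {x}) = {x}" "fst x = k" by auto
    then show "\<psi> (A - {x}) * gen_fun k \<xi> (A - (A - {x})) * kernel2 (A - {x}) (A - (A - {x})) =
        \<psi> (A - {x}) * \<xi> x * kernel2 (A - {x}) {x}"
      by (simp add: gen_fun_singleton)
  qed
  finally show ?thesis .
qed

text \<open>A common index set for both orders of multiplication, so that quadratic relations can be
  checked summand by summand. There are two pairs on a two-element set when k = l and both colours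
  agree, and at most one pair when k and l differ.\<close>

definition ordered_pairs :: "'i \<Rightarrow> 'i \<Rightarrow> ('i \<times> nat) set \<Rightarrow> (('i \<times> nat) \<times> ('i \<times> nat)) set" where
  "ordered_pairs k l A = {(x, y). x \<noteq> y \<and> A = {x, y} \<and> fst x = k \<and> fst y = l}"

lemma ordered_pairs_infinite: "infinite A \<Longrightarrow> ordered_pairs k l A = {}"
  by (auto simp: ordered_pairs_def)

lemma sum_ordered_pairs:
  assumes "finite A"
  shows "(\<Sum>x | x \<in> A \<and> fst x = k. f x * gen_fun l \<eta> (A - {x})) =
    (\<Sum>p\<in>ordered_pairs k l A. f (fst p) * \<eta> (snd p))"
proof -
  have inj: "inj_on fst (ordered_pairs k l A)"
    by (rule inj_onI) (auto simp: ordered_pairs_def doubleton_eq_iff)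
  have "(\<Sum>x | x \<in> A \<and> fst x = k. f x * gen_fun l \<eta> (A - {x})) =
      (\<Sum>x\<in>fst ` ordered_pairs k l A. f x * gen_fun l \<eta> (A - {x}))"
  proof (rule sum.mono_neutral_right)
    show "\<forall>x\<in>{x. x \<in> A \<and> fst x = k} - fst ` ordered_pairs k l A. f x * gen_fun l \<eta> (A - {x}) = 0"
    proof
      fix x assume x: "x \<in> {x. x \<in> A \<and> fst x = k} - fst ` ordered_pairs k l A"
      have "gen_fun l \<eta> (A - {x}) = 0"
      proof (rule gen_fun_eq_0)
        fix y assume y: "A - {x} = {y}"
        show "fst y \<noteq> l"
        proof
          assume "fst y = l"
          then have "(x, y) \<in> ordered_pairs k l A" using x y by (auto simp: ordered_pairs_def)
          then show False using x by force
        qed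
      qed
      then show "f x * gen_fun l \<eta> (A - {x}) = 0" by simp
    qed
  qed (use assms in \<open>auto simp: ordered_pairs_def\<close>)
  also have "\<dots> = (\<Sum>p\<in>ordered_pairs k l A. f (fst p) * gen_fun l \<eta> (A - {fst p}))"
    by (simp add: sum.reindex[OF inj])
  also have "\<dots> = (\<Sum>p\<in>ordered_pairs k l A. f (fst p) * \<eta> (snd p))"
  proof (rule sum.cong[OF refl])
    fix p assume "p \<in> ordered_pairs k l A"
    then have "A - {fst p} = {snd p}" "fst (snd p) = l" by (auto simp: ordered_pairs_def)
    then show "f (fst p) * gen_fun l \<eta> (A - {fst p}) = f (fst p) * \<eta> (snd p)"
      by (simp add: gen_fun_singleton)
  qed
  finally show ?thesis .
qed

lemma conv_gen_gen:
  shows "conv (gen_fun k \<xi>) (gen_fun l \<eta>) A =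
      (\<Sum>(x, y)\<in>ordered_pairs k l A. \<xi> x * \<eta> y * kernel x y)" (is ?thesis1)
    and "conv (gen_fun l \<eta>) (gen_fun k \<xi>) A =
      (\<Sum>(x, y)\<in>ordered_pairs k l A. \<xi> x * \<eta> y * kernel y x)" (is ?thesis2)
proof -
  have diff: "A - {fst p} = {snd p}" if "p \<in> ordered_pairs k l A" for p
    using that by (auto simp: ordered_pairs_def)
  show ?thesis1
  proof (cases "finite A")
    case True
    have "conv (gen_fun k \<xi>) (gen_fun l \<eta>) A = (\<Sum>x | x \<in> A \<and> fst x = k.
        (\<xi> x * kernel2 {x} (A - {x})) * gen_fun l \<eta> (A - {x}))"
      unfolding conv_gen_left[OF True] by (simp add: mult_ac)
    also have "\<dots> = (\<Sum>p\<in>ordered_pairs k l A.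
        (\<xi> (fst p) * kernel2 {fst p} (A - {fst p})) * \<eta> (snd p))"
      by (rule sum_ordered_pairs[OF True])
    finally show ?thesis by (simp add: diff case_prod_unfold mult_ac cong: sum.cong)
  qed (simp add: conv_infinite ordered_pairs_infinite)
  show ?thesis2
  proof (cases "finite A")
    case True
    \<comment> \<open>The variable of colour k is now the last factor; splitting from the right
      keeps it as the summation variable, so the index set is the same as for the other
      order.\<close>
    have "conv (gen_fun l \<eta>) (gen_fun k \<xi>) A = (\<Sum>x | x \<in> A \<and> fst x = k.
        (\<xi> x * kernel2 (A - {x}) {x}) * gen_fun l \<eta> (A - {x}))"
      unfolding conv_gen_right[OF True] by (simp add: mult_ac)
    also have "\<dots> = (\<Sum>p\<in>ordered_pairs k l A.
        (\<xi> (fst p) * kernel2 (A - {fst p}) {fst p}) * \<eta> (snd p))"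
      by (rule sum_ordered_pairs[OF True])
    finally show ?thesis by (simp add: diff case_prod_unfold mult_ac cong: sum.cong)
  qed (simp add: conv_infinite ordered_pairs_infinite)
qed

definition conv_comm :: "'i set_fun \<Rightarrow> 'i set_fun \<Rightarrow> 'i set_fun" where
  "conv_comm \<phi> \<psi> = conv \<phi> \<psi> - conv \<psi> \<phi>"

lemma sum_set_fun_apply: "sum F S A = (\<Sum>x\<in>S. F x A)" for F :: "'x \<Rightarrow> 'i set_fun"
  by (induction S rule: infinite_finite_induct) simp_all

lemma conv_comm_gen:
  assumes "finite A"
  shows "conv_comm (gen_fun k \<xi>) \<psi> A = (\<Sum>x | x \<in> A \<and> fst x = k.
    \<xi> x * (kernel2 {x} (A - {x}) - kernel2 (A - {x}) {x}) * \<psi> (A - {x}))"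
  by (simp add: conv_comm_def conv_gen_left[OF assms] conv_gen_right[OF assms] algebra_simps
      flip: sum_subtractf)

definition nested :: "'i \<Rightarrow> ('i \<times> nat \<Rightarrow> 'i mpoly fract) list \<Rightarrow> 'i set_fun \<Rightarrow> 'i set_fun" where
  "nested k \<xi>s = foldr (\<lambda>\<xi>. conv_comm (gen_fun k \<xi>)) \<xi>s"

lemma nested_simps [simp]:
  "nested k [] \<psi> = \<psi>"
  "nested k (\<xi> # \<xi>s) \<psi> = conv_comm (gen_fun k \<xi>) (nested k \<xi>s \<psi>)"
  by (simp_all add: nested_def)

text \<open>Each commutator adds one variable of colour k to the single variable of colour l. The
  Serre relation therefore has to be examined on sets of this shape only.\<close>

lemma nested_support:
  assumes "nested k \<xi>s (gen_fun l \<eta>) A \<noteq> 0" "k \<noteq> l"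
  shows "\<exists>y B. finite B \<and> A = insert y B \<and> fst y = l \<and> (\<forall>b\<in>B. fst b = k) \<and> card B = length \<xi>s"
  using assms(1)
proof (induction \<xi>s arbitrary: A)
  case Nil
  then obtain y where "A = {y}" "fst y = l" by (auto simp: gen_fun_def split: if_splits)
  then show ?case by (intro exI[of _ y] exI[of _ "{}"]) simp
next
  case (Cons \<xi> \<xi>s)
  have "finite A"
    by (rule ccontr) (use Cons.prems in \<open>simp add: conv_comm_def conv_infinite\<close>)
  have "\<exists>x. x \<in> A \<and> fst x = k \<and> nested k \<xi>s (gen_fun l \<eta>) (A - {x}) \<noteq> 0"
  proof (rule ccontr)
    assume "\<not> ?thesis"
    then have zero: "nested k \<xi>s (gen_fun l \<eta>) (A - {x}) = 0" if "x \<in> A" "fst x = k" for x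
      using that by blast
    have "nested k (\<xi> # \<xi>s) (gen_fun l \<eta>) A = 0"
      unfolding nested_simps conv_comm_gen[OF \<open>finite A\<close>] by (rule sum.neutral) (simp add: zero)
    then show False using Cons.prems by contradiction
  qed
  then obtain x where x: "x \<in> A" "fst x = k" "nested k \<xi>s (gen_fun l \<eta>) (A - {x}) \<noteq> 0"
    by blast
  then obtain y B where B: "finite B" "A - {x} = insert y B" "fst y = l" "\<forall>b\<in>B. fst b = k"
    "card B = length \<xi>s"
    using Cons.IH by blast
  have "A = insert y (insert x B)" "x \<notin> B" using B(2) x(1) by auto
  then show ?case using B x(2) by (intro exI[of _ y] exI[of _ "insert x B"]) simp
qed

end

section \<open>The kernel at the specialized parameters and the exchange identity\<close>

lemma fract_const_add: "fract_const (c + c') = fract_const c + fract_const c'"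
  and fract_const_mult: "fract_const (c * c') = fract_const c * fract_const c'"
  by (simp_all add: fract_const_def mpoly_const_add mpoly_const_mult fract_of_add fract_of_mult)

lemma fract_const_0 [simp]: "fract_const 0 = 0"
  and fract_const_1 [simp]: "fract_const 1 = 1"
  by (simp_all add: fract_const_def)

lemma fract_const_uminus: "fract_const (- c) = - fract_const c"
  by (metis add.right_inverse add_eq_0_iff fract_const_0 fract_const_add)

lemma fract_const_diff: "fract_const (c - c') = fract_const c - fract_const c'"
  using fract_const_add[of c "- c'"] by (simp add: fract_const_uminus)

lemma fract_const_of_int [simp]: "fract_const (of_int n) = of_int n"
proof -
  have nat: "fract_const (of_nat m) = of_nat m" for m
    by (induction m) (simp_all add: fract_const_add)
  show ?thesis by (cases n rule: int_diff_cases) (simp add: fract_const_diff nat)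
qed

lemma finite_arrows: "finite (arrows (a :: 'i::{finite,linorder} \<Rightarrow> _))"
proof -
  have "arrows a \<subseteq> (\<Union>i. \<Union>j. (\<lambda>p. (i, j, p)) ` {..num_arrows a i j})"
    by (auto simp: arrows_def)
  then show ?thesis by (rule finite_subset) simp
qed

lemma prod_arrows_between:
  fixes a :: "'i::{finite,linorder} \<Rightarrow> 'i \<Rightarrow> int"
  assumes "k < l" "a k l = 0 \<longleftrightarrow> a l k = 0"
    and "\<And>h. h \<in> arrows a \<Longrightarrow> \<not> (out_vertex h = k \<and> in_vertex h = l) \<Longrightarrow> F h = 1"
  shows "prod F (arrows a) = (\<Prod>p=1..num_arrows a k l. F (k, l, p))"
proof -
  let ?T = "(\<lambda>p. (k, l, p)) ` {1..num_arrows a k l}"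
  \<comment> \<open>Since gcd 0 0 = 0, unconnected vertices are covered by the same formula with an
    empty product.\<close>
  have "num_arrows a k l = 0" if "a k l = 0"
    using assms(2) that by (simp add: num_arrows_def)
  then have T: "?T = {h \<in> arrows a. out_vertex h = k \<and> in_vertex h = l}"
    using assms(1) by (auto simp: arrows_def out_vertex_def in_vertex_def)
  have "prod F (arrows a) = prod F ?T"
    by (rule prod.mono_neutral_right) (use finite_arrows assms(3) T in auto)
  then show ?thesis by (simp add: prod.reindex inj_on_def)
qed

text \<open>The arguments are n, n - 2, ..., 2 - n in one product and n - 2, ..., -n in the other,
  with n = Suc m: everything but the first, respectively the last, is common. An end factor exists
  only for n > 0, hence the successor.\<close>

lemma prod_shift_by_2:
  fixes f :: "int \<Rightarrow> 'f::comm_ring_1"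
  shows "\<exists>M. (\<Prod>p=1..Suc m. f (int (Suc m) + 2 - 2 * int p)) = M * f (int (Suc m)) \<and>
    (\<Prod>p=1..Suc m. f (int (Suc m) - 2 * int p)) = M * f (- int (Suc m))"
proof (intro exI conjI)
  let ?M = "\<Prod>p<m. f (int m - 1 - 2 * int p)"
  have "(\<Prod>p=1..Suc m. f (int (Suc m) + 2 - 2 * int p)) = (\<Prod>p<Suc m. f (int m + 1 - 2 * int p))"
    unfolding One_nat_def prod.atLeast1_atMost_eq
    by (rule prod.cong) (auto intro!: arg_cong[of _ _ f])
  also have "\<dots> = ?M * f (int (Suc m))"
    unfolding prod.lessThan_Suc_shift
    by (auto simp: algebra_simps intro!: prod.cong arg_cong[of _ _ f] arg_cong2[of _ _ _ _ "(*)"])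
  finally show "(\<Prod>p=1..Suc m. f (int (Suc m) + 2 - 2 * int p)) = ?M * f (int (Suc m))" .
  have "(\<Prod>p=1..Suc m. f (int (Suc m) - 2 * int p)) = (\<Prod>p<Suc m. f (int m - 1 - 2 * int p))"
    unfolding One_nat_def prod.atLeast1_atMost_eq
    by (rule prod.cong) (auto intro!: arg_cong[of _ _ f])
  also have "\<dots> = ?M * f (- int (Suc m))"
    unfolding prod.lessThan_Suc
    by (auto simp: algebra_simps intro!: arg_cong[of _ _ f] arg_cong2[of _ _ _ _ "(*)"])
  finally show "(\<Prod>p=1..Suc m. f (int (Suc m) - 2 * int p)) = ?M * f (- int (Suc m))" .
qed

text \<open>A common unit: t1, t2, t3 and the constant c of (Y1) are 1, 1, -2 and d_k a_kl times
  this element.\<close>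

definition half_hbar :: "'i::{finite,linorder} mpoly fract" where
  "half_hbar = fract_const (Polynomial.smult (1 / 2) hbar)"

lemma fract_const_hbar: "fract_const hbar = 2 * half_hbar"
proof -
  have "hbar = Polynomial.smult (1 / 2) hbar + Polynomial.smult (1 / 2) hbar"
    by (simp flip: smult_add_left)
  then show ?thesis unfolding half_hbar_def by (metis fract_const_add mult_2)
qed

lemma fract_const_smult_hbar:
  "fract_const (Polynomial.smult (of_int n / 2) hbar) = of_int n * half_hbar"
proof -
  have "Polynomial.smult (of_int n / 2) hbar = of_int n * Polynomial.smult (1 / 2) hbar"
    by (simp add: of_int_poly)
  then show ?thesis by (simp only: half_hbar_def fract_const_mult fract_const_of_int)
qed

locale yangian_shuffle =
  shuffle_data a d "Polynomial.smult (1 / 2) hbar" "Polynomial.smult (1 / 2) hbar" "- hbar"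
  for a :: "'i::{finite,linorder} \<Rightarrow> 'i \<Rightarrow> int" and d :: "'i \<Rightarrow> int" +
  assumes gcm: "symmetrizable_gcm a d"
begin

lemma gcm_zero_iff: "a k l = 0 \<longleftrightarrow> a l k = 0"
  and gcm_symmetric: "d k * a k l = d l * a l k"
  and gcm_nonpos: "k \<noteq> l \<Longrightarrow> a k l \<le> 0"
  and gcm_diag: "a k k = 2"
  using gcm unfolding symmetrizable_gcm_def by blast+

lemma kernel_same_colour:
  assumes "fst x = fst y"
  shows "kernel x y = (gvar x - gvar y + 2 * of_int (d (fst x)) * half_hbar) / (gvar x - gvar y)"
proof -
  \<comment> \<open>Arrows go from a smaller to a larger vertex, so the quiver has no loops.\<close>
  have "arrow_factor h x y = 1" if "h \<in> arrows a" for h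
    using that assms by (auto simp: arrow_factor_def arrows_def out_vertex_def in_vertex_def)
  then have "kernel x y = vertex_factor x y" by (simp add: kernel_def)
  then show ?thesis
    using assms by (simp add: vertex_factor_def fract_const_uminus fract_const_hbar algebra_simps)
qed

lemma kernel_less:
  assumes less: "fst x < fst y"
  defines "c \<equiv> of_int (- (d (fst x) * a (fst x) (fst y))) * half_hbar"
  shows "\<exists>M. kernel x y = M * (gvar y - gvar x + c) \<and> kernel y x = M * (gvar y - gvar x - c)"
proof -
  define k l where "k = fst x" and "l = fst y"
  define n \<delta> where "n = num_arrows a k l" and "\<delta> = d k * quiver_symmetrizer a k l"
  define f where "f = (\<lambda>m. gvar y - gvar x + of_int (m * \<delta>) * half_hbar)"
  have kl: "k < l" "k \<noteq> l" using less by (auto simp: k_def l_def)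
  \<comment> \<open>The number of arrows times l_kl is the absolute value of a_kl, which is - a_kl
    off the diagonal.\<close>
  have "int n * \<delta> = - (d k * a k l)"
  proof -
    have "gcd (a k l) (a l k) * \<bar>a k l div gcd (a k l) (a l k)\<bar> = \<bar>a k l\<bar>"
      by (metis abs_gcd_int abs_mult dvd_mult_div_cancel gcd_dvd1)
    then have "int n * \<bar>a k l div gcd (a k l) (a l k)\<bar> = - a k l"
      using gcm_nonpos[OF kl(2)] by (simp add: n_def num_arrows_def)
    then have "d k * (int n * \<bar>a k l div gcd (a k l) (a l k)\<bar>) = d k * (- a k l)" by simp
    then show ?thesis by (simp add: \<delta>_def quiver_symmetrizer_def mult_ac)
  qed
  then have c: "c = of_int (int n * \<delta>) * half_hbar" by (simp add: c_def k_def l_def)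
  have "vertex_factor x y = 1" "vertex_factor y x = 1" using less by (auto simp: vertex_factor_def)
  moreover have "(\<Prod>h\<in>arrows a. arrow_factor h x y) = (\<Prod>p=1..n. arrow_factor (k, l, p) x y)"
    unfolding n_def
    by (rule prod_arrows_between[OF kl(1) gcm_zero_iff])
      (use kl in \<open>auto simp: arrow_factor_def k_def l_def arrows_def out_vertex_def in_vertex_def\<close>)
  moreover have "(\<Prod>h\<in>arrows a. arrow_factor h y x) = (\<Prod>p=1..n. arrow_factor (k, l, p) y x)"
    unfolding n_def
    by (rule prod_arrows_between[OF kl(1) gcm_zero_iff])
      (use kl in \<open>auto simp: arrow_factor_def k_def l_def arrows_def out_vertex_def in_vertex_def\<close>)
  ultimately have "kernel x y = (\<Prod>p=1..n. arrow_factor (k, l, p) x y)"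
    "kernel y x = (\<Prod>p=1..n. arrow_factor (k, l, p) y x)"
    by (simp_all add: kernel_def)
  moreover have "arrow_factor (k, l, p) x y = f (int n + 2 - 2 * int p)"
    "arrow_factor (k, l, p) y x = f (int n - 2 * int p)" for p
    using kl by (auto simp: arrow_factor_def f_def k_def l_def out_vertex_def in_vertex_def
        arrow_weight_def reversed_arrow_weight_def n_def \<delta>_def half_hbar_def algebra_simps)
  ultimately have kernel: "kernel x y = (\<Prod>p=1..n. f (int n + 2 - 2 * int p))"
    "kernel y x = (\<Prod>p=1..n. f (int n - 2 * int p))" by simp_all
  have f: "f (int n) = gvar y - gvar x + c" "f (- int n) = gvar y - gvar x - c"
    by (simp_all add: f_def c)
  show ?thesis
  proof (cases n)
    case 0
    \<comment> \<open>Without arrows c = 0 and both kernels are 1; the common factor M then has to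
      cancel the linear term.\<close>
    have "gvar y - gvar x \<noteq> 0" using less by auto
    then show ?thesis using kernel 0 f by (intro exI[of _ "1 / (gvar y - gvar x)"]) (simp add: c)
  next
    case (Suc m)
    then show ?thesis using prod_shift_by_2[of f m] kernel f by metis
  qed
qed

lemma kernel_distinct_colours:
  assumes "fst x \<noteq> fst y"
  defines "c \<equiv> of_int (- (d (fst x) * a (fst x) (fst y))) * half_hbar"
  shows "\<exists>M. kernel x y = M * (gvar y - gvar x + c) \<and> kernel y x = M * (gvar y - gvar x - c)"
proof (cases "fst x < fst y")
  case True
  then show ?thesis unfolding c_def by (rule kernel_less)
next
  case False
  then have "fst y < fst x" using assms by auto
  from kernel_less[OF this] obtain M where
    "kernel y x = M * (gvar x - gvar y + c)" "kernel x y = M * (gvar x - gvar y - c)"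
    unfolding c_def gcm_symmetric[of "fst x"] by blast
  \<comment> \<open>Reversing the roles of x and y changes the sign of the difference of the
    variables, which M absorbs; c is unchanged because d_k a_kl is symmetric.\<close>
  then show ?thesis by (intro exI[of _ "- M"]) (simp add: algebra_simps)
qed

text \<open>For distinct colours this c is the negative of the one in
  \<open>kernel_distinct_colours\<close>. For equal colours a_kk = 2 makes it 2 d_k \<hbar>/2, the
  constant in the numerator of the vertex factor. In both cases the two sides contain the same
  product of (x - y - c) and (x - y + c).\<close>

lemma kernel_exchange:
  assumes "x \<noteq> y"
  defines "c \<equiv> of_int (d (fst x) * a (fst x) (fst y)) * half_hbar"
  shows "(gvar x - gvar y - c) * kernel x y = (gvar x - gvar y + c) * kernel y x"
proof (cases "fst x = fst y")
  case True
  have c: "c = 2 * of_int (d (fst x)) * half_hbar" using True by (simp add: c_def gcm_diag)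
  have "gvar x - gvar y \<noteq> 0" "gvar y - gvar x \<noteq> 0" using assms by auto
  then show ?thesis
    unfolding kernel_same_colour[OF True] kernel_same_colour[OF True[symmetric]] True[symmetric]
      c[symmetric]
    by (simp add: divide_simps) (simp add: algebra_simps)
next
  case False
  then obtain M where M: "kernel x y = M * (gvar y - gvar x - c)"
      "kernel y x = M * (gvar y - gvar x + c)"
    using kernel_distinct_colours[OF False] by (auto simp: c_def)
  show ?thesis unfolding M by (simp add: algebra_simps)
qed

text \<open>The factor with index j is the value of \<open>sum_serre_bracket\<close> for j + 1
  poles: the commutator that enlarges the set of variables of colour k from j to j + 1 elements
  contributes it.\<close>

definition serre_weight :: "'i \<Rightarrow> 'i \<Rightarrow> nat \<Rightarrow> 'i mpoly fract" where
  "serre_weight k l n = (\<Prod>j<n. of_nat (Suc j) *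
     (2 * (of_int (- (d k * a k l)) * half_hbar) - of_nat j * (2 * of_int (d k) * half_hbar)))"

lemma serre_weight_eq_0:
  assumes "k \<noteq> l"
  shows "serre_weight k l (nat (1 - a k l)) = 0"
proof -
  \<comment> \<open>The vanishing factor: 2 c = - a_kl D, and the index j = - a_kl is the last one
    in the product.\<close>
  define j where "j = nat (- a k l)"
  have j: "int j = - a k l" using gcm_nonpos[OF assms] by (simp add: j_def)
  have "(of_nat j :: 'i mpoly fract) = of_int (int j)" by simp
  also have "\<dots> = of_int (- a k l)" unfolding j ..
  finally have "2 * (of_int (- (d k * a k l)) * half_hbar :: 'i mpoly fract) -
      of_nat j * (2 * of_int (d k) * half_hbar) = 0"
    by (simp add: algebra_simps)
  moreover have "j < nat (1 - a k l)" using j by simp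
  ultimately show ?thesis unfolding serre_weight_def by (intro prod_zero) auto
qed

text \<open>In the coordinates z b = y - b the kernel from b to the other variables of colour k is
  the product defining \<open>residue\<close> for D, and the kernel in the opposite direction is the
  one for -D. The variable y supplies M b (z b + c) and M b (z b - c).\<close>

lemma kernel2_commutator:
  fixes z :: "'i \<times> nat \<Rightarrow> 'i mpoly fract" and c D :: "'i mpoly fract"
  assumes "finite B" "\<And>b. b \<in> B \<Longrightarrow> fst b = k" "fst y \<noteq> k"
    and M: "\<And>b. b \<in> B \<Longrightarrow> kernel b y = M b * (z b + c) \<and> kernel y b = M b * (z b - c)"
    and z: "z = (\<lambda>b. gvar y - gvar b)" and D: "D = 2 * of_int (d k) * half_hbar"
    and b: "b \<in> B"
  shows "kernel2 {b} (insert y (B - {b})) - kernel2 (insert y (B - {b})) {b} =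
    M b * ((z b + c) * residue z D B b - (z b - c) * residue z (- D) B b)"
proof -
  have same: "kernel b b' = (z b - z b' - D) / (z b - z b')"
    "kernel b' b = (z b - z b' - - D) / (z b - z b')" if "b' \<in> B - {b}" for b'
  proof -
    have "fst b = k" "fst b' = k" "gvar b - gvar b' \<noteq> 0" "gvar b' - gvar b \<noteq> 0"
      using that b assms(2) by auto
    then show "kernel b b' = (z b - z b' - D) / (z b - z b')"
      "kernel b' b = (z b - z b' - - D) / (z b - z b')"
      by (simp_all add: kernel_same_colour z D divide_simps) (simp_all add: algebra_simps)
  qed
  have y: "y \<notin> B - {b}" "finite (B - {b})" using assms(2)[of y] assms(1,3) by auto
  have "(\<Prod>b'\<in>B - {b}. kernel b b') = residue z D B b"
    unfolding residue_def by (rule prod.cong[OF refl same(1)])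
  then have "kernel2 {b} (insert y (B - {b})) = kernel b y * residue z D B b"
    using y by (simp add: kernel2_def)
  moreover have "(\<Prod>b'\<in>B - {b}. kernel b' b) = residue z (- D) B b"
    unfolding residue_def by (rule prod.cong[OF refl same(2)])
  then have "kernel2 (insert y (B - {b})) {b} = kernel y b * residue z (- D) B b"
    using y by (simp add: kernel2_def)
  ultimately show ?thesis using M[OF b] by (simp add: algebra_simps)
qed

text \<open>Summing the commutator factors over \<open>B\<close> gives a constant, so the symmetrized iterated
  commutator factors into a permanent and a product of constants, one of which vanishes.\<close>

lemma sum_nested:
  fixes z :: "'i \<times> nat \<Rightarrow> 'i mpoly fract" and c D :: "'i mpoly fract"
  assumes "fst y = l" "k \<noteq> l"
    and M: "\<And>b. fst b = k \<Longrightarrow> kernel b y = M b * (z b + c) \<and> kernel y b = M b * (z b - c)"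
    and z: "z = (\<lambda>b. gvar y - gvar b)" and D: "D = 2 * of_int (d k) * half_hbar"
    and c: "c = of_int (- (d k * a k l)) * half_hbar"
    and "finite J" "card J = n" "length bs = n" "distinct bs" "\<And>b. b \<in> set bs \<Longrightarrow> fst b = k"
  shows "(\<Sum>js\<in>permutations_of_set J.
      nested k (map \<xi> js) (gen_fun l \<eta>) (insert y (set bs))) =
    \<eta> y * prod M (set bs) * permanent \<xi> J bs * serre_weight k l n"
  using assms(7-)
proof (induction n arbitrary: J bs)
  case 0
  then show ?case using assms(1)
    by (simp add: gen_fun_singleton permanent_def serre_weight_def)
next
  case (Suc n)
  let ?B = "set bs"
  let ?N = "\<lambda>js. nested k (map \<xi> js) (gen_fun l \<eta>)"
  define t where "t = (\<lambda>b. kernel2 {b} (insert y (?B - {b})) - kernel2 (insert y (?B - {b})) {b})"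
  define T where "T = (\<lambda>b. (z b + c) * residue z D ?B b - (z b - c) * residue z (- D) ?B b)"
  have J: "J \<noteq> {}" using Suc.prems by auto
  have B: "card ?B = Suc n" using Suc.prems by (simp add: distinct_card)
  have t: "t b = M b * T b" if "b \<in> ?B" for b
    unfolding t_def T_def
    by (rule kernel2_commutator[OF _ _ _ _ z D that]) (use Suc.prems(5) M assms(1,2) in auto)
  have comm: "?N (j # js) (insert y ?B) = (\<Sum>b\<in>?B. \<xi> j b * t b * ?N js (insert y (?B - {b})))" for j js
  proof -
    have "{x. x \<in> insert y ?B \<and> fst x = k} = ?B" using Suc.prems(5) assms(1,2) by auto
    moreover have "insert y ?B - {b} = insert y (?B - {b})" if "b \<in> ?B" for b
      using Suc.prems(5)[OF that] assms(1,2) by auto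
    ultimately show ?thesis by (simp add: conv_comm_gen t_def cong: sum.cong)
  qed
  have IH: "(\<Sum>js\<in>permutations_of_set (J - {j}). ?N js (insert y (?B - {b}))) =
      \<eta> y * prod M (?B - {b}) * permanent \<xi> (J - {j}) (remove1 b bs) * serre_weight k l n"
    if "j \<in> J" "b \<in> ?B" for j b
  proof -
    have set: "set (remove1 b bs) = ?B - {b}" using Suc.prems(4) by (simp add: set_remove1_eq)
    show ?thesis
      using Suc.IH[of "J - {j}" "remove1 b bs"] Suc.prems that
      by (simp add: set length_remove1 distinct_remove1)
  qed
  have "(\<Sum>js\<in>permutations_of_set J. ?N js (insert y ?B)) =
      (\<Sum>j\<in>J. \<Sum>js\<in>permutations_of_set (J - {j}). \<Sum>b\<in>?B. \<xi> j b * t b * ?N js (insert y (?B - {b})))"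
    unfolding sum_permutations_of_set[OF Suc.prems(1) J] comm ..
  also have "\<dots> = (\<Sum>j\<in>J. \<Sum>b\<in>?B. \<xi> j b * t b *
      (\<Sum>js\<in>permutations_of_set (J - {j}). ?N js (insert y (?B - {b}))))"
    by (subst sum.swap) (simp add: sum_distrib_left)
  also have "\<dots> = (\<Sum>b\<in>?B. \<Sum>j\<in>J. \<xi> j b * t b *
      (\<Sum>js\<in>permutations_of_set (J - {j}). ?N js (insert y (?B - {b}))))"
    by (rule sum.swap)
  \<comment> \<open>The decisive factorization: summing over the index j of the outermost generator
    reassembles the full permanent, whichever variable b it was attached to, so the only remaining
    dependence on b is through \<open>T b\<close>.\<close>
  also have "\<dots> = (\<Sum>b\<in>?B. T b * (\<eta> y * prod M ?B * permanent \<xi> J bs * serre_weight k l n))"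
  proof (rule sum.cong[OF refl])
    fix b assume b: "b \<in> ?B"
    have "(\<Sum>j\<in>J. \<xi> j b * t b * (\<Sum>js\<in>permutations_of_set (J - {j}). ?N js (insert y (?B - {b})))) =
        (\<Sum>j\<in>J. \<xi> j b * permanent \<xi> (J - {j}) (remove1 b bs)) *
        (t b * (\<eta> y * prod M (?B - {b}) * serre_weight k l n))"
      unfolding sum_distrib_right by (rule sum.cong) (simp_all add: IH b mult_ac)
    also have "(\<Sum>j\<in>J. \<xi> j b * permanent \<xi> (J - {j}) (remove1 b bs)) =
        permanent \<xi> J (b # remove1 b bs)"
      by (rule permanent_Cons[OF Suc.prems(1) J, symmetric])
    also have "\<dots> = permanent \<xi> J bs"
      by (rule permanent_cong_mset) (use b Suc.prems in \<open>simp_all add: length_remove1\<close>)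
    \<comment> \<open>The factor M b contained in \<open>t b\<close> completes the product of M over
      \<open>?B - {b}\<close>.\<close>
    also have "t b * (\<eta> y * prod M (?B - {b}) * serre_weight k l n) =
        T b * (\<eta> y * prod M ?B * serre_weight k l n)"
      using b by (simp add: t prod.remove[of ?B b M] mult_ac)
    finally show "(\<Sum>j\<in>J. \<xi> j b * t b *
        (\<Sum>js\<in>permutations_of_set (J - {j}). ?N js (insert y (?B - {b})))) =
      T b * (\<eta> y * prod M ?B * permanent \<xi> J bs * serre_weight k l n)"
      by (simp only: mult_ac)
  qed
  also have "\<dots> = (\<Sum>b\<in>?B. T b) * (\<eta> y * prod M ?B * permanent \<xi> J bs * serre_weight k l n)"
    by (simp only: sum_distrib_right)
  also have "(\<Sum>b\<in>?B. T b) = of_nat (Suc n) * (2 * c - (of_nat (Suc n) - 1) * D)"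
    unfolding T_def B[symmetric] by (rule sum_serre_bracket) (auto simp: inj_on_def z)
  also have "\<dots> = of_nat (Suc n) * (2 * c - of_nat n * D)" by simp
  finally show ?case by (simp only: serre_weight_def c D prod.lessThan_Suc mult_ac)
qed

lemma serre_relation:
  assumes "k \<noteq> l"
  shows "(\<Sum>\<sigma> | \<sigma> permutes {1..nat (1 - a k l)}.
    nested k (map (\<lambda>m. \<xi> (\<sigma> m)) [1..<Suc (nat (1 - a k l))]) (gen_fun l \<eta>)) = 0"
proof
  fix A
  let ?n = "nat (1 - a k l)"
  have "(\<Sum>\<sigma> | \<sigma> permutes {1..?n}. nested k (map (\<lambda>m. \<xi> (\<sigma> m)) [1..<Suc ?n]) (gen_fun l \<eta>)) A =
      (\<Sum>\<sigma> | \<sigma> permutes {1..?n}. nested k (map \<xi> (map \<sigma> [1..<Suc ?n])) (gen_fun l \<eta>) A)"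
    by (simp add: sum_set_fun_apply comp_def del: upt_Suc)
  also have "\<dots> = (\<Sum>js\<in>permutations_of_set {1..?n}. nested k (map \<xi> js) (gen_fun l \<eta>) A)"
    by (rule sum_permutes_eq_sum_permutations_of_set)
  also have "\<dots> = 0"
  proof (cases "\<exists>y B. finite B \<and> A = insert y B \<and> fst y = l \<and> (\<forall>b\<in>B. fst b = k) \<and> card B = ?n")
    case True
    then obtain y B where B: "finite B" "A = insert y B" "fst y = l" "\<forall>b\<in>B. fst b = k" "card B = ?n"
      by blast
    obtain bs where bs: "set bs = B" "distinct bs" using finite_distinct_list[OF B(1)] by blast
    have "\<forall>b. \<exists>M. fst b = k \<longrightarrow>
        kernel b y = M * (gvar y - gvar b + of_int (- (d k * a k l)) * half_hbar) \<and>
        kernel y b = M * (gvar y - gvar b - of_int (- (d k * a k l)) * half_hbar)"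
      using kernel_distinct_colours[of _ y] B(3) assms by auto
    then obtain M where M: "\<And>b. fst b = k \<Longrightarrow>
        kernel b y = M b * (gvar y - gvar b + of_int (- (d k * a k l)) * half_hbar) \<and>
        kernel y b = M b * (gvar y - gvar b - of_int (- (d k * a k l)) * half_hbar)"
      by metis
    have "(\<Sum>js\<in>permutations_of_set {1..?n}. nested k (map \<xi> js) (gen_fun l \<eta>) (insert y (set bs))) =
        \<eta> y * prod M (set bs) * permanent \<xi> {1..?n} bs * serre_weight k l ?n"
      by (rule sum_nested[OF B(3) assms M refl refl refl])
        (use bs B(4,5) in \<open>auto simp: distinct_card[symmetric]\<close>)
    then show ?thesis by (simp add: B(2) bs(1) serre_weight_eq_0[OF assms])
  next
    case False
    \<comment> \<open>On sets of any other shape each iterated commutator vanishes on its own,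
      before symmetrization.\<close>
    have "nested k (map \<xi> js) (gen_fun l \<eta>) A = 0" if "js \<in> permutations_of_set {1..?n}" for js
      using nested_support[OF _ assms, of "map \<xi> js" \<eta> A] False
        length_finite_permutations_of_set[OF that] by auto
    then show ?thesis by (intro sum.neutral) blast
  qed
  finally show "(\<Sum>\<sigma> | \<sigma> permutes {1..?n}.
      nested k (map (\<lambda>m. \<xi> (\<sigma> m)) [1..<Suc ?n]) (gen_fun l \<eta>)) A = 0 A"
    by simp
qed

end


section \<open>The homomorphism from the free algebra\<close>

lemma fract_of_mpoly_const: "fract_of (mpoly_const c) = fract_const c"
  by (simp add: fract_const_def)

lemma std_vars_unit_vector: "std_vars (unit_vector k) = {(k, 1)}"
  by (auto simp: std_vars_def unit_vector_def split: if_splits)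

lemma colour_count_singleton: "colour_count {x} = unit_vector (fst x)"
proof
  fix i
  have "{s. (i, s) \<in> {x}} = (if i = fst x then {snd x} else {})"
    by (auto simp: prod_eq_iff)
  then show "colour_count {x} i = unit_vector (fst x) i"
    by (simp add: colour_count_def unit_vector_def)
qed

lemma var_power_in_SH_component: "mpoly_var (k, 1) ^ r \<in> SH_component (unit_vector k)"
proof -
  have "mpoly_vars (mpoly_var (k, 1) ^ r) \<subseteq> std_vars (unit_vector k)"
    using mpoly_vars_power[of "mpoly_var (k, 1)" r] by (simp add: std_vars_unit_vector)
  moreover have "mpoly_rename (\<lambda>(i, s). (i, \<pi> i s)) (mpoly_var (k, 1) ^ r) = mpoly_var (k, 1) ^ r"
    if "\<forall>i. \<pi> i permutes {1..unit_vector k i}" for \<pi>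
    using permutes_in_image[OF spec[OF that, of k], of 1]
    by (simp add: unit_vector_def mpoly_rename_power)
  ultimately show ?thesis
    unfolding SH_component_def std_vars_def by blast
qed

lemma lambda_power_in_sh_carrier: "lambda_power k r \<in> sh_carrier"
  unfolding lambda_power_def by (rule single_in_sh_carrier[OF var_power_in_SH_component])

lemma embed_lambda_power: "embed (lambda_power k r) = gen_fun k (\<lambda>x. gvar x ^ r)"
proof
  fix A :: "('a \<times> nat) set"
  show "embed (lambda_power k r) A = gen_fun k (\<lambda>x. gvar x ^ r) A"
  proof (cases A rule: set_fun_cases)
    case 1
    then show ?thesis by (auto simp: embed_def gen_fun_def)
  next
    case (2 \<pi> v)
    have A: "embed (lambda_power k r) A =
        fract_of (mpoly_rename \<pi> (Poly_Mapping.lookup (lambda_power k r) v))"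
      using embed_image[OF lambda_power_in_sh_carrier 2(1)] 2(2) by simp
    show ?thesis
    proof (cases "v = unit_vector k")
      case True
      then have "A = {\<pi> (k, 1)}" using 2(2) by (simp add: std_vars_unit_vector)
      then show ?thesis
        using A True colour_perm_fst[OF 2(1), of "(k, 1)"]
        by (simp add: gen_fun_singleton lambda_power_def mpoly_rename_power fract_of_power gvar_def)
    next
      case False
      have "colour_count A = v" using 2 by (simp add: colour_count_perm)
      then have "gen_fun k (\<lambda>x. gvar x ^ r) A = 0"
        using False by (intro gen_fun_eq_0) (auto simp: colour_count_singleton)
      then show ?thesis using A False by (simp add: lambda_power_def lookup_single when_def)
    qed
  qed
qed

text \<open>In degree e_k the component consists of polynomials in one variable over the scalars.
  Hence the powers of this variable already generate the spherical subalgebra, which gives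
  surjectivity.\<close>

lemma SH_component_unit_vector:
  assumes "f \<in> SH_component (unit_vector k)"
  shows "f = (\<Sum>m\<in>Poly_Mapping.keys f. mpoly_const (Poly_Mapping.lookup f m) *
    mpoly_var (k, 1) ^ Poly_Mapping.lookup m (k, 1))"
proof -
  have "rename_monom (\<lambda>x. x) m = mpoly_var (k, 1) ^ Poly_Mapping.lookup m (k, 1)"
    if "m \<in> Poly_Mapping.keys f" for m
  proof -
    have "Poly_Mapping.keys m \<subseteq> {(k, 1)}"
      using SH_component_vars[OF assms] that by (auto simp: mpoly_vars_def std_vars_unit_vector)
    then show ?thesis by (subst rename_monom_superset[of "{(k, 1)}"]) simp_all
  qed
  then have "mpoly_rename (\<lambda>x. x) f = (\<Sum>m\<in>Poly_Mapping.keys f.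
      mpoly_const (Poly_Mapping.lookup f m) * mpoly_var (k, 1) ^ Poly_Mapping.lookup m (k, 1))"
    unfolding mpoly_rename_pm_ext pm_ext_def by (intro sum.cong) simp_all
  then show ?thesis by simp
qed

lemma one_in_sh_carrier: "Poly_Mapping.single (\<lambda>_. 0) 1 \<in> sh_carrier"
  by (rule single_in_sh_carrier) (simp add: SH_component_def)

lemma embed_one: "embed (Poly_Mapping.single (\<lambda>_. 0) 1) = one_set_fun"
proof
  fix A :: "('a \<times> nat) set"
  show "embed (Poly_Mapping.single (\<lambda>_. 0) 1) A = one_set_fun A"
  proof (cases A rule: set_fun_cases)
    case 1
    then show ?thesis by (auto simp: embed_def one_set_fun_def)
  next
    case (2 \<pi> v)
    have "std_vars v = {} \<longleftrightarrow> (\<lambda>_. 0) = v"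
    proof
      assume "std_vars v = {}"
      then have "v i = 0" for i
        using colour_count_std_vars[of v] by (simp add: colour_count_def fun_eq_iff)
      then show "(\<lambda>_. 0) = v" by auto
    qed (auto simp: std_vars_def)
    then show ?thesis
      using embed_image[OF one_in_sh_carrier 2(1), of v] 2(2)
      by (simp add: one_set_fun_def lookup_single when_def)
  qed
qed

definition sh_scale :: "complex poly \<Rightarrow> 'i shuffle_elem \<Rightarrow> 'i shuffle_elem" where
  "sh_scale c F = Poly_Mapping.map (\<lambda>f. mpoly_const c * f) F"

lemma lookup_sh_scale:
  "Poly_Mapping.lookup (sh_scale c F) v = mpoly_const c * Poly_Mapping.lookup F v"
  by (simp add: sh_scale_def Poly_Mapping.map.rep_eq when_def)

lemma sh_scale_in_sh_carrier: "F \<in> sh_carrier \<Longrightarrow> sh_scale c F \<in> sh_carrier"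
  by (simp add: sh_carrier_def lookup_sh_scale SH_component_scale)

lemma embed_sh_scale: "embed (sh_scale c F) = (\<lambda>A. fract_const c * embed F A)"
  by (simp add: embed_def fun_eq_iff lookup_sh_scale mpoly_rename_mult fract_of_mult
      fract_of_mpoly_const)

lemma sh_scale_1 [simp]: "sh_scale 1 F = F"
  and sh_scale_0 [simp]: "sh_scale 0 F = 0"
  and sh_scale_add_left: "sh_scale (c + c') F = sh_scale c F + sh_scale c' F"
  and sh_scale_add_right: "sh_scale c (F + G) = sh_scale c F + sh_scale c G"
  and sh_scale_mult: "sh_scale (c * c') F = sh_scale c (sh_scale c' F)"
  by (auto intro!: poly_mapping_eqI[of "sh_scale _ _"] simp: lookup_sh_scale lookup_add
      mpoly_const_add mpoly_const_mult algebra_simps)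

lemma sh_scale_minus_1: "sh_scale (- 1) F = - F"
proof -
  have "mpoly_const (- 1) = (- 1 :: 'a mpoly)" by (simp add: mpoly_const_def single_uminus)
  then show ?thesis by (intro poly_mapping_eqI) (simp only: lookup_sh_scale lookup_uminus mult_minus1)
qed

lemma Chbar_simps [simp]:
  "carrier Chbar = UNIV" "x \<otimes>\<^bsub>Chbar\<^esub> y = x * y" "\<one>\<^bsub>Chbar\<^esub> = 1" "\<zero>\<^bsub>Chbar\<^esub> = 0"
  "x \<oplus>\<^bsub>Chbar\<^esub> y = x + y"
  by (simp_all add: ring_of_type_algebra_def)

lemma free_algebra_simps [simp]:
  "carrier free_algebra = UNIV" "f \<otimes>\<^bsub>free_algebra\<^esub> g = f * g" "\<one>\<^bsub>free_algebra\<^esub> = 1"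
  "\<zero>\<^bsub>free_algebra\<^esub> = 0" "f \<oplus>\<^bsub>free_algebra\<^esub> g = f + g"
  "c \<odot>\<^bsub>free_algebra\<^esub> f = free_const c * f"
  by (simp_all add: free_algebra_def ring_of_type_algebra_def ring.defs module.defs)

lemma free_const_add: "free_const (c + c') = free_const c + free_const c'"
  and free_const_mult: "free_const (c * c') = free_const c * free_const c'"
  by (simp_all add: single_add mult_single)

lemma free_const_commute: "f * free_const c = free_const c * f" for f :: "'i free_alg"
  by (induction f rule: poly_mapping_induct_add)
    (simp_all add: mult_single distrib_left distrib_right mult.commute)

lemma ring_free_algebra: "ring (free_algebra :: (complex poly, 'i free_alg) module)"
proof (rule ringI)
  show "abelian_group (free_algebra :: (complex poly, 'i free_alg) module)"
  proof (rule abelian_groupI)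
    fix f :: "'i free_alg"
    show "\<exists>g\<in>carrier free_algebra. g \<oplus>\<^bsub>free_algebra\<^esub> f = \<zero>\<^bsub>free_algebra\<^esub>"
      by (auto intro: exI[of _ "- f"])
  qed (simp_all add: algebra_simps)
  show "monoid (free_algebra :: (complex poly, 'i free_alg) module)"
    by (rule monoidI) (simp_all add: algebra_simps)
qed (simp_all add: algebra_simps)

lemma assoc_algebra_free_algebra:
  "assoc_algebra Chbar (free_algebra :: (complex poly, 'i free_alg) module)"
proof -
  interpret ring "free_algebra :: (complex poly, 'i free_alg) module" by (rule ring_free_algebra)
  have "module Chbar (free_algebra :: (complex poly, 'i free_alg) module)"
    by (rule moduleI[OF cring_from_type_algebra abelian_group_axioms])
      (simp_all add: free_const_add free_const_mult algebra_simps)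
  moreover have "f * (free_const c * g) = free_const c * (f * g)" for c and f g :: "'i free_alg"
    by (metis free_const_commute mult.assoc)
  ultimately show ?thesis
    by (intro assoc_algebra.intro assoc_algebra_axioms.intro ring_axioms) (simp_all add: mult.assoc)
qed

section \<open>The spherical subalgebra as an associative algebra\<close>

context yangian_shuffle
begin

abbreviation "sph \<equiv> generated_subalgebra Chbar SH
  (\<Union>k. Poly_Mapping.single (unit_vector k) ` SH_component (unit_vector k))"

abbreviation "SHsph \<equiv> spherical_algebra a d
  (Polynomial.smult (1 / 2) hbar) (Polynomial.smult (1 / 2) hbar) (- hbar)"

lemma SH_simps:
  "\<one>\<^bsub>SH\<^esub> = Poly_Mapping.single (\<lambda>_. 0) 1" "\<zero>\<^bsub>SH\<^esub> = 0" "F \<oplus>\<^bsub>SH\<^esub> G = F + G"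
  "c \<odot>\<^bsub>SH\<^esub> F = sh_scale c F"
  by (simp_all add: shuffle_algebra_def sh_scale_def)

lemma SHsph_simps:
  "carrier SHsph = sph" "F \<otimes>\<^bsub>SHsph\<^esub> G = F \<otimes>\<^bsub>SH\<^esub> G"
  "\<one>\<^bsub>SHsph\<^esub> = Poly_Mapping.single (\<lambda>_. 0) 1" "\<zero>\<^bsub>SHsph\<^esub> = 0" "F \<oplus>\<^bsub>SHsph\<^esub> G = F + G"
  "c \<odot>\<^bsub>SHsph\<^esub> F = sh_scale c F"
  by (simp_all add: spherical_algebra_def SH_simps)

lemma sph_one: "Poly_Mapping.single (\<lambda>_. 0) 1 \<in> sph"
  using generated_subalgebra.one[of SH Chbar] by (simp only: SH_simps)

lemma sph_add: "F \<in> sph \<Longrightarrow> G \<in> sph \<Longrightarrow> F + G \<in> sph"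
  using generated_subalgebra.add[of F Chbar SH _ G] by (simp only: SH_simps)

lemma sph_scale: "F \<in> sph \<Longrightarrow> sh_scale c F \<in> sph"
  using generated_subalgebra.smult[of c Chbar F SH] by (simp add: SH_simps)

lemma sph_mult: "F \<in> sph \<Longrightarrow> G \<in> sph \<Longrightarrow> F \<otimes>\<^bsub>SH\<^esub> G \<in> sph"
  by (rule generated_subalgebra.mult)

lemma sph_zero: "0 \<in> sph"
  using sph_scale[OF sph_one, of 0] by simp

lemma lambda_power_in_sph: "lambda_power k r \<in> sph"
  unfolding lambda_power_def
  by (rule generated_subalgebra.incl, rule UN_I[OF UNIV_I], rule imageI,
      rule var_power_in_SH_component)

lemma sph_subset: "sph \<subseteq> sh_carrier"
proof
  fix F assume "F \<in> sph"
  then show "F \<in> sh_carrier"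
  proof induction
    case (incl F)
    then show ?case using single_in_sh_carrier by blast
  qed (simp_all add: SH_simps one_in_sh_carrier add_in_sh_carrier mult_in_sh_carrier
      sh_scale_in_sh_carrier)
qed

lemmas sphD = subsetD[OF sph_subset]

lemma infinite_embed: "infinite A \<Longrightarrow> embed F A = 0"
  by (simp add: embed_def)

lemma assoc_algebra_SHsph: "assoc_algebra Chbar SHsph"
proof -
  \<comment> \<open>Multiplicative identities are transported along the injective map
    \<open>embed\<close>, under which the shuffle product becomes \<open>conv\<close>.\<close>
  have eqI: "F = G" if "F \<in> sh_carrier" "G \<in> sh_carrier" "embed F = embed G" for F G
    using that by (rule embed_inject)
  note closed = sphD sph_mult sph_add sph_scale mult_in_sh_carrier add_in_sh_carrier
    sh_scale_in_sh_carrier one_in_sh_carrier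
  have group: "abelian_group SHsph"
  proof (rule abelian_groupI)
    fix F assume "F \<in> carrier SHsph"
    then have "- F \<in> sph" using sph_scale[of F "- 1"] by (simp add: SHsph_simps sh_scale_minus_1)
    then show "\<exists>G\<in>carrier SHsph. G \<oplus>\<^bsub>SHsph\<^esub> F = \<zero>\<^bsub>SHsph\<^esub>"
      by (intro bexI[of _ "- F"]) (simp_all add: SHsph_simps)
  qed (simp_all add: SHsph_simps sph_add sph_zero algebra_simps)
  have monoid: "monoid SHsph"
    by (rule monoidI; simp only: SHsph_simps)
      (auto intro!: eqI intro: closed simp: sph_one embed_mult closed embed_one conv_assoc
        conv_one_left conv_one_right infinite_embed)
  have ring: "ring SHsph"
    by (rule ringI[OF group monoid]; simp only: SHsph_simps)
      (auto intro!: eqI intro: closed simp: embed_mult closed embed_add conv_add_left conv_add_right)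
  have module: "module Chbar SHsph"
    by (rule moduleI[OF cring_from_type_algebra group])
      (simp_all add: SHsph_simps sph_scale sh_scale_add_left sh_scale_add_right sh_scale_mult)
  show ?thesis
    by (intro assoc_algebra.intro assoc_algebra_axioms.intro ring module; simp only: SHsph_simps)
      (auto intro!: eqI intro: closed simp: embed_mult closed embed_sh_scale conv_scale_left
        conv_scale_right)
qed

section \<open>Evaluation of words and the map from the free algebra\<close>

definition list_fun :: "('i \<times> nat) list \<Rightarrow> 'i set_fun" where
  "list_fun ws = foldr (\<lambda>(k, r). conv (gen_fun k (\<lambda>x. gvar x ^ r))) ws one_set_fun"

definition word_fun :: "('i \<times> nat) word \<Rightarrow> 'i set_fun" where
  "word_fun w = list_fun (letters w)"

lemma ex_sph_list_fun: "\<exists>F\<in>sph. embed F = list_fun ws"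
proof (induction ws)
  case Nil
  then show ?case using sph_one embed_one by (force simp: list_fun_def)
next
  case (Cons w ws)
  then obtain F where F: "F \<in> sph" "embed F = list_fun ws" by blast
  obtain k r where w: "w = (k, r)" by (cases w)
  have "embed (lambda_power k r \<otimes>\<^bsub>SH\<^esub> F) = list_fun (w # ws)"
    using F(2) by (simp add: embed_mult lambda_power_in_sh_carrier sphD[OF F(1)] embed_lambda_power
        list_fun_def w)
  then show ?case using sph_mult[OF lambda_power_in_sph F(1)] by blast
qed

lemma list_fun_append:
  "list_fun (us @ ws) = conv (list_fun us) (list_fun ws)"
proof (induction us)
  case Nil
  have "list_fun ws A = 0" if "infinite A" for A
    using ex_sph_list_fun[of ws] infinite_embed[OF that] by metis
  then have "conv one_set_fun (list_fun ws) = list_fun ws" by (rule conv_one_left)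
  then show ?case by (simp add: list_fun_def)
next
  case (Cons u us)
  then show ?case by (simp add: list_fun_def conv_assoc case_prod_unfold)
qed

text \<open>The target is the space of set functions because \<open>conv\<close> is bilinear without
  restriction there, whereas the shuffle product is controlled on \<open>sh_carrier\<close>
  only.\<close>

definition free_map :: "'i free_alg \<Rightarrow> 'i set_fun" where
  "free_map = pm_ext (\<lambda>w c A. fract_const c * word_fun w A)"

lemma free_map_0: "free_map 0 = 0"
  and free_map_add: "free_map (f + g) = free_map f + free_map g"
  and free_map_single: "free_map (Poly_Mapping.single w c) = (\<lambda>A. fract_const c * word_fun w A)"
  unfolding free_map_def
  by (intro pm_ext_0 pm_ext_add pm_ext_single;
      simp add: fun_eq_iff fract_const_add distrib_right)+

lemma free_map_mult: "free_map (f * g) = conv (free_map f) (free_map g)"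
  unfolding free_map_def
proof (rule pm_ext_mult)
  fix w w' :: "('i \<times> nat) word" and c c'
  have "word_fun (w + w') = conv (word_fun w) (word_fun w')"
    by (simp add: word_fun_def plus_word_def list_fun_append)
  then show "(\<lambda>A. fract_const (c * c') * word_fun (w + w') A) =
      conv (\<lambda>A. fract_const c * word_fun w A) (\<lambda>A. fract_const c' * word_fun w' A)"
    by (simp add: conv_scale_left conv_scale_right fract_const_mult mult_ac)
  show "conv (\<phi> + \<psi>) \<chi> = conv \<phi> \<chi> + conv \<psi> \<chi>" "conv \<phi> (\<psi> + \<chi>) = conv \<phi> \<psi> + conv \<phi> \<chi>"
    "conv 0 \<phi> = 0" "conv \<phi> 0 = 0" for \<phi> \<psi> \<chi>
    by (rule conv_add_left conv_add_right conv_zero_left conv_zero_right)+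
qed (simp_all add: fun_eq_iff fract_const_add distrib_right)

lemma ex_sph_free_map: "\<exists>F\<in>sph. embed F = free_map f"
proof (induction f rule: poly_mapping_induct_add)
  case zero
  show ?case by (intro bexI[of _ 0]) (simp_all only: embed_0 free_map_0 sph_zero)
next
  case (single w c)
  obtain F where F: "F \<in> sph" "embed F = word_fun w"
    using ex_sph_list_fun[of "letters w"] by (auto simp: word_fun_def)
  then have "embed (sh_scale c F) = free_map (Poly_Mapping.single w c)"
    by (simp add: embed_sh_scale free_map_single)
  then show ?case using sph_scale[OF F(1)] by blast
next
  case (add f g)
  then obtain F G where "F \<in> sph" "G \<in> sph" "embed F = free_map f" "embed G = free_map g" by blast
  then show ?case by (intro bexI[of _ "F + G"]) (simp_all add: embed_add free_map_add sph_add)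
qed

text \<open>The choice is unique because \<open>embed\<close> is injective on the spherical
  subalgebra; \<open>free_hom_eqI\<close> exploits this to derive the algebra laws from those of
  \<open>free_map\<close>.\<close>

definition free_hom :: "'i free_alg \<Rightarrow> 'i shuffle_elem" where
  "free_hom f = (SOME F. F \<in> sph \<and> embed F = free_map f)"

lemma free_hom: "free_hom f \<in> sph" "embed (free_hom f) = free_map f"
proof -
  have "\<exists>F. F \<in> sph \<and> embed F = free_map f" using ex_sph_free_map by blast
  from someI_ex[OF this] show "free_hom f \<in> sph" "embed (free_hom f) = free_map f"
    by (simp_all add: free_hom_def)
qed

lemma free_hom_eqI: "F \<in> sph \<Longrightarrow> embed F = free_map f \<Longrightarrow> free_hom f = F"
  using free_hom by (intro embed_inject sphD) simp_all

lemma word_fun_0: "word_fun 0 = one_set_fun"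
  by (simp add: word_fun_def zero_word_def list_fun_def)

lemma free_map_const: "free_map (free_const c * f) = (\<lambda>A. fract_const c * free_map f A)"
proof -
  have "conv one_set_fun (free_map f) = free_map f"
    by (rule conv_one_left) (simp add: infinite_embed flip: free_hom(2))
  then show ?thesis by (simp add: free_map_mult free_map_single word_fun_0 conv_scale_left)
qed

lemma free_map_1: "free_map 1 = one_set_fun"
  using free_map_single[of 0 1] by (simp add: word_fun_0)

lemma free_map_gen: "free_map (free_gen k r) = gen_fun k (\<lambda>x. gvar x ^ r)"
proof -
  have "conv (gen_fun k (\<lambda>x. gvar x ^ r)) one_set_fun = gen_fun k (\<lambda>x. gvar x ^ r)"
    by (rule conv_one_right) (auto simp: gen_fun_def)
  then show ?thesis by (simp add: free_gen_def free_map_single word_fun_def list_fun_def)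
qed

lemma free_hom_add: "free_hom (f + g) = free_hom f + free_hom g"
  by (rule free_hom_eqI) (simp_all add: free_hom sph_add embed_add free_map_add)

lemma free_hom_mult: "free_hom (f * g) = free_hom f \<otimes>\<^bsub>SH\<^esub> free_hom g"
  by (rule free_hom_eqI) (simp_all add: free_hom sph_mult embed_mult sphD free_map_mult)

lemma free_hom_1: "free_hom 1 = Poly_Mapping.single (\<lambda>_. 0) 1"
  by (rule free_hom_eqI) (simp_all add: sph_one embed_one free_map_1)

lemma free_hom_const: "free_hom (free_const c * f) = sh_scale c (free_hom f)"
  by (rule free_hom_eqI) (simp_all add: free_hom sph_scale embed_sh_scale free_map_const)

lemma free_hom_gen: "free_hom (free_gen k r) = lambda_power k r"
  by (rule free_hom_eqI) (simp_all add: lambda_power_in_sph embed_lambda_power free_map_gen)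

lemma free_hom_surj:
  assumes "F \<in> sph"
  shows "F \<in> range free_hom"
  using assms
proof induction
  case one
  show ?case by (metis free_hom_1 SH_simps(1) rangeI)
next
  case (incl F)
  then obtain k f where F: "F = Poly_Mapping.single (unit_vector k) f"
    and f: "f \<in> SH_component (unit_vector k)" by blast
  \<comment> \<open>The generator is a polynomial in one variable with coefficients
    \<open>?c m\<close> and exponents \<open>?r m\<close>; its preimage is the same combination of
    the free generators.\<close>
  let ?c = "Poly_Mapping.lookup f" and ?r = "\<lambda>m. Poly_Mapping.lookup m (k, 1)"
  have sum: "free_hom (\<Sum>m\<in>M. free_const (?c m) * free_gen k (?r m)) =
      (\<Sum>m\<in>M. sh_scale (?c m) (lambda_power k (?r m)))" if "finite M" for M
    using that
  proof induction
    case empty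
    show ?case by (simp add: free_hom_eqI sph_zero free_map_0)
  qed (simp add: free_hom_add free_hom_const free_hom_gen)
  have "F = (\<Sum>m\<in>Poly_Mapping.keys f. sh_scale (?c m) (lambda_power k (?r m)))"
  proof (rule poly_mapping_eqI)
    fix v
    show "Poly_Mapping.lookup F v = Poly_Mapping.lookup
        (\<Sum>m\<in>Poly_Mapping.keys f. sh_scale (?c m) (lambda_power k (?r m))) v"
      using SH_component_unit_vector[OF f, symmetric]
      by (cases "unit_vector k = v")
        (simp_all add: F lookup_sum lookup_sh_scale lambda_power_def lookup_single when_def)
  qed
  then have "F = free_hom (\<Sum>m\<in>Poly_Mapping.keys f. free_const (?c m) * free_gen k (?r m))"
    by (simp only: sum[OF finite_keys])
  then show ?case by simp
next
  case (add F G)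
  then obtain f g where "F = free_hom f" "G = free_hom g" by blast
  then have "F \<oplus>\<^bsub>SH\<^esub> G = free_hom (f + g)" by (simp only: SH_simps free_hom_add)
  then show ?case by simp
next
  case (mult F G)
  then obtain f g where "F = free_hom f" "G = free_hom g" by blast
  then have "F \<otimes>\<^bsub>SH\<^esub> G = free_hom (f * g)" by (simp only: free_hom_mult)
  then show ?case by simp
next
  case (smult c F)
  then obtain f where "F = free_hom f" by blast
  then have "c \<odot>\<^bsub>SH\<^esub> F = free_hom (free_const c * f)" by (simp only: SH_simps free_hom_const)
  then show ?case by simp
qed

section \<open>The defining relations lie in the kernel\<close>

lemma free_map_uminus: "free_map (- f) = - free_map f"
  by (metis add.right_inverse add_eq_0_iff free_map_0 free_map_add)

lemma free_map_diff: "free_map (f - g) = free_map f - free_map g"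
  using free_map_add[of f "- g"] by (simp add: free_map_uminus)

lemma free_map_commutator: "free_map (commutator f g) = conv_comm (free_map f) (free_map g)"
  by (simp add: commutator_def free_map_diff free_map_mult conv_comm_def)

lemma free_map_sum: "free_map (sum f A) = (\<Sum>x\<in>A. free_map (f x))"
  by (induction A rule: infinite_finite_induct) (simp_all only: sum.infinite sum.empty sum.insert
      free_map_0 free_map_add simp_thms not_False_eq_True)

text \<open>The coefficient of u^p in the expansion of \<hbar> / (u - x) at u = infinity, the image
  of the generating series of the generators.\<close>

definition series_coeff :: "int \<Rightarrow> 'i \<times> nat \<Rightarrow> 'i mpoly fract" where
  "series_coeff p x = (if p < 0 then fract_const hbar * gvar x ^ nat (- p - 1) else 0)"

lemma free_map_gen_series: "free_map (gen_series k p) = gen_fun k (series_coeff p)"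
  by (auto simp: gen_series_def free_map_0 free_map_const free_map_gen gen_fun_def series_coeff_def
      fun_eq_iff)

text \<open>Coefficientwise form of u x(u) = \<lambda> x(u) + \<hbar>. The constant \<hbar>, visible
  at p = 0, is what the commutator terms in (Y1) compensate.\<close>

lemma series_coeff_pred:
  "series_coeff (p - 1) x = gvar x * series_coeff p x + (if p = 0 then fract_const hbar else 0)"
proof -
  have "nat (- (p - 1) - 1) = Suc (nat (- p - 1))" if "p < 0" using that by simp
  then show ?thesis by (auto simp: series_coeff_def)
qed

lemma free_map_Y1: "free_map (Y1_coeff a d k l p q) = 0"
proof
  fix A
  let ?\<xi> = series_coeff and ?hb = "fract_const hbar"
  let ?P = "ordered_pairs k l A"
  let ?c = "of_int (d k * a k l) * half_hbar"
  let ?K = "\<lambda>z. kernel (fst z) (snd z)" and ?L = "\<lambda>z. kernel (snd z) (fst z)"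
  have F: "free_map (gen_series k r * gen_series l s) A =
      (\<Sum>z\<in>?P. ?\<xi> r (fst z) * ?\<xi> s (snd z) * ?K z)" for r s
    by (simp add: free_map_mult free_map_gen_series conv_gen_gen(1) case_prod_unfold)
  have G: "free_map (gen_series l s * gen_series k r) A =
      (\<Sum>z\<in>?P. ?\<xi> r (fst z) * ?\<xi> s (snd z) * ?L z)" for r s
    by (simp add: free_map_mult free_map_gen_series conv_gen_gen(2) case_prod_unfold)
  have gen_0: "free_map (free_gen i 0) = gen_fun i (\<lambda>_. 1)" for i
    by (simp add: free_map_gen)
  have C1: "free_map (commutator (free_gen k 0) (gen_series l s)) A =
      (\<Sum>z\<in>?P. ?\<xi> s (snd z) * (?K z - ?L z))" for s
    unfolding free_map_commutator free_map_gen_series gen_0 conv_comm_def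
    by (simp add: conv_gen_gen[where k = k and l = l and \<xi> = "\<lambda>_. 1" and \<eta> = "?\<xi> s"]
        case_prod_unfold sum_subtractf right_diff_distrib)
  have C2: "free_map (commutator (gen_series k r) (free_gen l 0)) A =
      (\<Sum>z\<in>?P. ?\<xi> r (fst z) * (?K z - ?L z))" for r
    unfolding free_map_commutator free_map_gen_series gen_0 conv_comm_def
    by (simp add: conv_gen_gen[where k = k and l = l and \<xi> = "?\<xi> r" and \<eta> = "\<lambda>_. 1"]
        case_prod_unfold sum_subtractf right_diff_distrib)
  have if1: "free_map (if b then f else 0) A = (if b then free_map f A else 0)" for b f
    by (simp add: free_map_0)
  have if2: "(if b then sum f ?P else 0) = (\<Sum>z\<in>?P. if b then f z else 0)"
    for b and f :: "_ \<Rightarrow> 'i mpoly fract" by simp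
  have lin: "sum A1 ?P - sum A2 ?P - c * sum A3 ?P - (sum B1 ?P - sum B2 ?P + c * sum B3 ?P) -
      h * (sum C1 ?P - sum C2 ?P) = (\<Sum>z\<in>?P. (A1 z - A2 z - c * A3 z) -
      (B1 z - B2 z + c * B3 z) - h * (C1 z - C2 z))"
    for A1 A2 A3 B1 B2 B3 C1 C2 :: "_ \<Rightarrow> 'i mpoly fract" and c h
    by (simp add: sum_subtractf sum.distrib sum_distrib_left right_diff_distrib)
  have "free_map (Y1_coeff a d k l p q) A = (\<Sum>z\<in>?P.
      (?\<xi> (p - 1) (fst z) * ?\<xi> q (snd z) * ?K z - ?\<xi> p (fst z) * ?\<xi> (q - 1) (snd z) * ?K z -
        ?c * (?\<xi> p (fst z) * ?\<xi> q (snd z) * ?K z)) -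
      (?\<xi> (p - 1) (fst z) * ?\<xi> q (snd z) * ?L z - ?\<xi> p (fst z) * ?\<xi> (q - 1) (snd z) * ?L z +
        ?c * (?\<xi> p (fst z) * ?\<xi> q (snd z) * ?L z)) -
      ?hb * ((if p = 0 then ?\<xi> q (snd z) * (?K z - ?L z) else 0) -
        (if q = 0 then ?\<xi> p (fst z) * (?K z - ?L z) else 0)))"
    unfolding Y1_coeff_def Let_def
    by (simp only: free_map_diff free_map_add free_map_const fract_const_smult_hbar
        minus_apply plus_fun_apply F G C1 C2 if1 if2 lin)
  also have "\<dots> = (\<Sum>z\<in>?P. 0)"
  proof (rule sum.cong[OF refl])
    fix z assume "z \<in> ?P"
    then have z: "fst z \<noteq> snd z" "fst (fst z) = k" "fst (snd z) = l"
      by (auto simp: ordered_pairs_def)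
    have K: "(gvar (fst z) - gvar (snd z) - ?c) * ?K z = (gvar (fst z) - gvar (snd z) + ?c) * ?L z"
      using kernel_exchange[OF z(1)] by (simp add: z)
    \<comment> \<open>Abstract form of one summand: U, V are the variables, P, Q the series
      coefficients, K, L the kernels in the two orders, h stands for \<hbar>, and e, e' indicate p =
      0 and q = 0. The terms with e and e' cancel and the exchange identity remains.\<close>
    have "(U * P + e * h) * Q * K - P * (V * Q + e' * h) * K - c * (P * Q * K) -
        ((U * P + e * h) * Q * L - P * (V * Q + e' * h) * L + c * (P * Q * L)) -
        h * (e * (Q * (K - L)) - e' * (P * (K - L))) =
      P * Q * ((U - V - c) * K - (U - V + c) * L)"
      for U V P Q K L c e e' h :: "'i mpoly fract"
      by (simp add: algebra_simps)
    note eq = this[of "gvar (fst z)" "?\<xi> p (fst z)" "if p = 0 then 1 else 0" ?hb "?\<xi> q (snd z)" "?K z"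
        "gvar (snd z)" "if q = 0 then 1 else 0" ?c "?L z", unfolded K]
    have if3: "(if b then (1 :: 'i mpoly fract) else 0) * t = (if b then t else 0)" for b t by simp
    show "(?\<xi> (p - 1) (fst z) * ?\<xi> q (snd z) * ?K z - ?\<xi> p (fst z) * ?\<xi> (q - 1) (snd z) * ?K z -
        ?c * (?\<xi> p (fst z) * ?\<xi> q (snd z) * ?K z)) -
      (?\<xi> (p - 1) (fst z) * ?\<xi> q (snd z) * ?L z - ?\<xi> p (fst z) * ?\<xi> (q - 1) (snd z) * ?L z +
        ?c * (?\<xi> p (fst z) * ?\<xi> q (snd z) * ?L z)) -
      ?hb * ((if p = 0 then ?\<xi> q (snd z) * (?K z - ?L z) else 0) -
        (if q = 0 then ?\<xi> p (fst z) * (?K z - ?L z) else 0)) = 0"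
      using eq unfolding series_coeff_pred if3 by simp
  qed
  finally show "free_map (Y1_coeff a d k l p q) A = 0 A" by simp
qed

lemma free_map_Y2:
  assumes "k \<noteq> l"
  shows "free_map (Y2_coeff a k l p q) = 0"
proof -
  have "free_map (foldr (\<lambda>m y. commutator (gen_series k (p (\<sigma> m))) y) ms (gen_series l q)) =
      nested k (map (\<lambda>m. series_coeff (p (\<sigma> m))) ms) (gen_fun l (series_coeff q))"
    for \<sigma> :: "nat \<Rightarrow> nat" and ms
    by (induction ms) (simp_all add: free_map_commutator free_map_gen_series)
  then show ?thesis
    unfolding Y2_coeff_def Let_def free_map_sum
    using serre_relation[OF assms, of "\<lambda>m. series_coeff (p m)" "series_coeff q"] by simp
qed

lemma Y_ideal:
  shows ideal_Y_ideal: "ideal (Y_ideal a d) free_algebra"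
    and Y_ideal_kernel: "f \<in> Y_ideal a d \<Longrightarrow> free_map f = 0"
proof -
  interpret ring "free_algebra :: (complex poly, 'i free_alg) module" by (rule ring_free_algebra)
  show "ideal (Y_ideal a d) free_algebra"
    unfolding Y_ideal_def by (rule genideal_ideal) simp
  have "ideal {f. free_map f = 0} free_algebra"
  proof (rule idealI[OF ring_axioms])
    have inv: "\<ominus>\<^bsub>free_algebra\<^esub> f = - f" for f :: "'i free_alg"
      by (rule minus_equality[symmetric, THEN sym]) simp_all
    show "subgroup {f. free_map f = 0} (add_monoid free_algebra)"
      by (rule add.subgroupI)
        (auto intro: exI[of _ 0] simp: free_map_0 free_map_add free_map_uminus inv simp flip: a_inv_def)
  qed (simp_all add: free_map_mult)
  moreover have "Y_relations a d \<subseteq> {f. free_map f = 0}"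
    by (auto simp: Y_relations_def free_map_Y1 free_map_Y2)
  ultimately have "Y_ideal a d \<subseteq> {f. free_map f = 0}"
    unfolding Y_ideal_def by (rule genideal_minimal)
  then show "f \<in> Y_ideal a d \<Longrightarrow> free_map f = 0" by blast
qed

end


section \<open>Quotients of associative algebras\<close>

lemma quotient_algebra_simps:
  "carrier (quotient_algebra A J) = carrier (A Quot J)"
  "x \<otimes>\<^bsub>quotient_algebra A J\<^esub> y = x \<otimes>\<^bsub>A Quot J\<^esub> y"
  "\<one>\<^bsub>quotient_algebra A J\<^esub> = \<one>\<^bsub>A Quot J\<^esub>"
  "\<zero>\<^bsub>quotient_algebra A J\<^esub> = \<zero>\<^bsub>A Quot J\<^esub>"
  "x \<oplus>\<^bsub>quotient_algebra A J\<^esub> y = x \<oplus>\<^bsub>A Quot J\<^esub> y"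
  "c \<odot>\<^bsub>quotient_algebra A J\<^esub> C = (\<Union>x\<in>C. J +>\<^bsub>A\<^esub> (c \<odot>\<^bsub>A\<^esub> x))"
  by (simp_all add: quotient_algebra_def FactRing_def ring.defs module.defs monoid.defs)

lemma carrier_FactRing: "carrier (A Quot J) = (\<lambda>x. J +>\<^bsub>A\<^esub> x) ` carrier A"
  by (auto simp: FactRing_def A_RCOSETS_def')

text \<open>A two-sided ring ideal of an algebra with unit is stable under scalars, since c j = (c
  1) j. Hence all sets in the union defining the scalar action on a coset coincide.\<close>

lemma smult_coset:
  assumes "assoc_algebra R A" "ideal J A" "c \<in> carrier R" "x \<in> carrier A"
  shows "c \<odot>\<^bsub>quotient_algebra A J\<^esub> (J +>\<^bsub>A\<^esub> x) = J +>\<^bsub>A\<^esub> (c \<odot>\<^bsub>A\<^esub> x)"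
proof -
  interpret A: assoc_algebra R A by fact
  interpret J: ideal J A by fact
  interpret Q: ring "A Quot J" by (rule J.quotient_is_ring)
  interpret q: ring_hom_ring A "A Quot J" "\<lambda>x. J +>\<^bsub>A\<^esub> x" by (rule J.rcos_ring_hom_ring)
  have "J +>\<^bsub>A\<^esub> (c \<odot>\<^bsub>A\<^esub> y) = J +>\<^bsub>A\<^esub> (c \<odot>\<^bsub>A\<^esub> x)" if y: "y \<in> J +>\<^bsub>A\<^esub> x" for y
  proof -
    obtain j where j: "j \<in> J" "y = j \<oplus>\<^bsub>A\<^esub> x" using y by (auto simp: a_r_coset_def')
    have jA: "j \<in> carrier A" using j(1) J.Icarr by blast
    have "c \<odot>\<^bsub>A\<^esub> j = (c \<odot>\<^bsub>A\<^esub> \<one>\<^bsub>A\<^esub>) \<otimes>\<^bsub>A\<^esub> j"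
      using assms(3) jA by (simp add: A.smult_mult_left)
    moreover have "(c \<odot>\<^bsub>A\<^esub> \<one>\<^bsub>A\<^esub>) \<otimes>\<^bsub>A\<^esub> j \<in> J"
      using assms(3) by (intro J.I_l_closed j(1) A.smult_closed A.one_closed)
    ultimately have "c \<odot>\<^bsub>A\<^esub> j \<in> J" by (simp only:)
    then have zero: "J +>\<^bsub>A\<^esub> (c \<odot>\<^bsub>A\<^esub> j) = \<zero>\<^bsub>A Quot J\<^esub>"
      by (simp only: FactRing_def ring.simps J.a_rcos_const)
    have "J +>\<^bsub>A\<^esub> (c \<odot>\<^bsub>A\<^esub> y) = J +>\<^bsub>A\<^esub> (c \<odot>\<^bsub>A\<^esub> j \<oplus>\<^bsub>A\<^esub> c \<odot>\<^bsub>A\<^esub> x)"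
      by (simp only: j(2) A.smult_r_distr[OF assms(3) jA assms(4)])
    also have "\<dots> = (J +>\<^bsub>A\<^esub> (c \<odot>\<^bsub>A\<^esub> j)) \<oplus>\<^bsub>A Quot J\<^esub> (J +>\<^bsub>A\<^esub> (c \<odot>\<^bsub>A\<^esub> x))"
      by (intro q.hom_add A.smult_closed assms(3,4) jA)
    also have "\<dots> = J +>\<^bsub>A\<^esub> (c \<odot>\<^bsub>A\<^esub> x)"
      unfolding zero by (intro Q.l_zero q.hom_closed A.smult_closed assms(3,4))
    finally show ?thesis .
  qed
  moreover have "x \<in> J +>\<^bsub>A\<^esub> x" using assms(4) by (rule J.a_rcos_self)
  ultimately show ?thesis unfolding quotient_algebra_simps by blast
qed

lemma assoc_algebra_quotient:
  assumes "assoc_algebra R A" "ideal J A"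
  shows "assoc_algebra R (quotient_algebra A J)"
proof -
  interpret A: assoc_algebra R A by fact
  interpret J: ideal J A by fact
  interpret Q: ring "A Quot J" by (rule J.quotient_is_ring)
  interpret q: ring_hom_ring A "A Quot J" "\<lambda>x. J +>\<^bsub>A\<^esub> x" by (rule J.rcos_ring_hom_ring)
  note smult = smult_coset[OF assms] and simps = quotient_algebra_simps(1-5)
  have group: "abelian_group (quotient_algebra A J)"
  proof (rule abelian_groupI; unfold simps)
    fix C assume "C \<in> carrier (A Quot J)"
    then show "\<exists>D\<in>carrier (A Quot J). D \<oplus>\<^bsub>A Quot J\<^esub> C = \<zero>\<^bsub>A Quot J\<^esub>"
      by (intro bexI[of _ "\<ominus>\<^bsub>A Quot J\<^esub> C"]) (simp_all add: Q.l_neg)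
  qed (simp_all add: Q.a_ac)
  have monoid: "monoid (quotient_algebra A J)"
    by (rule monoidI; unfold simps) (simp_all add: Q.m_assoc)
  have ring: "ring (quotient_algebra A J)"
    by (rule ringI[OF group monoid]; unfold simps)
      (simp_all add: Q.l_distr Q.r_distr)
  have module: "module R (quotient_algebra A J)"
  proof (rule moduleI[OF A.R.cring_axioms group]; unfold simps carrier_FactRing)
  qed (auto simp: smult A.smult_l_distr A.smult_r_distr A.smult_assoc1 simp flip: q.hom_add)
  show ?thesis
  proof (intro assoc_algebra.intro assoc_algebra_axioms.intro ring module;
      unfold simps carrier_FactRing)
  qed (auto simp: smult A.smult_mult_left A.smult_mult_right simp flip: q.hom_mult)
qed

section \<open>Descent to the quotient by the relations\<close>

context yangian_shuffle
begin

abbreviation Y_class :: "'i free_alg \<Rightarrow> 'i free_alg set" where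
  "Y_class f \<equiv> Y_ideal a d +>\<^bsub>free_algebra\<^esub> f"

lemma Y_class_eqD:
  assumes "Y_class f = Y_class g"
  shows "free_hom f = free_hom g"
proof -
  interpret J: ideal "Y_ideal a d" free_algebra by (rule ideal_Y_ideal)
  have "f \<in> Y_class g" using J.a_rcos_self[of f] assms by simp
  then obtain j where "j \<in> Y_ideal a d" "f = j + g" by (auto simp: a_r_coset_def')
  then have "free_map f = free_map g" by (simp add: free_map_add Y_ideal_kernel)
  then show ?thesis by (intro free_hom_eqI) (simp_all add: free_hom)
qed

text \<open>An arbitrary representative is evaluated; by \<open>Y_class_eqD\<close> the value
  depends on the class only.\<close>

definition Y_hom :: "'i free_alg set \<Rightarrow> 'i shuffle_elem" where
  "Y_hom C = free_hom (SOME f. Y_class f = C)"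

lemma Y_hom_class: "Y_hom (Y_class f) = free_hom f"
  unfolding Y_hom_def by (rule Y_class_eqD) (rule someI[of _ f], rule refl)

lemma carrier_Y_plus: "carrier (Y_plus a d) = range Y_class"
  by (simp add: Y_plus_def quotient_algebra_simps carrier_FactRing)

lemma assoc_algebra_hom_Y_hom: "assoc_algebra_hom Chbar (Y_plus a d) SHsph Y_hom"
proof -
  interpret J: ideal "Y_ideal a d" free_algebra by (rule ideal_Y_ideal)
  interpret q: ring_hom_ring free_algebra "free_algebra Quot Y_ideal a d" Y_class
    by (rule J.rcos_ring_hom_ring)
  have add: "Y_class f \<oplus>\<^bsub>Y_plus a d\<^esub> Y_class g = Y_class (f + g)"
    and mult: "Y_class f \<otimes>\<^bsub>Y_plus a d\<^esub> Y_class g = Y_class (f * g)"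
    and one: "\<one>\<^bsub>Y_plus a d\<^esub> = Y_class 1" for f g
    using q.hom_add[of f g] q.hom_mult[of f g] q.hom_one
    by (simp_all add: Y_plus_def quotient_algebra_simps)
  have smult: "c \<odot>\<^bsub>Y_plus a d\<^esub> Y_class f = Y_class (free_const c * f)" for c f
    using smult_coset[OF assoc_algebra_free_algebra ideal_Y_ideal, of c f] by (simp add: Y_plus_def)
  have "Y_hom \<in> ring_hom (Y_plus a d) SHsph"
    by (rule ring_hom_memI)
      (auto simp: carrier_Y_plus add mult one Y_hom_class SHsph_simps free_hom free_hom_add
        free_hom_mult free_hom_1)
  moreover have "assoc_algebra Chbar (Y_plus a d)"
    unfolding Y_plus_def by (rule assoc_algebra_quotient[OF assoc_algebra_free_algebra ideal_Y_ideal])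
  ultimately show ?thesis
    by (intro assoc_algebra_hom.intro assoc_algebra_hom_axioms.intro assoc_algebra_SHsph)
      (auto simp: carrier_Y_plus smult Y_hom_class SHsph_simps free_hom_const)
qed

lemma Y_hom_gen: "Y_hom (Y_gen a d k r) = lambda_power k r"
  by (simp add: Y_gen_def Y_hom_class free_hom_gen)

lemma Y_hom_surj: "Y_hom ` carrier (Y_plus a d) = carrier SHsph"
proof -
  have "Y_hom ` carrier (Y_plus a d) = range free_hom"
    by (simp add: carrier_Y_plus image_image Y_hom_class)
  also have "\<dots> = sph" using free_hom(1) free_hom_surj by blast
  finally show ?thesis by (simp add: SHsph_simps)
qed

end

theorem theorem5p1:
  fixes a :: "'i::{finite,linorder} \<Rightarrow> 'i \<Rightarrow> int" and d :: "'i \<Rightarrow> int"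
  assumes "symmetrizable_gcm a d"
  defines "SHsph \<equiv> spherical_algebra a d
             (Polynomial.smult (1/2) hbar) (Polynomial.smult (1/2) hbar) (- hbar)"
  shows "\<exists>\<Phi>. assoc_algebra_hom Chbar (Y_plus a d) SHsph \<Phi> \<and>
              (\<forall>k r. \<Phi> (Y_gen a d k r) = lambda_power k r) \<and>
              \<Phi> ` carrier (Y_plus a d) = carrier SHsph"
proof -
  interpret yangian_shuffle a d by unfold_locales (rule assms(1))
  show ?thesis
    unfolding SHsph_def using assoc_algebra_hom_Y_hom Y_hom_gen Y_hom_surj by blast
qed

end
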